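(* Let $1<p<\infty$, let $k$ be a polynomial that is not the zero polynomial, let $\phi$ be the functional with kernel $k$, let $F$ be the $A^p$ extremal function for $k$, and let $K(z)=\frac1z\int_0^z k(\zeta)\,d\zeta$. Then for every integer $m\ge 0$, \[ \frac1{2\pi}\int_0^{2\pi}|F(e^{i\theta})|^p e^{im\theta}\,d\theta = \frac{1}{2\pi\|\phi\|}\int_0^{2\pi} F(e^{i\theta})\,e^{im\theta}\Big[\frac p2\,\overline{k(e^{i\theta})}+\Big(1-\frac p2\Big)(m+1)\,\overline{K(e^{i\theta})}\Big]\,d\theta. \]
   Context: $\mathbb{D}$ is the open unit disc and $\sigma$ is normalized area measure on $\mathbb{D}$. For $1<p<\infty$, $A^p$ is the Bergman space of analytic $f$ on $\mathbb{D}$ with $\|f\|_{A^p}=(\int_{\mathbb{D}}|f|^p\,d\sigma)^{1/p}<\infty$, and $H^p$ is the Hardy space of analytic $f$ with $\|f\|_{H^p}=\sup_{0<r<1}(\frac1{2\pi}\int_0^{2\pi}|f(re^{i\theta})|^p d\theta)^{1/p}<\infty$; $H^p$ functions have radial boundary values $f(e^{i\theta})$ a.e. Let $q=p/(p-1)$. For $k\in A^q$, $k\not\equiv0$, the functional with kernel $k$ is $\phi(f)=\int_{\mathbb{D}} f\,\overline{k}\,d\sigma$ on $A^p$, with norm $\|\phi\|$ in $(A^p)^*$. The extremal function for $k$ is the unique $F\in A^p$ with $\|F\|_{A^p}=1$ and $\operatorname{Re}\phi(F)=\sup_{\|g\|_{A^p}=1}\operatorname{Re}\phi(g)=\|\phi\|$.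 (Such $F$ lies in $H^p$ when $k\in H^q$.) *)

theory Defs
  imports "HOL-Analysis.Analysis" "HOL-Computational_Algebra.Polynomial"
begin

definition disc_integral :: "(complex \<Rightarrow> complex) \<Rightarrow> complex" where
  "disc_integral f = (LINT z:ball 0 1|lborel. f z) / complex_of_real pi"

definition bergman_norm :: "real \<Rightarrow> (complex \<Rightarrow> complex) \<Rightarrow> real" where
  "bergman_norm p f = ((LINT z:ball 0 1|lborel. norm (f z) powr p) / pi) powr (1 / p)"

definition in_bergman :: "real \<Rightarrow> (complex \<Rightarrow> complex) \<Rightarrow> bool" where
  "in_bergman p f \<longleftrightarrow> f holomorphic_on ball 0 1 \<and>
     set_integrable lborel (ball 0 1) (\<lambda>z. norm (f z) powr p)"

definition kernel_functional :: "complex poly \<Rightarrow> (complex \<Rightarrow> complex) \<Rightarrow> complex" where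
  "kernel_functional k f = disc_integral (\<lambda>z. f z * cnj (poly k z))"

definition functional_norm :: "real \<Rightarrow> complex poly \<Rightarrow> real" where
  "functional_norm p k =
     Sup {norm (kernel_functional k g) | g. in_bergman p g \<and> bergman_norm p g = 1}"

definition is_extremal :: "real \<Rightarrow> complex poly \<Rightarrow> (complex \<Rightarrow> complex) \<Rightarrow> bool" where
  "is_extremal p k F \<longleftrightarrow> in_bergman p F \<and> bergman_norm p F = 1 \<and>
     Re (kernel_functional k F) =
       Sup {Re (kernel_functional k g) | g. in_bergman p g \<and> bergman_norm p g = 1}"

definition boundary_val :: "(complex \<Rightarrow> complex) \<Rightarrow> real \<Rightarrow> complex" where
  "boundary_val F \<theta> = Lim (at_left 1) (\<lambda>r::real. F (complex_of_real r * cis \<theta>))"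

text \<open>K(z) = (1/z) int_0^z k(zeta) dzeta, the integral taken along the segment [0,z]
  parametrized by zeta = t z, t in [0,1] (so d zeta = z dt).\<close>
definition primitive_avg :: "complex poly \<Rightarrow> complex \<Rightarrow> complex" where
  "primitive_avg k z = (1 / z) * (LINT t:{0..1}|lborel. poly k (complex_of_real t * z) * z)"

end

theory Submission
  imports Defs "HOL-Complex_Analysis.Cauchy_Integral_Formula"
begin

text \<open>
  Let \<open>J w = |w|\<^sup>p\<^sup>-\<^sup>2 w\<^sup>*\<close>, where \<open>w\<^sup>*\<close> is the conjugate, and \<open>F\<^sub>t(z) = F(e\<^sup>i\<^sup>t z)\<close>.
  Extremality of \<open>F\<close> means \<open>\<integral> J(F) f d\<sigma> = \<phi>(f) / \<parallel>\<phi>\<parallel>\<close> for all \<open>f\<close> in \<open>A\<^sup>p\<close>.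
  Applied to \<open>F\<close> and to its rotations, this turns \<open>\<integral> Re ((J(F) - J(F\<^sub>t)) (F - F\<^sub>t)) d\<sigma>\<close> into a
  second difference of the trigonometric polynomial \<open>t \<mapsto> \<phi>(F\<^sub>t)\<close>, so it is \<open>O(t\<^sup>2)\<close>.
  The strong monotonicity of \<open>J\<close> and Fatou's lemma give \<open>\<integral> |F|\<^sup>p\<^sup>-\<^sup>2 |z F'|\<^sup>2 d\<sigma> < \<infinity>\<close>, hence
  \<open>\<integral> |F|\<^sup>p\<^sup>-\<^sup>1 |z F'| d\<sigma> < \<infinity>\<close>. This single integrability replaces Ryabykh's theorem and Hardy space theory: by
  Fubini in polar coordinates almost every radius carries a limit of \<open>F\<close> and a bound that is integrable
  in the angle. Integrating \<open>2\<partial>\<^sub>z(z\<^sup>m\<^sup>+\<^sup>1 |F|\<^sup>p) = J(F) (2(m+1) z\<^sup>m F + p z\<^sup>m\<^sup>+\<^sup>1 F')\<close>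
  over the disc gives the left-hand side as boundary term. The two area integrals are values at \<open>t = 0\<close> of
  \<open>\<phi>(z\<^sup>m F\<^sub>t)\<close> and of its derivative, because the limit \<open>t \<rightarrow> 0\<close> may be taken under the integral. They are
  finite sums of Taylor coefficients of \<open>F\<close>, and so is the right-hand side.
\<close>

section \<open>Polar coordinates on the unit disc\<close>

text \<open>A priori \<open>F\<close> is only in the Bergman space: neither boundary values nor
  integrability of \<open>F'\<close> up to the circle is known, so Green's formula is not directly
  available. Rotations help because they preserve area: \<open>J(F_t)\<close> paired with
  \<open>F\<close> equals \<open>J(F)\<close> paired with \<open>F_{-t}\<close>, so every term of
  the expanded pairing is a value of the single functional \<open>\<phi>\<close>, and a polynomial
  kernel leaves only finitely many frequencies in t. For p < 2 the map \<open>J\<close> is not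
  differentiable at 0 and |F|^(p-2) blows up near zeros of \<open>F\<close>. The monotonicity
  inequality is therefore used for differences, with the larger modulus in the weight, and
  \<open>F'\<close> enters only in the limit. Near the circle no integrable majorant of the
  difference quotients is at hand; Young's inequality with a free parameter, played against the
  O(t^2) bound, gives smallness there uniformly in t. The two sides agree coefficient by coefficient
  through p/2 + (1 - p/2)(m+1)/(j+1) = (2(m+1) + p(j-m)) / (2(j+1)). The denominator j+1 comes from
  an area moment on one side and from K on the other.\<close>

abbreviation (input) polar :: "real \<Rightarrow> real \<Rightarrow> complex" where
  "polar r \<theta> \<equiv> of_real r * cis \<theta>"

text \<open>Lebesgue measure is determined by its values on boxes, and a complex box is a product of
  two intervals. This opens the way to Tonelli in real and imaginary part.\<close>

lemma lborel_complex_eq: "(lborel :: complex measure) = distr (lborel \<Otimes>\<^sub>M lborel) borel (\<lambda>(x, y). Complex x y)"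
proof (rule lborel_eqI)
  fix l u :: complex
  assume le: "\<And>b. b \<in> Basis \<Longrightarrow> l \<bullet> b \<le> u \<bullet> b"
  have [simp]: "Re l \<le> Re u" "Im l \<le> Im u"
    using le[of 1] le[of \<i>] by (auto simp: Basis_complex_def)
  have meas[measurable]: "(\<lambda>(x, y). Complex x y) \<in> borel_measurable (lborel \<Otimes>\<^sub>M lborel)"
    unfolding case_prod_unfold Complex_eq by measurable
  have "(\<lambda>(x, y). Complex x y) -` box l u \<inter> space (lborel \<Otimes>\<^sub>M lborel) = {Re l<..<Re u} \<times> {Im l<..<Im u}"
    by (auto simp: box_def Basis_complex_def space_pair_measure)
  then have "emeasure (distr (lborel \<Otimes>\<^sub>M lborel) borel (\<lambda>(x, y). Complex x y)) (box l u)
     = emeasure (lborel \<Otimes>\<^sub>M lborel) ({Re l<..<Re u} \<times> {Im l<..<Im u})"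
    by (subst emeasure_distr) auto
  also have "\<dots> = ennreal (Re u - Re l) * ennreal (Im u - Im l)"
    by (subst lborel.emeasure_pair_measure_Times) auto
  also have "\<dots> = (\<Prod>b\<in>Basis. (u - l) \<bullet> b)"
    by (simp add: Basis_complex_def ennreal_mult)
  finally show "emeasure (distr (lborel \<Otimes>\<^sub>M lborel) borel (\<lambda>(x, y). Complex x y)) (box l u) = (\<Prod>b\<in>Basis. (u - l) \<bullet> b)" .
qed simp

lemma measurable_Complex_pair [measurable]:
  "(\<lambda>(x, y). Complex x y) \<in> borel_measurable (lborel \<Otimes>\<^sub>M lborel)"
  unfolding case_prod_unfold Complex_eq by measurable

lemma nn_integral_complex_eq1:
  assumes [measurable]: "f \<in> borel_measurable borel"
  shows "(\<integral>\<^sup>+z. f z \<partial>lborel) = (\<integral>\<^sup>+y. (\<integral>\<^sup>+x. f (Complex x y) \<partial>lborel) \<partial>lborel)"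
proof -
  have [measurable]: "(\<lambda>(x, y). f (Complex x y)) \<in> borel_measurable (lborel \<Otimes>\<^sub>M lborel)"
    unfolding case_prod_unfold Complex_eq by measurable
  show ?thesis
    by (subst lborel_complex_eq, subst nn_integral_distr)
       (auto simp: lborel_pair.nn_integral_snd[symmetric] case_prod_unfold)
qed

lemma nn_integral_complex_eq2:
  assumes [measurable]: "f \<in> borel_measurable borel"
  shows "(\<integral>\<^sup>+z. f z \<partial>lborel) = (\<integral>\<^sup>+x. (\<integral>\<^sup>+y. f (Complex x y) \<partial>lborel) \<partial>lborel)"
proof -
  have [measurable]: "(\<lambda>(x, y). f (Complex x y)) \<in> borel_measurable (lborel \<Otimes>\<^sub>M lborel)"
    unfolding case_prod_unfold Complex_eq by measurable
  show ?thesis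
    by (subst lborel_complex_eq, subst nn_integral_distr)
       (auto simp: case_prod_unfold lborel.nn_integral_fst[symmetric])
qed

lemma nn_integral_lborel_shift:
  fixes f :: "real \<Rightarrow> ennreal"
  assumes [measurable]: "f \<in> borel_measurable borel"
  shows "(\<integral>\<^sup>+x. f (x + c) \<partial>lborel) = (\<integral>\<^sup>+x. f x \<partial>lborel)"
  using nn_integral_real_affine[OF assms, of 1 c] by (simp add: add.commute)

text \<open>On each horizontal line the shear is a translation, so the inner integral over x does
  not change.\<close>

lemma nn_integral_shear_Re:
  assumes [measurable]: "f \<in> borel_measurable borel"
  shows "(\<integral>\<^sup>+z. f (z + of_real (a * Im z)) \<partial>lborel) = (\<integral>\<^sup>+z. f z \<partial>lborel)"
proof -
  have "(\<integral>\<^sup>+z. f (z + of_real (a * Im z)) \<partial>lborel) = (\<integral>\<^sup>+y. (\<integral>\<^sup>+x. f (Complex x y + of_real (a * y)) \<partial>lborel) \<partial>lborel)"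
    by (subst nn_integral_complex_eq1) auto
  also have "\<dots> = (\<integral>\<^sup>+y. (\<integral>\<^sup>+x. f (Complex (x + a * y) y) \<partial>lborel) \<partial>lborel)"
    by (intro nn_integral_cong arg_cong[where f=f]) (auto simp: complex_eq_iff)
  also have "\<dots> = (\<integral>\<^sup>+y. (\<integral>\<^sup>+x. f (Complex x y) \<partial>lborel) \<partial>lborel)"
    by (intro nn_integral_cong nn_integral_lborel_shift[of "\<lambda>x. f (Complex x _)"]) (simp add: Complex_eq)
  finally show ?thesis
    by (simp add: nn_integral_complex_eq1)
qed

lemma nn_integral_shear_Im:
  assumes [measurable]: "f \<in> borel_measurable borel"
  shows "(\<integral>\<^sup>+z. f (z + \<i> * of_real (a * Re z)) \<partial>lborel) = (\<integral>\<^sup>+z. f z \<partial>lborel)"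
proof -
  have "(\<integral>\<^sup>+z. f (z + \<i> * of_real (a * Re z)) \<partial>lborel) = (\<integral>\<^sup>+x. (\<integral>\<^sup>+y. f (Complex x y + \<i> * of_real (a * x)) \<partial>lborel) \<partial>lborel)"
    by (subst nn_integral_complex_eq2) auto
  also have "\<dots> = (\<integral>\<^sup>+x. (\<integral>\<^sup>+y. f (Complex x (y + a * x)) \<partial>lborel) \<partial>lborel)"
    by (intro nn_integral_cong arg_cong[where f=f]) (auto simp: complex_eq_iff)
  also have "\<dots> = (\<integral>\<^sup>+x. (\<integral>\<^sup>+y. f (Complex x y) \<partial>lborel) \<partial>lborel)"
    by (intro nn_integral_cong nn_integral_lborel_shift[of "\<lambda>y. f (Complex _ y)"]) (simp add: Complex_eq)
  finally show ?thesis
    by (simp add: nn_integral_complex_eq2)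
qed

text \<open>A rotation by an angle other than \<open>\<pi>\<close> is a product of three shears.\<close>

lemma nn_integral_lborel_rotate:
  fixes c :: complex
  assumes f: "f \<in> borel_measurable borel" and c: "norm c = 1"
  shows "(\<integral>\<^sup>+z. f (c * z) \<partial>lborel) = (\<integral>\<^sup>+z. f z \<partial>lborel)"
proof -
  have main: "(\<integral>\<^sup>+z. f (c * z) \<partial>lborel) = (\<integral>\<^sup>+z. f z \<partial>lborel)"
    if [measurable]: "f \<in> borel_measurable borel" and c: "norm c = 1" "c \<noteq> -1" for f :: "complex \<Rightarrow> ennreal" and c
  proof -
    \<comment> \<open>For \<open>c = cis x\<close> these are \<open>a = - tan (x / 2)\<close> and
      \<open>b = sin x\<close>; the shears with parameters \<open>a\<close>, \<open>b\<close>,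
      \<open>a\<close> compose to the rotation by x.\<close>
    define a where "a = - Im c / (1 + Re c)"
    define b where "b = Im c"
    have *: "Re c ^ 2 + Im c ^ 2 = 1" using c(1) by (metis cmod_power2 one_power2)
    have ne: "1 + Re c \<noteq> 0"
    proof
      assume "1 + Re c = 0"
      then have "Re c = -1" by simp
      with * have "Im c = 0" by simp
      with \<open>Re c = -1\<close> c(2) show False by (simp add: complex_eq_iff)
    qed
    have a1: "1 + a * b = Re c"
      using * ne by (simp add: a_def b_def field_simps power2_eq_square)
    have a2: "a * (1 + Re c) = - Im c" using ne by (simp add: a_def)
    define g where "g z = f (z + of_real (a * Im z))" for z
    define h where "h z = g (z + \<i> * of_real (b * Re z))" for z
    have [measurable]: "g \<in> borel_measurable borel" "h \<in> borel_measurable borel"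
      unfolding g_def h_def by measurable
    have "f (c * z) = h (z + of_real (a * Im z))" for z
    proof -
      have "Re c * x - Im c * y = x + a * y + a * (y + b * (x + a * y))" for x y
      proof -
        have "x + a * y + a * (y + b * (x + a * y)) = (1 + a * b) * x + a * (1 + (1 + a * b)) * y"
          by (simp add: algebra_simps)
        then show ?thesis by (simp add: a1 a2)
      qed
      moreover have "Re c * y + Im c * x = y + b * (x + a * y)" for x y
        by (simp add: a1[symmetric] b_def algebra_simps)
      ultimately have "c * z = (let w = z + of_real (a * Im z); v = w + \<i> * of_real (b * Re w) in v + of_real (a * Im v))"
        by (simp add: complex_eq_iff Let_def)
      then show ?thesis by (simp add: h_def g_def Let_def)
    qed
    then have "(\<integral>\<^sup>+z. f (c * z) \<partial>lborel) = (\<integral>\<^sup>+z. h z \<partial>lborel)"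
      by (simp only: nn_integral_shear_Re[OF \<open>h \<in> borel_measurable borel\<close>])
    also have "\<dots> = (\<integral>\<^sup>+z. g z \<partial>lborel)"
      unfolding h_def by (rule nn_integral_shear_Im) simp
    also have "\<dots> = (\<integral>\<^sup>+z. f z \<partial>lborel)"
      unfolding g_def by (rule nn_integral_shear_Re) simp
    finally show ?thesis .
  qed
  show ?thesis
  proof (cases "c = -1")
    \<comment> \<open>Here the denominator of \<open>a\<close> vanishes; the half turn is performed
      as two quarter turns, -1 = \<open>\<i> * \<i>\<close>.\<close>
    case True
    note f[measurable]
    have [measurable]: "(\<lambda>z. f (\<i> * z)) \<in> borel_measurable borel" by measurable
    have "(\<integral>\<^sup>+z. f (c * z) \<partial>lborel) = (\<integral>\<^sup>+z. (\<lambda>z. f (\<i> * z)) (\<i> * z) \<partial>lborel)"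
      unfolding True by (simp add: mult.assoc[symmetric])
    also have "\<dots> = (\<integral>\<^sup>+z. f (\<i> * z) \<partial>lborel)"
      by (rule main) (auto simp: complex_eq_iff)
    also have "\<dots> = (\<integral>\<^sup>+z. f z \<partial>lborel)"
      by (rule main) (auto simp: complex_eq_iff)
    finally show ?thesis .
  next
    case False
    then show ?thesis by (intro main f c)
  qed
qed

lemma distr_lborel_rotate:
  fixes c :: complex
  assumes "norm c = 1"
  shows "distr lborel borel ((*) c) = lborel"
proof (rule measure_eqI)
  fix A assume "A \<in> sets (distr lborel borel ((*) c))"
  then have [measurable]: "A \<in> sets borel" by simp
  have [measurable]: "(*) c \<in> borel \<rightarrow>\<^sub>M borel" by measurable
  have "emeasure (distr lborel borel ((*) c)) A = (\<integral>\<^sup>+z. indicator A (c * z) \<partial>lborel)"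
    by (subst nn_integral_indicator[symmetric], simp, subst nn_integral_distr) auto
  also have "\<dots> = emeasure lborel A"
    by (subst nn_integral_lborel_rotate) (auto simp: assms)
  finally show "emeasure (distr lborel borel ((*) c)) A = emeasure lborel A" .
qed simp

text \<open>The shifted interval is cut at \<open>2 * pi\<close> and the protruding piece is moved
  back by one period. The cut points are counted twice, which is harmless almost everywhere.\<close>

lemma nn_integral_periodic_shift:
  fixes h :: "real \<Rightarrow> ennreal"
  assumes [measurable]: "h \<in> borel_measurable borel" and per: "\<And>x. h (x + 2 * pi) = h x"
    and \<alpha>: "0 \<le> \<alpha>" "\<alpha> \<le> 2 * pi"
  shows "(\<integral>\<^sup>+\<theta>\<in>{0..2*pi}. h (\<theta> + \<alpha>) \<partial>lborel) = (\<integral>\<^sup>+\<theta>\<in>{0..2*pi}. h \<theta> \<partial>lborel)"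
proof -
  have ae: "AE x in lborel. x \<noteq> \<alpha> \<and> x \<noteq> 2 * pi"
    using AE_lborel_singleton[of \<alpha>] AE_lborel_singleton[of "2*pi"] by eventually_elim auto
  have ae0: "AE x in lborel. x \<noteq> 0 \<and> x \<noteq> \<alpha>"
    using AE_lborel_singleton[of \<alpha>] AE_lborel_singleton[of "0::real"] by eventually_elim auto
  have "(\<integral>\<^sup>+\<theta>\<in>{0..2*pi}. h (\<theta> + \<alpha>) \<partial>lborel) = (\<integral>\<^sup>+\<theta>. h \<theta> * indicator {\<alpha>..2*pi+\<alpha>} \<theta> \<partial>lborel)"
    by (subst nn_integral_lborel_shift[where c=\<alpha>, symmetric, of "\<lambda>\<theta>. h \<theta> * indicator {\<alpha>..2*pi+\<alpha>} \<theta>"])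
       (auto intro!: nn_integral_cong simp: indicator_def)
  also have "\<dots> = (\<integral>\<^sup>+\<theta>. h \<theta> * indicator {\<alpha>..2*pi} \<theta> + h \<theta> * indicator {2*pi..2*pi+\<alpha>} \<theta> \<partial>lborel)"
  proof (rule nn_integral_cong_AE)
    show "AE \<theta> in lborel. h \<theta> * indicator {\<alpha>..2*pi+\<alpha>} \<theta> = h \<theta> * indicator {\<alpha>..2*pi} \<theta> + h \<theta> * indicator {2*pi..2*pi+\<alpha>} \<theta>"
      using ae by eventually_elim (use \<alpha> in \<open>auto simp: indicator_def\<close>)
  qed
  also have "\<dots> = (\<integral>\<^sup>+\<theta>. h \<theta> * indicator {\<alpha>..2*pi} \<theta> \<partial>lborel) + (\<integral>\<^sup>+\<theta>. h \<theta> * indicator {2*pi..2*pi+\<alpha>} \<theta> \<partial>lborel)"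
    by (rule nn_integral_add) auto
  also have "(\<integral>\<^sup>+\<theta>. h \<theta> * indicator {2*pi..2*pi+\<alpha>} \<theta> \<partial>lborel) = (\<integral>\<^sup>+\<theta>. h \<theta> * indicator {0..\<alpha>} \<theta> \<partial>lborel)"
    by (subst nn_integral_lborel_shift[where c="2*pi", symmetric, of "\<lambda>\<theta>. h \<theta> * indicator {2*pi..2*pi+\<alpha>} \<theta>"])
       (auto intro!: nn_integral_cong simp: indicator_def per)
  also have "(\<integral>\<^sup>+\<theta>. h \<theta> * indicator {\<alpha>..2*pi} \<theta> \<partial>lborel) + (\<integral>\<^sup>+\<theta>. h \<theta> * indicator {0..\<alpha>} \<theta> \<partial>lborel)
    = (\<integral>\<^sup>+\<theta>. h \<theta> * indicator {\<alpha>..2*pi} \<theta> + h \<theta> * indicator {0..\<alpha>} \<theta> \<partial>lborel)"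
    by (rule nn_integral_add[symmetric]) auto
  also have "\<dots> = (\<integral>\<^sup>+\<theta>\<in>{0..2*pi}. h \<theta> \<partial>lborel)"
  proof (rule nn_integral_cong_AE)
    show "AE \<theta> in lborel. h \<theta> * indicator {\<alpha>..2*pi} \<theta> + h \<theta> * indicator {0..\<alpha>} \<theta> = h \<theta> * indicator {0..2*pi} \<theta>"
      using ae0 by eventually_elim (use \<alpha> in \<open>auto simp: indicator_def\<close>)
  qed
  finally show ?thesis .
qed

text \<open>Both measures are compared on the rays \<open>{x<..}\<close>. The mass there is the area
  of an annulus, \<open>pi - pi * x^2\<close> for x between 0 and 1, and the density
  \<open>2 * pi * r\<close> is the derivative of the area of a disc.\<close>

lemma distr_norm_disc:
  "distr (density lborel (indicator (ball (0::complex) 1))) borel norm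
    = density lborel (\<lambda>r. ennreal (2 * pi * r) * indicator {0<..<1} r)" (is "?M = ?N")
proof (rule measure_eqI_lessThan)
  have M: "emeasure ?M {x<..} = emeasure lborel (ball (0::complex) 1 \<inter> {z. x < norm z})" for x
  proof -
    have [measurable]: "ball (0::complex) 1 \<in> sets borel" "{z::complex. x < norm z} \<in> sets borel" by measurable
    have "emeasure ?M {x<..} = emeasure (density lborel (indicator (ball (0::complex) 1))) {z. x < norm z}"
      by (subst emeasure_distr) (auto intro!: arg_cong2[where f=emeasure])
    also have "\<dots> = (\<integral>\<^sup>+z. indicator (ball (0::complex) 1) z * indicator {z. x < norm z} z \<partial>lborel)"
      by (subst emeasure_density) auto
    also have "\<dots> = (\<integral>\<^sup>+z. indicator (ball (0::complex) 1 \<inter> {z. x < norm z}) z \<partial>lborel)"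
      by (intro nn_integral_cong) (auto split: split_indicator)
    also have "\<dots> = emeasure lborel (ball (0::complex) 1 \<inter> {z. x < norm z})"
      by (subst nn_integral_indicator) auto
    finally show ?thesis .
  qed
  have N: "emeasure ?N {x<..} = (\<integral>\<^sup>+r. ennreal (2 * pi * r) * indicator {max 0 x<..<1} r \<partial>lborel)" for x
    by (subst emeasure_density) (auto intro!: nn_integral_cong split: split_indicator)
  have N': "(\<integral>\<^sup>+r. ennreal (2 * pi * r) * indicator {y<..<1} r \<partial>lborel) = ennreal (pi - pi * y^2)"
    if "0 \<le> y" "y \<le> 1" for y :: real
  proof -
    have ae: "AE r in lborel. r \<noteq> y \<and> r \<noteq> 1"
      using AE_lborel_singleton[of y] AE_lborel_singleton[of "1::real"] by eventually_elim auto
    have "(\<integral>\<^sup>+r. ennreal (2 * pi * r) * indicator {y<..<1} r \<partial>lborel) = (\<integral>\<^sup>+r. ennreal (2 * pi * r) * indicator {y..1} r \<partial>lborel)"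
    proof (rule nn_integral_cong_AE)
      show "AE r in lborel. ennreal (2 * pi * r) * indicator {y<..<1} r = ennreal (2 * pi * r) * indicator {y..1} r"
        using ae by eventually_elim (auto simp: indicator_def)
    qed
    also have "\<dots> = ennreal (pi * 1^2 - pi * y^2)"
      using that by (intro nn_integral_FTC_Icc[where F="\<lambda>r. pi * r^2"]) (auto intro!: derivative_eq_intros)
    finally show ?thesis by simp
  qed
  have vol: "emeasure lborel (ball (0::complex) 1 \<inter> {z. x < norm z}) = ennreal (pi - pi * (max 0 x)^2)" if "x < 1" for x
  proof (cases "x < 0")
    case True
    then have "x < norm z" for z :: complex using norm_ge_zero[of z] by linarith
    then have "ball (0::complex) 1 \<inter> {z. x < norm z} = ball 0 1" by auto
    then show ?thesis using True by (simp add: emeasure_ball unit_ball_vol_2 max_def)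
  next
    case False
    then have x0: "0 \<le> x" by simp
    have "ball (0::complex) 1 \<inter> {z. x < norm z} = ball 0 1 - cball 0 x" by auto
    then have "emeasure lborel (ball (0::complex) 1 \<inter> {z. x < norm z}) = emeasure lborel (ball (0::complex) 1) - emeasure lborel (cball (0::complex) x)"
    proof -
      have "cball (0::complex) x \<subseteq> ball 0 1" using that by (simp add: cball_subset_ball_iff)
      moreover have "emeasure lborel (cball (0::complex) x) \<noteq> \<infinity>"
        using emeasure_lborel_cball_finite[of "0::complex" x] by (rule less_imp_neq)
      ultimately show ?thesis 
        unfolding \<open>ball (0::complex) 1 \<inter> {z. x < norm z} = ball 0 1 - cball 0 x\<close>
        by (intro emeasure_Diff) simp_all
    qed
    also have "\<dots> = ennreal (pi - pi * x^2)"
    proof -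
      have 1: "emeasure lborel (ball (0::complex) 1) = ennreal pi"
        by (simp add: emeasure_ball unit_ball_vol_2)
      have 2: "emeasure lborel (cball (0::complex) x) = ennreal (pi * x\<^sup>2)"
        by (subst emeasure_cball[OF x0]) (simp add: unit_ball_vol_2)
      show ?thesis unfolding 1 2 by (rule ennreal_minus) simp
    qed
    finally show ?thesis using False by (simp add: max_def)
  qed
  have vol0: "emeasure ?M {x<..} = 0" "emeasure ?N {x<..} = 0" if "x \<ge> 1" for x
  proof -
    have "ball (0::complex) 1 \<inter> {z. x < norm z} = {}" using that by auto
    then show "emeasure ?M {x<..} = 0" unfolding M by simp
    show "emeasure ?N {x<..} = 0" unfolding N using that by simp
  qed
  show "emeasure ?M {x<..} = emeasure ?N {x<..}" for x
  proof (cases "x < 1")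
    case True
    then show ?thesis unfolding M N using N'[of "max 0 x"] by (simp add: vol)
  next
    case False
    then show ?thesis using vol0 by simp
  qed
  show "emeasure ?M {x<..} < \<infinity>" for x
  proof (cases "x < 1")
    case True
    then show ?thesis unfolding M by (simp add: vol)
  next
    case False
    then show ?thesis using vol0(1)[of x] by simp
  qed
qed auto

text \<open>No Jacobian is involved. Rotation invariance allows the integrand to be averaged over
  all angles, at the price of a factor \<open>2 * pi\<close>. After Tonelli the average
  \<open>g\<close> depends on \<open>norm z\<close> alone, so only the distribution of the norm on
  the disc is required.\<close>

theorem nn_integral_disc_polar:
  fixes f :: "complex \<Rightarrow> ennreal"
  assumes [measurable]: "f \<in> borel_measurable borel"
  shows "(\<integral>\<^sup>+z\<in>ball 0 1. f z \<partial>lborel)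
    = (\<integral>\<^sup>+r. (\<integral>\<^sup>+\<theta>. ennreal r * indicator {0<..<1} r * indicator {0..2*pi} \<theta> * f (polar r \<theta>) \<partial>lborel) \<partial>lborel)"
proof -
  have cis_meas[measurable]: "cis \<in> borel_measurable borel"
    by (intro borel_measurable_continuous_onI continuous_intros)
  define B where "B = ball (0::complex) 1"
  have [measurable]: "B \<in> sets borel" by (simp add: B_def)
  define g where "g z = (\<integral>\<^sup>+\<theta>\<in>{0..2*pi}. f (cis \<theta> * z) \<partial>lborel)" for z
  have [measurable]: "g \<in> borel_measurable borel"
    unfolding g_def by measurable
  have periodic: "cis (x + 2 * pi) = cis x" for x
    by (simp add: complex_eq_iff)
  have g_norm: "g z = g (of_real (norm z))" for z
  proof -
    have z: "z = of_real (norm z) * cis (Arg2pi z)"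
      using Arg2pi_eq[of z] by (simp add: cis_conv_exp)
    have "cis \<theta> * z = cis (\<theta> + Arg2pi z) * of_real (norm z)" for \<theta>
    proof -
      have "cis (\<theta> + Arg2pi z) * of_real (norm z) = cis \<theta> * (of_real (norm z) * cis (Arg2pi z))"
        by (simp only: cis_mult[symmetric] mult_ac)
      then show ?thesis by (simp only: z[symmetric])
    qed
    then have "g z = (\<integral>\<^sup>+\<theta>\<in>{0..2*pi}. f (cis (\<theta> + Arg2pi z) * of_real (norm z)) \<partial>lborel)"
      unfolding g_def by (simp only:)
    also have "\<dots> = (\<integral>\<^sup>+\<theta>\<in>{0..2*pi}. f (cis \<theta> * of_real (norm z)) \<partial>lborel)"
      by (rule nn_integral_periodic_shift[of "\<lambda>\<theta>. f (cis \<theta> * of_real (norm z))"])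
         (auto simp: Arg2pi_ge_0 Arg2pi_lt_2pi less_imp_le periodic)
    finally show ?thesis by (simp add: g_def)
  qed
  have rot: "(\<integral>\<^sup>+z\<in>B. f (cis \<theta> * z) \<partial>lborel) = (\<integral>\<^sup>+z\<in>B. f z \<partial>lborel)" for \<theta>
    by (subst nn_integral_lborel_rotate[where c="cis \<theta>", symmetric, of "\<lambda>z. f z * indicator B z"])
       (auto simp: B_def indicator_def norm_mult intro!: nn_integral_cong)
  have "ennreal (2 * pi) * (\<integral>\<^sup>+z\<in>B. f z \<partial>lborel) = (\<integral>\<^sup>+\<theta>\<in>{0..2*pi}. (\<integral>\<^sup>+z\<in>B. f (cis \<theta> * z) \<partial>lborel) \<partial>lborel)"
    by (simp only: rot, subst nn_integral_cmult_indicator) (auto simp: mult.commute)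
  also have "\<dots> = (\<integral>\<^sup>+\<theta>. (\<integral>\<^sup>+z. f (cis \<theta> * z) * indicator B z * indicator {0..2*pi} \<theta> \<partial>lborel) \<partial>lborel)"
    by (intro nn_integral_cong nn_integral_multc[symmetric]) measurable
  also have "\<dots> = (\<integral>\<^sup>+z. (\<integral>\<^sup>+\<theta>. f (cis \<theta> * z) * indicator B z * indicator {0..2*pi} \<theta> \<partial>lborel) \<partial>lborel)"
    by (rule lborel_pair.Fubini') measurable
  also have "\<dots> = (\<integral>\<^sup>+z. g z * indicator B z \<partial>lborel)"
  proof (intro nn_integral_cong)
    fix z
    have "g z * indicator B z = (\<integral>\<^sup>+\<theta>. f (cis \<theta> * z) * indicator {0..2*pi} \<theta> * indicator B z \<partial>lborel)"
      unfolding g_def by (rule nn_integral_multc[symmetric]) measurable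
    then show "(\<integral>\<^sup>+\<theta>. f (cis \<theta> * z) * indicator B z * indicator {0..2*pi} \<theta> \<partial>lborel) = g z * indicator B z"
      by (simp only: mult_ac)
  qed
  also have "\<dots> = (\<integral>\<^sup>+z. indicator B z * g (of_real (norm z)) \<partial>lborel)"
  proof (intro nn_integral_cong)
    fix z show "g z * indicator B z = indicator B z * g (of_real (norm z))"
      by (subst g_norm[of z]) (rule mult.commute)
  qed
  also have "\<dots> = (\<integral>\<^sup>+z. g (of_real (norm z)) \<partial>density lborel (indicator B))"
    by (subst nn_integral_density) auto
  also have "\<dots> = (\<integral>\<^sup>+r. g (of_real r) \<partial>distr (density lborel (indicator B)) borel norm)"
    by (subst nn_integral_distr) auto
  also have "\<dots> = (\<integral>\<^sup>+r. ennreal (2 * pi * r) * indicator {0<..<1} r * g (of_real r) \<partial>lborel)"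
    unfolding B_def distr_norm_disc by (subst nn_integral_density) auto
  also have "\<dots> = (\<integral>\<^sup>+r. ennreal (2 * pi) * (ennreal r * indicator {0<..<1} r * g (of_real r)) \<partial>lborel)"
  proof (intro nn_integral_cong)
    fix r :: real
    show "ennreal (2 * pi * r) * indicator {0<..<1} r * g (of_real r)
      = ennreal (2 * pi) * (ennreal r * indicator {0<..<1} r * g (of_real r))"
    proof (cases "r \<in> {0<..<1}")
      case True
      then have "ennreal (2 * pi * r) = ennreal (2 * pi) * ennreal r"
        by (intro ennreal_mult) auto
      then show ?thesis by (simp only: mult_ac)
    qed simp
  qed
  also have "\<dots> = ennreal (2 * pi) * (\<integral>\<^sup>+r. ennreal r * indicator {0<..<1} r * g (of_real r) \<partial>lborel)"
    by (intro nn_integral_cmult) auto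
  finally have "(\<integral>\<^sup>+z\<in>B. f z \<partial>lborel) = (\<integral>\<^sup>+r. ennreal r * indicator {0<..<1} r * g (of_real r) \<partial>lborel)"
    using ennreal_mult_cancel_left[of "ennreal (2 * pi)"] by simp
  also have "\<dots> = (\<integral>\<^sup>+r. (\<integral>\<^sup>+\<theta>. ennreal r * indicator {0<..<1} r * indicator {0..2*pi} \<theta> * f (polar r \<theta>) \<partial>lborel) \<partial>lborel)"
  proof (intro nn_integral_cong)
    fix r :: real
    have "ennreal r * indicator {0<..<1} r * g (of_real r) =
      (\<integral>\<^sup>+\<theta>. ennreal r * indicator {0<..<1} r * (f (cis \<theta> * of_real r) * indicator {0..2*pi} \<theta>) \<partial>lborel)"
      unfolding g_def by (rule nn_integral_cmult[symmetric]) measurable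
    then show "ennreal r * indicator {0<..<1} r * g (of_real r) =
      (\<integral>\<^sup>+\<theta>. ennreal r * indicator {0<..<1} r * indicator {0..2*pi} \<theta> * f (polar r \<theta>) \<partial>lborel)"
      by (simp only: mult_ac)
  qed
  finally show ?thesis by (simp add: B_def)
qed

lemma cis_borel_measurable [measurable]: "cis \<in> borel_measurable borel"
  by (intro borel_measurable_continuous_onI continuous_intros)

section \<open>Unnormalized area on the disc, and Lebesgue measure on radii and on angles\<close>

definition disc :: "complex measure" where
  "disc = restrict_space lborel (ball 0 1)"

definition radius :: "real measure" where
  "radius = restrict_space lborel {0<..<1}"

definition angle :: "real measure" where
  "angle = restrict_space lborel {0..2*pi}"

lemma space_disc [simp]: "space disc = ball 0 1"
  and space_radius [simp]: "space radius = {0<..<1}"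
  and space_angle [simp]: "space angle = {0..2*pi}"
  by (auto simp: disc_def radius_def angle_def space_restrict_space)

interpretation disc: finite_measure disc
  by (rule finite_measureI)
     (use emeasure_lborel_ball_finite[of "0::complex" 1] in
       \<open>auto simp: disc_def emeasure_restrict_space space_restrict_space\<close>)

interpretation radius: finite_measure radius
  by (rule finite_measureI) (simp add: radius_def emeasure_restrict_space space_restrict_space)

interpretation angle: finite_measure angle
  by (rule finite_measureI) (simp add: angle_def emeasure_restrict_space space_restrict_space)

interpretation polar: pair_sigma_finite radius angle ..

lemma set_integrable_disc_iff:
  fixes f :: "complex \<Rightarrow> 'a::{banach, second_countable_topology}"
  shows "set_integrable lborel (ball 0 1) f \<longleftrightarrow> integrable disc f"
  by (simp add: set_integrable_def disc_def integrable_restrict_space)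

lemma set_integral_disc_eq:
  fixes f :: "complex \<Rightarrow> 'a::{banach, second_countable_topology}"
  shows "(LINT z:ball 0 1|lborel. f z) = (\<integral>z. f z \<partial>disc)"
  by (simp add: set_lebesgue_integral_def disc_def integral_restrict_space)

lemma set_integral_angle_eq:
  fixes f :: "real \<Rightarrow> 'a::{banach, second_countable_topology}"
  shows "(LINT \<theta>:{0..2*pi}|lborel. f \<theta>) = (\<integral>\<theta>. f \<theta> \<partial>angle)"
  by (simp add: set_lebesgue_integral_def angle_def integral_restrict_space)

lemma continuous_on_measurable_disc:
  "continuous_on (ball 0 1) f \<Longrightarrow> f \<in> borel_measurable disc"
  unfolding disc_def
  using borel_measurable_continuous_on_restrict[of "ball 0 1" f]
  by (simp cong: measurable_cong_sets add: sets_restrict_space)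

lemma borel_measurable_disc [measurable (raw)]:
  "f \<in> borel_measurable borel \<Longrightarrow> f \<in> borel_measurable disc"
  unfolding disc_def by (rule measurable_restrict_space1) simp

lemma borel_measurable_radius [measurable (raw)]:
  "f \<in> borel_measurable borel \<Longrightarrow> f \<in> borel_measurable radius"
  unfolding radius_def by (rule measurable_restrict_space1) simp

lemma borel_measurable_angle [measurable (raw)]:
  "f \<in> borel_measurable borel \<Longrightarrow> f \<in> borel_measurable angle"
  unfolding angle_def by (rule measurable_restrict_space1) simp

abbreviation "polar_rect \<equiv> radius \<Otimes>\<^sub>M angle"

definition polar_point :: "real \<times> real \<Rightarrow> complex" where
  "polar_point x = of_real (fst x) * cis (snd x)"

lemma measurable_fst_snd_polar [measurable]:
  "fst \<in> borel_measurable polar_rect"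
  "snd \<in> borel_measurable polar_rect"
proof -
  have "(\<lambda>r::real. r) \<in> borel_measurable radius" "(\<lambda>r::real. r) \<in> borel_measurable angle"
    by (auto intro: borel_measurable_radius borel_measurable_angle)
  from measurable_compose[OF measurable_fst this(1)] measurable_compose[OF measurable_snd this(2)]
  show "fst \<in> borel_measurable polar_rect"
    "snd \<in> borel_measurable polar_rect" by auto
qed

lemma polar_point_measurable [measurable]:
  "polar_point \<in> polar_rect \<rightarrow>\<^sub>M disc"
proof -
  have "polar_point \<in> borel_measurable polar_rect"
    unfolding polar_point_def by measurable
  moreover have "polar_point \<in> space polar_rect \<rightarrow> ball 0 1"
    by (auto simp: polar_point_def space_pair_measure norm_mult)
  ultimately show ?thesis
    unfolding disc_def by (intro measurable_restrict_space2) (auto cong: measurable_cong_sets)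
qed

text \<open>Restating the formula for nonnegative integrands as an equality of measures transfers it
  to integrability and to Bochner integrals. The area factor r sits in the density, since
  \<open>radius\<close> itself carries plain dr.\<close>

lemma distr_polar_point:
  "distr (density polar_rect (\<lambda>x. ennreal (fst x))) disc polar_point
    = disc" (is "?M = _")
proof (rule measure_eqI)
  fix A assume "A \<in> sets ?M"
  then have A: "A \<in> sets disc" by simp
  then have A'[measurable]: "A \<in> sets borel" and sub: "A \<subseteq> ball 0 1"
    by (auto simp: disc_def sets_restrict_space)
  note A[measurable]
  have "emeasure ?M A = (\<integral>\<^sup>+x. indicator A (polar_point x) \<partial>density polar_rect (\<lambda>x. ennreal (fst x)))"
    by (subst nn_integral_indicator[symmetric], simp, subst nn_integral_distr) auto
  also have "\<dots> = (\<integral>\<^sup>+x. ennreal (fst x) * indicator A (polar_point x) \<partial>polar_rect)"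
    by (subst nn_integral_density) auto
  also have "\<dots> = (\<integral>\<^sup>+r. (\<integral>\<^sup>+\<theta>. ennreal r * indicator A (polar r \<theta>) \<partial>angle) \<partial>radius)"
    by (subst angle.nn_integral_fst[symmetric]) (auto simp: polar_point_def)
  also have "\<dots> = (\<integral>\<^sup>+r. (\<integral>\<^sup>+\<theta>. ennreal r * indicator {0<..<1} r * indicator {0..2*pi} \<theta> *
       indicator A (polar r \<theta>) \<partial>lborel) \<partial>lborel)"
    unfolding radius_def angle_def
    by (auto simp: nn_integral_restrict_space intro!: nn_integral_cong split: split_indicator)
  also have "\<dots> = (\<integral>\<^sup>+z\<in>ball 0 1. indicator A z \<partial>lborel)"
    by (rule nn_integral_disc_polar[symmetric]) simp
  also have "\<dots> = (\<integral>\<^sup>+z. indicator A z \<partial>disc)"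
    unfolding disc_def by (subst nn_integral_restrict_space) auto
  also have "\<dots> = emeasure disc A"
    by (rule nn_integral_indicator) simp
  finally show "emeasure ?M A = emeasure disc A" .
qed simp

context
  fixes f :: "complex \<Rightarrow> 'a::{banach, second_countable_topology}"
  assumes f[measurable]: "f \<in> borel_measurable disc"
begin

private lemma radius_nonneg: "AE x in polar_rect. 0 \<le> fst x"
  by (rule AE_I2) (auto simp: space_pair_measure)

lemma integrable_disc_polar:
  "integrable disc f \<longleftrightarrow>
   integrable polar_rect (\<lambda>x. fst x *\<^sub>R f (polar_point x))"
  by (subst (1) distr_polar_point[symmetric], subst integrable_distr_eq, simp, simp,
      subst integrable_density[OF _ _ radius_nonneg]) auto

lemma integral_disc_polar:
  "(\<integral>z. f z \<partial>disc) = (\<integral>x. fst x *\<^sub>R f (polar_point x) \<partial>polar_rect)"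
  by (subst (1) distr_polar_point[symmetric], subst integral_distr, simp, simp,
      subst integral_density[OF _ _ radius_nonneg]) auto

lemma disc_rotate:
  assumes "norm c = 1"
  shows integrable_disc_rotate: "integrable disc (\<lambda>z. f (c * z)) \<longleftrightarrow> integrable disc f" (is ?A)
  and integral_disc_rotate: "(\<integral>z. f (c * z) \<partial>disc) = (\<integral>z. f z \<partial>disc)" (is ?B)
proof -
  \<comment> \<open>Extension by zero to the whole plane, where rotation invariance of Lebesgue
    measure applies; the indicator of the disc is itself rotation invariant.\<close>
  define g where "g = (\<lambda>z. indicator (ball 0 1) z *\<^sub>R f z)"
  have g[measurable]: "g \<in> borel_measurable borel"
    using f by (simp add: g_def disc_def borel_measurable_restrict_space_iff)
  have [measurable]: "(*) c \<in> borel \<rightarrow>\<^sub>M borel" by measurable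
  have eq: "(\<lambda>z. indicator (ball 0 1) z *\<^sub>R f (c * z)) = (\<lambda>z. g (c * z))"
    using assms by (auto simp: g_def indicator_def norm_mult)
  show ?A
    unfolding set_integrable_disc_iff[symmetric] set_integrable_def eq g_def[symmetric]
    by (subst (2) distr_lborel_rotate[OF assms, symmetric], subst integrable_distr_eq) auto
  show ?B
    unfolding set_integral_disc_eq[symmetric] set_lebesgue_integral_def eq g_def[symmetric]
    by (subst (2) distr_lborel_rotate[OF assms, symmetric], subst integral_distr) auto
qed

end

section \<open>The duality map of the Bergman space\<close>

text \<open>Up to the factor p this is the gradient of |w|^p: the derivative in direction v is
  \<open>p * Re (dual_power p w * v)\<close>. The conjugate is built in so that all pairings are
  plain products.\<close>

definition dual_power :: "real \<Rightarrow> complex \<Rightarrow> complex" where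
  "dual_power p w = of_real (norm w powr (p - 2)) * cnj w"

lemma dual_power_0 [simp]: "dual_power p 0 = 0"
  by (simp add: dual_power_def)

lemma norm_dual_power: "norm (dual_power p w) = norm w powr (p - 1)"
proof (cases "w = 0")
  case False
  then have "norm w powr (p - 1) = norm w powr (p - 2) * norm w"
    by (simp add: powr_diff power2_eq_square)
  then show ?thesis by (simp add: dual_power_def norm_mult)
qed (simp add: dual_power_def)

lemma dual_power_mult_self: "dual_power p w * w = of_real (norm w powr p)"
proof (cases "w = 0")
  case False
  then have "norm w powr p = norm w powr (p - 2) * (norm w)^2"
    by (simp add: powr_diff)
  moreover have "cnj w * w = of_real ((norm w)^2)"
    by (metis complex_norm_square mult.commute of_real_power)
  ultimately show ?thesis by (simp add: dual_power_def mult.assoc)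
qed (simp add: dual_power_def)

text \<open>Away from 0 both factors are continuous. At 0 the first factor may blow up when p < 2,
  but the modulus of the product is |w|^(p-1), which tends to 0 because p > 1.\<close>

lemma continuous_on_dual_power:
  assumes "1 < p"
  shows "continuous_on UNIV (dual_power p)"
proof -
  have "isCont (dual_power p) w" for w
  proof (cases "w = 0")
    case True
    have "((\<lambda>w::complex. norm w powr (p - 1)) \<longlongrightarrow> norm (0::complex) powr (p - 1)) (at 0)"
      using assms by (intro tendsto_powr' tendsto_intros) auto
    then have "((\<lambda>w. norm (dual_power p w)) \<longlongrightarrow> 0) (at 0)"
      using assms by (simp add: norm_dual_power)
    then have "(dual_power p \<longlongrightarrow> 0) (at 0)"
      by (simp only: tendsto_norm_zero_iff)
    then show ?thesis
      unfolding True isCont_def by simp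
  next
    case False
    then show ?thesis unfolding dual_power_def[abs_def] by (intro continuous_intros) auto
  qed
  then show ?thesis by (simp add: continuous_at_imp_continuous_on)
qed

lemma cnj_borel_measurable [measurable]: "cnj \<in> borel_measurable borel"
  by (intro borel_measurable_continuous_onI continuous_intros)

lemma dual_power_measurable [measurable]: "dual_power p \<in> borel_measurable borel"
  unfolding dual_power_def[abs_def] by measurable

section \<open>Derivative of a power of the modulus along a curve\<close>

lemma has_vector_derivative_imp_quotient_tendsto:
  fixes \<gamma> :: "real \<Rightarrow> 'a::real_normed_vector"
  assumes "(\<gamma> has_vector_derivative v) (at t)"
  shows "((\<lambda>s. (\<gamma> s - \<gamma> t) /\<^sub>R (s - t)) \<longlongrightarrow> v) (at t)"
proof (rule LIM_zero_cancel)
  have "((\<lambda>s. norm ((1 / norm (s - t)) *\<^sub>R (\<gamma> s - (\<gamma> t + (s - t) *\<^sub>R v)))) \<longlongrightarrow> 0) (at t)"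
    by (rule tendsto_norm_zero) (use assms in \<open>unfold has_vector_derivative_def has_derivative_within, blast\<close>)
  moreover have "norm ((1 / norm (s - t)) *\<^sub>R (\<gamma> s - (\<gamma> t + (s - t) *\<^sub>R v))) = norm ((\<gamma> s - \<gamma> t) /\<^sub>R (s - t) - v)"
    if "s \<noteq> t" for s
  proof -
    have "(\<gamma> s - \<gamma> t) /\<^sub>R (s - t) - v = (1 / (s - t)) *\<^sub>R (\<gamma> s - (\<gamma> t + (s - t) *\<^sub>R v))"
      using that by (simp add: scaleR_diff_right scaleR_add_right inverse_eq_divide)
    then show ?thesis by simp
  qed
  ultimately have "((\<lambda>s. norm ((\<gamma> s - \<gamma> t) /\<^sub>R (s - t) - v)) \<longlongrightarrow> 0) (at t)"
    by (elim Lim_transform_eventually) (auto simp: eventually_at_filter)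
  then show "((\<lambda>s. (\<gamma> s - \<gamma> t) /\<^sub>R (s - t) - v) \<longlongrightarrow> 0) (at t)"
    by (simp only: tendsto_norm_zero_iff)
qed

text \<open>Where the curve avoids 0 this is the chain rule. At a zero the modulus need not be
  differentiable, but |\<gamma>(s)|^p / |s - t| is |\<gamma>(s)| / |s - t|, which tends to |v|,
  times |\<gamma>(s)|^(p-1), which tends to 0.\<close>

lemma has_real_derivative_norm_powr:
  fixes \<gamma> :: "real \<Rightarrow> complex"
  assumes p: "1 < p" and \<gamma>: "(\<gamma> has_vector_derivative v) (at t)"
  shows "((\<lambda>s. norm (\<gamma> s) powr p) has_real_derivative p * Re (dual_power p (\<gamma> t) * v)) (at t)"
proof (cases "\<gamma> t = 0")
  case False
  have "((\<lambda>s. norm (\<gamma> s)) has_derivative (\<lambda>h. (h *\<^sub>R v) \<bullet> sgn (\<gamma> t))) (at t)"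
    by (rule has_derivative_compose[OF \<gamma>[unfolded has_vector_derivative_def] has_derivative_norm[OF False]])
  moreover have "(\<lambda>h. (h *\<^sub>R v) \<bullet> sgn (\<gamma> t)) = (*) (v \<bullet> sgn (\<gamma> t))"
    by (auto simp: mult.commute)
  ultimately have "((\<lambda>s. norm (\<gamma> s)) has_real_derivative v \<bullet> sgn (\<gamma> t)) (at t)"
    by (simp add: has_field_derivative_def)
  then have d: "((\<lambda>s. norm (\<gamma> s) powr p) has_real_derivative p * norm (\<gamma> t) powr (p - 1) * (v \<bullet> sgn (\<gamma> t))) (at t)"
    using False by (auto intro!: derivative_eq_intros has_real_derivative_powr' simp: powr_diff) 
  have "norm (\<gamma> t) powr (p - 1) * (v \<bullet> sgn (\<gamma> t)) = Re (dual_power p (\<gamma> t) * v)"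
    using False by (simp add: dual_power_def inner_complex_def sgn_eq powr_diff power2_eq_square algebra_simps add_divide_distrib)
  then show ?thesis using d by (simp add: mult.assoc)
next
  case True
  have "((\<lambda>s. (\<gamma> s - \<gamma> t) /\<^sub>R (s - t)) \<longlongrightarrow> v) (at t)"
    by (rule has_vector_derivative_imp_quotient_tendsto[OF \<gamma>])
  then have 1: "((\<lambda>s. norm (\<gamma> s /\<^sub>R (s - t))) \<longlongrightarrow> norm v) (at t)"
    by (intro tendsto_norm) (simp add: True)
  have "(\<gamma> \<longlongrightarrow> 0) (at t)"
    using has_vector_derivative_continuous[OF \<gamma>] True by (simp add: continuous_within)
  then have "((\<lambda>s. norm (\<gamma> s) powr (p - 1)) \<longlongrightarrow> 0 powr (p - 1)) (at t)"
    using p by (intro tendsto_powr') (auto simp: tendsto_norm_zero_iff)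
  from tendsto_mult[OF 1 this] have "((\<lambda>s. norm (\<gamma> s /\<^sub>R (s - t)) * norm (\<gamma> s) powr (p - 1)) \<longlongrightarrow> 0) (at t)"
    using p by simp
  moreover have "norm (\<gamma> s /\<^sub>R (s - t)) * norm (\<gamma> s) powr (p - 1) = norm (norm (\<gamma> s) powr p / (s - t))" for s
  proof (cases "\<gamma> s = 0")
    case False
    then show ?thesis by (simp add: powr_diff abs_mult field_simps)
  qed simp
  ultimately have "((\<lambda>s. norm (norm (\<gamma> s) powr p / (s - t))) \<longlongrightarrow> 0) (at t)"
    by simp
  then have "((\<lambda>s. norm (\<gamma> s) powr p / (s - t)) \<longlongrightarrow> 0) (at t)"
    by (simp only: tendsto_norm_zero_iff)
  then show ?thesis
    using p by (simp add: has_field_derivative_iff True dual_power_def)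
qed

section \<open>Strong monotonicity of the duality map and inequalities of Young type\<close>

lemma powr_diff_lower_bound:
  fixes x y p :: real
  assumes p: "1 < p" and y: "0 < y" "y \<le> x"
  shows "min (1 / 2) (p - 1) * x powr (p - 2) * (x - y) \<le> x powr (p - 1) - y powr (p - 1)"
proof (cases "p \<ge> 2")
  case True
  have "y powr (p - 1) = y powr (p - 2) * y"
    using y by (simp add: powr_diff power2_eq_square)
  also have "\<dots> \<le> x powr (p - 2) * y"
    using y True by (intro mult_right_mono powr_mono2) auto
  finally have "y powr (p - 1) \<le> x powr (p - 2) * y" .
  moreover have "x powr (p - 1) = x powr (p - 2) * x"
    using y by (simp add: powr_diff power2_eq_square)
  ultimately have "x powr (p - 2) * (x - y) \<le> x powr (p - 1) - y powr (p - 1)"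
    by (simp add: algebra_simps)
  moreover have "min (1 / 2) (p - 1) * (x powr (p - 2) * (x - y)) \<le> 1 * (x powr (p - 2) * (x - y))"
    using y p by (intro mult_right_mono) auto
  ultimately show ?thesis by (simp add: mult.assoc)
next
  case False
  show ?thesis
  proof (cases "x = y")
    case ne: False
    with y have "y < x" by simp
    have "\<exists>z>y. z < x \<and> x powr (p - 1) - y powr (p - 1) = (x - y) * ((p - 1) * z powr (p - 1 - 1))"
      by (rule MVT2[OF \<open>y < x\<close>]) (rule has_real_derivative_powr, use y in linarith)
    then obtain z where z: "y < z" "z < x" "x powr (p - 1) - y powr (p - 1) = (x - y) * ((p - 1) * z powr (p - 2))"
      by auto
    have "x powr (p - 2) \<le> z powr (p - 2)"
      using z y False by (intro powr_mono2') auto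
    then have "min (1 / 2) (p - 1) * x powr (p - 2) \<le> (p - 1) * z powr (p - 2)"
      using p by (intro mult_mono) auto
    from mult_right_mono[OF this, of "x - y"] show ?thesis
      unfolding z(3) using y by (simp add: mult_ac)
  qed simp
qed

text \<open>With x = |a| at least y = |b| and R the real part of \<open>cnj a * b\<close>, the
  pairing splits into a radial part (x - y)(x^(p-1) - y^(p-1)) and an angular part (x^(p-2) +
  y^(p-2))(xy - R), while |a - b|^2 = (x - y)^2 + 2(xy - R). \<open>powr_diff_lower_bound\<close>
  controls the radial part, with p - 1 coming from the mean value theorem when p < 2. The 1/2 in the
  constant lets the weight of the larger modulus alone absorb the 2 in front of xy - R.\<close>

lemma dual_power_strongly_monotone:
  assumes p: "1 < p"
  shows "min (1 / 2) (p - 1) * max (norm a) (norm b) powr (p - 2) * (norm (a - b))\<^sup>2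
    \<le> Re ((dual_power p a - dual_power p b) * (a - b))"
proof -
  have main: "min (1 / 2) (p - 1) * norm a powr (p - 2) * (norm (a - b))\<^sup>2
    \<le> Re ((dual_power p a - dual_power p b) * (a - b))" if le: "norm b \<le> norm a" for a b
  proof (cases "b = 0")
    case True
    have "min (1 / 2) (p - 1) * (norm a powr (p - 2) * (norm a)\<^sup>2) \<le> 1 * (norm a powr (p - 2) * (norm a)\<^sup>2)"
      using p by (intro mult_right_mono) auto
    moreover have "norm a powr (p - 2) * (norm a)\<^sup>2 = Re (dual_power p a * a)"
      unfolding dual_power_mult_self by (cases "a = 0") (auto simp: powr_diff)
    moreover have "Re ((dual_power p a - dual_power p b) * (a - b)) = Re (dual_power p a * a)"
      by (simp only: True dual_power_0 diff_zero)
    ultimately show ?thesis by (simp only: True diff_zero mult_1 mult.assoc)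
  next
    case False
    define x y R c where "x = norm a" and "y = norm b" and "R = Re (cnj a * b)" and "c = min (1 / 2) (p - 1)"
    have xy: "0 < y" "y \<le> x" "0 < x" using False le by (auto simp: x_def y_def less_le_trans)
    have R: "R \<le> x * y"
      unfolding R_def x_def y_def using complex_Re_le_cmod[of "cnj a * b"] by (simp add: norm_mult)
    have c: "0 \<le> c" "c \<le> 1 / 2" using p by (auto simp: c_def min_def)
    have sq: "Re a * Re a + Im a * Im a = x * x" "Re b * Re b + Im b * Im b = y * y"
      unfolding x_def y_def by (metis cmod_power2 power2_eq_square)+
    have nab: "(norm (a - b))\<^sup>2 = (x - y)^2 + 2 * (x * y - R)"
      unfolding cmod_power2 R_def using sq by (simp add: power2_eq_square algebra_simps)
    have "Re ((dual_power p a - dual_power p b) * (a - b)) = x powr (p - 2) * (x * x - R) + y powr (p - 2) * (y * y - R)"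
      unfolding dual_power_def x_def[symmetric] y_def[symmetric] sq[symmetric] R_def by (simp add: algebra_simps)
    also have "\<dots> = (x - y) * (x powr (p - 1) - y powr (p - 1)) + (x powr (p - 2) + y powr (p - 2)) * (x * y - R)"
    proof -
      have "x powr (p - 1) = x powr (p - 2) * x" "y powr (p - 1) = y powr (p - 2) * y"
        using xy by (simp_all add: powr_diff power2_eq_square)
      then show ?thesis by (simp add: algebra_simps)
    qed
    also have "\<dots> \<ge> (x - y) * (c * x powr (p - 2) * (x - y)) + (2 * c * x powr (p - 2)) * (x * y - R)"
    proof (intro add_mono mult_left_mono mult_right_mono)
      show "c * x powr (p - 2) * (x - y) \<le> x powr (p - 1) - y powr (p - 1)"
        unfolding c_def by (rule powr_diff_lower_bound) (use p xy in auto)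
      have "2 * c * x powr (p - 2) \<le> 1 * x powr (p - 2)"
        using c by (intro mult_right_mono) auto
      then show "2 * c * x powr (p - 2) \<le> x powr (p - 2) + y powr (p - 2)"
        using powr_ge_zero[of y "p - 2"] by linarith
    qed (use xy R in auto)
    finally show ?thesis
      unfolding nab x_def[symmetric] c_def[symmetric] by (simp add: power2_eq_square algebra_simps)
  qed
  show ?thesis
  proof (cases "norm b \<le> norm a")
    case True
    then show ?thesis using main[OF True] by (simp add: max_def)
  next
    case False
    then have "norm a \<le> norm b" by simp
    from main[OF this] False show ?thesis
      by (simp add: max_def norm_minus_commute algebra_simps)
  qed
qed

lemma dual_power_monotone:
  assumes "1 < p"
  shows "0 \<le> Re ((dual_power p a - dual_power p b) * (a - b))"
  by (rule order_trans[OF _ dual_power_strongly_monotone[OF assms]]) (use assms in auto)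

text \<open>The square of |a| - l|v| is nonnegative; dividing by l and multiplying by |a|^(p-2)
  gives the claim. The free parameter \<open>l\<close> shifts weight between the two terms.\<close>

lemma norm_powr_mult_norm_le:
  fixes a v :: complex
  assumes l: "0 < l"
  shows "norm a powr (p - 1) * norm v \<le> (norm a powr p / l + l * (norm a powr (p - 2) * (norm v)\<^sup>2)) / 2"
proof (cases "a = 0")
  case False
  define s where "s = norm a"
  have s: "s > 0" using False by (simp add: s_def)
  have "s powr p = s powr (p - 2) * s\<^sup>2" "s powr (p - 1) = s powr (p - 2) * s"
    using s by (auto simp: powr_diff power2_eq_square)
  moreover have "s * norm v \<le> (s\<^sup>2 / l + l * (norm v)\<^sup>2) / 2"
  proof -
    have "0 \<le> (s - l * norm v)\<^sup>2 / l" using l by simp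
    also have "\<dots> = s\<^sup>2 / l + l * (norm v)\<^sup>2 - 2 * (s * norm v)"
      using l by (simp add: power2_eq_square field_simps)
    finally show ?thesis by simp
  qed
  from mult_left_mono[OF this, of "s powr (p - 2)"] have
    "s powr (p - 2) * (s * norm v) \<le> s powr (p - 2) * ((s\<^sup>2 / l + l * (norm v)\<^sup>2) / 2)" by simp
  ultimately show ?thesis unfolding s_def[symmetric] by (simp add: algebra_simps)
qed simp

text \<open>Replacing \<open>a\<close> on the left by whichever of \<open>a\<close>,
  \<open>b\<close> has the larger modulus produces exactly the weight for which strong monotonicity
  is available.\<close>

lemma norm_powr_mult_diff_le:
  fixes a b :: complex
  assumes p: "1 < p" and l: "0 < l"
  shows "norm a powr (p - 1) * norm (a - b) \<le> (norm a powr p + norm b powr p) / l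
     + l / min (1 / 2) (p - 1) * Re ((dual_power p a - dual_power p b) * (a - b))"
proof -
  define c where "c = min (1 / 2) (p - 1)"
  have c: "c > 0" using p by (simp add: c_def)
  define m where "m = (if norm b \<le> norm a then a else b)"
  have m: "norm m = max (norm a) (norm b)" by (simp add: m_def)
  have half: "x / 2 \<le> x" if "0 \<le> x" for x :: real using that by simp
  have "norm a powr (p - 1) * norm (a - b) \<le> norm m powr (p - 1) * norm (a - b)"
    using p by (intro mult_right_mono powr_mono2) (auto simp: m)
  also have "\<dots> \<le> (norm m powr p / l + l * (norm m powr (p - 2) * (norm (a - b))\<^sup>2)) / 2"
    by (rule norm_powr_mult_norm_le[OF l])
  also have "\<dots> \<le> norm m powr p / l + l * (norm m powr (p - 2) * (norm (a - b))\<^sup>2)"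
  proof -
    have "0 \<le> norm m powr p / l + l * (norm m powr (p - 2) * (norm (a - b))\<^sup>2)"
      using l by (intro add_nonneg_nonneg mult_nonneg_nonneg divide_nonneg_pos) auto
    then show ?thesis by (rule half)
  qed
  also have "\<dots> \<le> (norm a powr p + norm b powr p) / l + l * (Re ((dual_power p a - dual_power p b) * (a - b)) / c)"
  proof (intro add_mono divide_right_mono mult_left_mono)
    show "norm m powr p \<le> norm a powr p + norm b powr p" by (auto simp: m_def)
    show "norm m powr (p - 2) * (norm (a - b))\<^sup>2 \<le> Re ((dual_power p a - dual_power p b) * (a - b)) / c"
      using dual_power_strongly_monotone[OF p, of a b] c unfolding m c_def[symmetric] by (simp add: field_simps)
  qed (use l in auto)
  finally show ?thesis by (simp add: c_def)
qed

section \<open>Fourier coefficients on circles and moments on the disc\<close>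

lemma cis_has_vector_derivative:
  "((\<lambda>\<theta>. cis (a * \<theta>)) has_vector_derivative (\<i> * of_real a * cis (a * \<theta>))) (at \<theta> within S)"
proof -
  have "((\<lambda>z. exp (\<i> * of_real a * z)) has_field_derivative (\<i> * of_real a * exp (\<i> * of_real a * of_real \<theta>))) (at (of_real \<theta>))"
    by (auto intro!: derivative_eq_intros)
  from has_vector_derivative_real_field[OF this] show ?thesis
    by (simp add: cis_conv_exp mult.assoc)
qed

lemma cis_power_mult_cnj: "cis t ^ m * cnj (cis t) ^ j = cis ((real m - real j) * t)"
  by (simp only: cis_cnj Complex.DeMoivre cis_mult) (simp add: algebra_simps)

lemma integral_angle_FTC:
  fixes G :: "real \<Rightarrow> complex"
  assumes "\<And>\<theta>. (G has_vector_derivative g \<theta>) (at \<theta>)" and "continuous_on UNIV g"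
    and "G (2 * pi) = G 0"
  shows "(\<integral>\<theta>. g \<theta> \<partial>angle) = 0"
proof -
  have "(\<integral>\<theta>. g \<theta> \<partial>angle) = (\<integral>\<theta>. indicator {0..2*pi} \<theta> *\<^sub>R g \<theta> \<partial>lborel)"
    by (simp add: set_integral_angle_eq[symmetric] set_lebesgue_integral_def)
  also have "\<dots> = G (2 * pi) - G 0"
    using assms by (intro integral_FTC_atLeastAtMost)
      (auto intro: has_vector_derivative_at_within continuous_on_subset)
  finally show ?thesis using assms(3) by simp
qed

lemma cis_int_2pi: "cis (of_int l * (2 * pi)) = 1"
  using cis_multiple_2pi[of "of_int l"] by (simp add: mult.commute mult.assoc)

lemma integral_angle_cis:
  "(\<integral>\<theta>. cis (of_int l * \<theta>) \<partial>angle) = (if l = 0 then of_real (2 * pi) else 0)"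
proof (cases "l = 0")
  case True
  have "measure angle (space angle) = 2 * pi"
    unfolding angle_def by (simp add: measure_restrict_space space_restrict_space)
  then show ?thesis using True by (simp add: scaleR_conv_of_real)
next
  case False
  have "((\<lambda>\<theta>. cis (of_int l * \<theta>) / (\<i> * of_real (of_int l))) has_vector_derivative cis (of_int l * \<theta>)) (at \<theta>)" for \<theta>
    using has_vector_derivative_divide[OF cis_has_vector_derivative[of "of_int l" \<theta> UNIV], of "\<i> * of_real (of_int l)"] False
    by simp
  moreover have "continuous_on UNIV (\<lambda>\<theta>. cis (of_int l * \<theta>))"
    by (intro continuous_intros)
  ultimately have "(\<integral>\<theta>. cis (of_int l * \<theta>) \<partial>angle) = 0"
    by (rule integral_angle_FTC) (simp add: cis_int_2pi)
  then show ?thesis using False by simp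
qed

text \<open>Indexed by integers, with 0 at negative indices, so that index differences such as
  \<open>int j - int m\<close> need no case distinction.\<close>

definition taylor_coeff :: "(complex \<Rightarrow> complex) \<Rightarrow> int \<Rightarrow> complex" where
  "taylor_coeff f l = (if l < 0 then 0 else (deriv ^^ nat l) f 0 / fact (nat l))"

text \<open>Termwise integration of the Taylor series. The frequency is \<open>l\<close>, not
  \<open>- l\<close>, so the surviving term is the one of index \<open>- l\<close>; for positive
  \<open>l\<close> there is none.\<close>

lemma circle_coefficient:
  assumes f: "f holomorphic_on ball 0 1" and r: "0 \<le> r" "r < 1"
  shows "(\<integral>\<theta>. f (polar r \<theta>) * cis (of_int l * \<theta>) \<partial>angle)
    = of_real (2 * pi * r ^ nat (- l)) * taylor_coeff f (- l)"
proof -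
  define a where "a n = (deriv ^^ n) f 0 / fact n" for n
  have s: "(\<lambda>n. a n * w ^ n) sums f w" if "norm w < 1" for w
    using holomorphic_power_series[OF f, of w] that by (simp add: a_def)
  \<comment> \<open>A radius strictly between \<open>r\<close> and 1: convergence at
    \<open>R\<close> yields absolute convergence at \<open>r\<close>.\<close>
  define R where "R = (r + 1) / 2"
  have R: "r < R" "R < 1" "0 < R" using r by (auto simp: R_def)
  have "summable (\<lambda>n. a n * of_real R ^ n)"
    using s[of "of_real R"] R by (auto simp: sums_iff)
  then have sm: "summable (\<lambda>n. norm (a n * of_real r ^ n))"
    by (rule powser_insidea) (use R r in auto)
  have eq: "norm (a n * (polar r \<theta>) ^ n * cis (of_int l * \<theta>)) = norm (a n * of_real r ^ n)" for n \<theta>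
    by (simp add: norm_mult norm_power power_mult_distrib)
  have [measurable]: "(\<lambda>\<theta>. a n * (polar r \<theta>) ^ n * cis (of_int l * \<theta>)) \<in> borel_measurable angle" for n
    by measurable
  have int: "(\<integral>\<theta>. a n * (polar r \<theta>) ^ n * cis (of_int l * \<theta>) \<partial>angle)
     = (if n = nat (- l) \<and> l \<le> 0 then a n * of_real (r ^ n) * of_real (2 * pi) else 0)" for n
  proof -
    have "a n * (polar r \<theta>) ^ n * cis (of_int l * \<theta>) = a n * of_real (r ^ n) * cis (of_int (int n + l) * \<theta>)" for \<theta>
    proof -
      have "cis (of_int (int n + l) * \<theta>) = cis (real n * \<theta>) * cis (of_int l * \<theta>)"
        by (simp add: cis_mult distrib_right)
      moreover have "cis (real n * \<theta>) = cis \<theta> ^ n" by (simp add: Complex.DeMoivre)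
      ultimately show ?thesis by (simp add: power_mult_distrib mult.assoc)
    qed
    then have "(\<integral>\<theta>. a n * (polar r \<theta>) ^ n * cis (of_int l * \<theta>) \<partial>angle)
       = a n * of_real (r ^ n) * (\<integral>\<theta>. cis (of_int (int n + l) * \<theta>) \<partial>angle)"
      by (simp only:) (rule integral_mult_right_zero)
    also have "\<dots> = (if n = nat (- l) \<and> l \<le> 0 then a n * of_real (r ^ n) * of_real (2 * pi) else 0)"
      unfolding integral_angle_cis by auto
    finally show ?thesis .
  qed
  have "(\<lambda>n. \<integral>\<theta>. a n * (polar r \<theta>) ^ n * cis (of_int l * \<theta>) \<partial>angle)
     sums (\<integral>\<theta>. (\<Sum>n. a n * (polar r \<theta>) ^ n * cis (of_int l * \<theta>)) \<partial>angle)"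
  proof (rule sums_integral)
    show "integrable angle (\<lambda>\<theta>. a n * (polar r \<theta>) ^ n * cis (of_int l * \<theta>))" for n
      by (rule angle.integrable_const_bound[of _ "norm (a n * of_real r ^ n)"]) (simp_all only: eq, auto)
    show "AE \<theta> in angle. summable (\<lambda>n. norm (a n * (polar r \<theta>) ^ n * cis (of_int l * \<theta>)))"
      unfolding eq using sm by simp
    show "summable (\<lambda>n. \<integral>\<theta>. norm (a n * (polar r \<theta>) ^ n * cis (of_int l * \<theta>)) \<partial>angle)"
      unfolding eq using summable_mult[OF sm, of "measure angle (space angle)"] by simp
  qed
  also have "(\<integral>\<theta>. (\<Sum>n. a n * (polar r \<theta>) ^ n * cis (of_int l * \<theta>)) \<partial>angle)
     = (\<integral>\<theta>. f (polar r \<theta>) * cis (of_int l * \<theta>) \<partial>angle)"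
  proof (intro Bochner_Integration.integral_cong refl)
    fix \<theta>
    have "(\<lambda>n. a n * (polar r \<theta>) ^ n * cis (of_int l * \<theta>)) sums (f (polar r \<theta>) * cis (of_int l * \<theta>))"
      by (intro sums_mult2 s) (use r in \<open>simp add: norm_mult\<close>)
    then show "(\<Sum>n. a n * (polar r \<theta>) ^ n * cis (of_int l * \<theta>)) = f (polar r \<theta>) * cis (of_int l * \<theta>)"
      by (simp add: sums_iff)
  qed
  finally have 1: "(\<lambda>n. if n = nat (- l) \<and> l \<le> 0 then a n * of_real (r ^ n) * of_real (2 * pi) else 0)
     sums (\<integral>\<theta>. f (polar r \<theta>) * cis (of_int l * \<theta>) \<partial>angle)"
    unfolding int .
  have "(\<lambda>n. if n = nat (- l) \<and> l \<le> 0 then a n * of_real (r ^ n) * of_real (2 * pi) else 0)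
     sums (of_real (2 * pi * r ^ nat (- l)) * taylor_coeff f (- l))"
  proof (cases "l \<le> 0")
    case True
    then show ?thesis
      using sums_single[of "nat (- l)" "\<lambda>n. a n * of_real (r ^ n) * of_real (2 * pi)"]
      by (simp add: taylor_coeff_def a_def mult_ac)
  next
    case False
    then show ?thesis by (simp add: taylor_coeff_def)
  qed
  from sums_unique2[OF 1 this] show ?thesis .
qed

text \<open>The conjugate of a polynomial kernel is a polynomial in \<open>cnj z\<close>, so the
  functional at \<open>z ^ m * f z\<close> is a finite combination of these numbers. Area is
  unnormalized here.\<close>

definition moment :: "(complex \<Rightarrow> complex) \<Rightarrow> nat \<Rightarrow> nat \<Rightarrow> complex" where
  "moment f m j = (\<integral>z. z ^ m * f z * cnj z ^ j \<partial>disc)"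

lemma holomorphic_measurable_disc:
  "f holomorphic_on ball 0 1 \<Longrightarrow> f \<in> borel_measurable disc"
  by (intro continuous_on_measurable_disc holomorphic_on_imp_continuous_on)

lemma integrable_moment:
  assumes "integrable disc f"
  shows "integrable disc (\<lambda>z. z ^ m * f z * cnj z ^ j)"
proof (rule Bochner_Integration.integrable_bound[OF assms])
  have [measurable]: "f \<in> borel_measurable disc" using assms by auto
  have [measurable]: "(\<lambda>z. z) \<in> borel_measurable disc" "cnj \<in> borel_measurable disc"
    by (auto intro!: borel_measurable_disc)
  show "(\<lambda>z. z ^ m * f z * cnj z ^ j) \<in> borel_measurable disc" by measurable
  show "AE z in disc. norm (z ^ m * f z * cnj z ^ j) \<le> norm (f z)"
  proof (rule AE_I2)
    fix z assume "z \<in> space disc"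
    then have "norm z \<le> 1" by simp
    then have "norm z ^ m * norm (f z) * norm z ^ j \<le> 1 * norm (f z) * 1"
      by (intro mult_mono power_le_one) auto
    then show "norm (z ^ m * f z * cnj z ^ j) \<le> norm (f z)"
      by (simp add: norm_mult norm_power)
  qed
qed

lemma integral_radius_power:
  "(\<integral>r. r ^ n \<partial>radius) = 1 / real (n + 1)"
proof -
  have "(\<integral>r. r ^ n \<partial>radius) = (\<integral>r. indicator {0<..<1} r *\<^sub>R r ^ n \<partial>lborel)"
    by (simp add: radius_def integral_restrict_space)
  also have "\<dots> = (\<integral>r. indicator {0..1} r *\<^sub>R r ^ n \<partial>lborel)"
  proof (rule integral_cong_AE)
    have "AE r in lborel. r \<noteq> 0 \<and> r \<noteq> (1::real)"
      using AE_lborel_singleton[of "0::real"] AE_lborel_singleton[of "1::real"] by eventually_elim auto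
    then show "AE r in lborel. indicator {0<..<1} r *\<^sub>R r ^ n = indicator {0..1} r *\<^sub>R (r::real) ^ n"
      by eventually_elim (auto simp: indicator_def)
  qed auto
  also have "\<dots> = 1 ^ (n + 1) / real (n + 1) - 0 ^ (n + 1) / real (n + 1)"
    by (rule integral_FTC_atLeastAtMost)
       (auto intro!: derivative_eq_intros continuous_intros
         simp: has_real_derivative_iff_has_vector_derivative[symmetric] simp del: power_Suc)
  finally show ?thesis by simp
qed

text \<open>On the circle of radius r the factors contribute r^(m+j) and frequency m - j, which
  selects the Taylor coefficient j - m together with r^(j-m). With the area factor the total is
  r^(2j+1), whose integral 1/(2j+2) times 2 pi is pi/(j+1).\<close>

lemma moment_eq:
  assumes hol: "f holomorphic_on ball 0 1" and int: "integrable disc f"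
  shows "moment f m j = of_real (pi / real (j + 1)) * taylor_coeff f (int j - int m)"
proof -
  define h where "h z = z ^ m * f z * cnj z ^ j" for z
  have h: "integrable disc h" unfolding h_def by (rule integrable_moment[OF int])
  then have hm: "h \<in> borel_measurable disc" by auto
  have "moment f m j = (\<integral>x. fst x *\<^sub>R h (polar_point x) \<partial>polar_rect)"
    unfolding moment_def h_def[symmetric] by (rule integral_disc_polar[OF hm])
  also have "\<dots> = (\<integral>r. (\<integral>\<theta>. r *\<^sub>R h (polar r \<theta>) \<partial>angle) \<partial>radius)"
    using polar.integral_fst'[of "\<lambda>x. fst x *\<^sub>R h (polar_point x)"] h
    by (simp add: integrable_disc_polar[OF hm] polar_point_def)
  also have "\<dots> = (\<integral>r. of_real (r ^ (2 * j + 1)) * (of_real (2 * pi) * taylor_coeff f (int j - int m)) \<partial>radius)"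
  proof (rule Bochner_Integration.integral_cong[OF refl])
    fix r assume "r \<in> space radius"
    then have r: "0 < r" "r < 1" by auto
    have "r *\<^sub>R h (polar r \<theta>) = of_real (r ^ (m + j + 1)) * (f (polar r \<theta>) * cis (of_int (int m - int j) * \<theta>))" for \<theta>
    proof -
      have "cis (of_int (int m - int j) * \<theta>) = cis \<theta> ^ m * cnj (cis \<theta>) ^ j"
        by (simp add: cis_power_mult_cnj)
      then show ?thesis
        by (simp add: h_def scaleR_conv_of_real power_mult_distrib power_add mult_ac)
    qed
    then have "(\<integral>\<theta>. r *\<^sub>R h (polar r \<theta>) \<partial>angle)
       = of_real (r ^ (m + j + 1)) * (\<integral>\<theta>. f (polar r \<theta>) * cis (of_int (int m - int j) * \<theta>) \<partial>angle)"
      by (simp only:) (rule integral_mult_right_zero)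
    also have "\<dots> = of_real (r ^ (m + j + 1)) * (of_real (2 * pi * r ^ nat (int j - int m)) * taylor_coeff f (int j - int m))"
      using circle_coefficient[OF hol, of r "int m - int j"] r by simp
    also have "\<dots> = of_real (r ^ (2 * j + 1)) * (of_real (2 * pi) * taylor_coeff f (int j - int m))"
    proof (cases "m \<le> j")
      case True
      then have "m + j + 1 + nat (int j - int m) = 2 * j + 1" by auto
      then have "r ^ (m + j + 1) * r ^ nat (int j - int m) = r ^ (2 * j + 1)"
        by (simp only: power_add[symmetric])
      then show ?thesis by (simp add: mult_ac flip: of_real_mult)
    next
      case False
      then show ?thesis by (simp add: taylor_coeff_def)
    qed
    finally show "(\<integral>\<theta>. r *\<^sub>R h (polar r \<theta>) \<partial>angle) = \<dots>" .
  qed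
  also have "\<dots> = (\<integral>r. of_real (r ^ (2 * j + 1)) \<partial>radius) * (of_real (2 * pi) * taylor_coeff f (int j - int m))"
    by (rule integral_mult_left_zero)
  also have "(\<integral>r. complex_of_real (r ^ (2 * j + 1)) \<partial>radius) = of_real (1 / real (2 * j + 1 + 1))"
    by (subst integral_radius_power[symmetric]) (rule integral_complex_of_real)
  also have "of_real (1 / real (2 * j + 1 + 1)) * (of_real (2 * pi) * taylor_coeff f (int j - int m))
     = of_real (pi / real (j + 1)) * taylor_coeff f (int j - int m)"
  proof -
    have "1 / real (2 * j + 1 + 1) * (2 * pi) = pi / real (j + 1)" by (simp add: field_simps)
    then show ?thesis by (simp only: mult.assoc[symmetric] of_real_mult[symmetric])
  qed
  finally show ?thesis .
qed

text \<open>Substituting w = \<open>cis t * z\<close> leaves area unchanged and turns the monomials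
  into a phase of frequency j - m. Rotation dependence of the functional is therefore a
  trigonometric polynomial.\<close>

lemma moment_rotate:
  assumes f: "f \<in> borel_measurable disc"
  shows "moment (\<lambda>z. f (cis t * z)) m j = cis ((real j - real m) * t) * moment f m j"
proof -
  define h where "h z = z ^ m * f z * cnj z ^ j" for z
  note f[measurable]
  have [measurable]: "(\<lambda>z. z) \<in> borel_measurable disc" "cnj \<in> borel_measurable disc"
    by (auto intro!: borel_measurable_disc)
  have hm: "h \<in> borel_measurable disc" unfolding h_def by measurable
  have e: "cis ((real j - real m) * t) * (cis t ^ m * cnj (cis t) ^ j) = 1"
    by (simp add: cis_power_mult_cnj cis_mult algebra_simps)
  have "z ^ m * f (cis t * z) * cnj z ^ j = cis ((real j - real m) * t) * h (cis t * z)" for z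
  proof -
    have "cis ((real j - real m) * t) * h (cis t * z)
       = (cis ((real j - real m) * t) * (cis t ^ m * cnj (cis t) ^ j)) * (z ^ m * f (cis t * z) * cnj z ^ j)"
      by (simp add: h_def power_mult_distrib mult_ac)
    then show ?thesis by (simp only: e mult_1)
  qed
  then have "moment (\<lambda>z. f (cis t * z)) m j = (\<integral>z. cis ((real j - real m) * t) * h (cis t * z) \<partial>disc)"
    by (simp add: moment_def)
  also have "\<dots> = cis ((real j - real m) * t) * (\<integral>z. h (cis t * z) \<partial>disc)"
    by (rule integral_mult_right_zero)
  also have "(\<integral>z. h (cis t * z) \<partial>disc) = (\<integral>z. h z \<partial>disc)"
    by (rule integral_disc_rotate[OF hm]) simp
  finally show ?thesis by (simp add: moment_def h_def)
qed

lemma kernel_functional_eq_moments: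
  assumes "integrable disc f"
  shows "kernel_functional k (\<lambda>z. z ^ m * f z) = (\<Sum>j\<le>degree k. cnj (coeff k j) * moment f m j) / of_real pi"
proof -
  have "z ^ m * f z * cnj (poly k z) = (\<Sum>j\<le>degree k. cnj (coeff k j) * (z ^ m * f z * cnj z ^ j))" for z
    by (simp add: poly_altdef sum_distrib_left mult_ac)
  then have "(\<integral>z. z ^ m * f z * cnj (poly k z) \<partial>disc) = (\<Sum>j\<le>degree k. cnj (coeff k j) * moment f m j)"
    unfolding moment_def
    by (simp add: integral_mult_right_zero integrable_moment[OF assms] integrable_mult_right)
  then show ?thesis
    by (simp add: kernel_functional_def disc_integral_def set_integral_disc_eq)
qed

section \<open>Orthogonality for extremal functions\<close>

text \<open>The sequential theorem is applied along arbitrary sequences tending to \<open>a\<close>.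
  As the hypotheses hold only eventually, a finite initial segment of each sequence is
  dropped.\<close>

lemma dominated_convergence_at_within:
  fixes s :: "real \<Rightarrow> 'a \<Rightarrow> 'b::{banach, second_countable_topology}"
  assumes f: "f \<in> borel_measurable M" and w: "integrable M w"
    and lim: "AE x in M. ((\<lambda>t. s t x) \<longlongrightarrow> f x) (at a within S)"
    and ev: "\<forall>\<^sub>F t in at a within S. s t \<in> borel_measurable M \<and> (AE x in M. norm (s t x) \<le> w x)"
  shows "((\<lambda>t. \<integral>x. s t x \<partial>M) \<longlongrightarrow> (\<integral>x. f x \<partial>M)) (at a within S)"
  unfolding tendsto_at_iff_sequentially comp_def
proof (intro allI impI)
  fix X :: "nat \<Rightarrow> real" assume X: "\<forall>i. X i \<in> S - {a}" "X \<longlonglongrightarrow> a"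
  then have flt: "filterlim X (at a within S) sequentially"
    by (auto simp: filterlim_at)
  from ev have "\<forall>\<^sub>F n in sequentially. s (X n) \<in> borel_measurable M \<and> (AE x in M. norm (s (X n) x) \<le> w x)"
    using flt by (rule eventually_compose_filterlim)
  then obtain N where N: "\<And>n. n \<ge> N \<Longrightarrow> s (X n) \<in> borel_measurable M \<and> (AE x in M. norm (s (X n) x) \<le> w x)"
    by (auto simp: eventually_sequentially)
  have "(\<lambda>n. \<integral>x. s (X (n + N)) x \<partial>M) \<longlonglongrightarrow> (\<integral>x. f x \<partial>M)"
  proof (rule integral_dominated_convergence[OF f _ w])
    show "AE x in M. (\<lambda>n. s (X (n + N)) x) \<longlonglongrightarrow> f x"
      using lim
    proof eventually_elim
      case (elim x)
      have "(\<lambda>n. s (X n) x) \<longlonglongrightarrow> f x"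
        using filterlim_compose[OF elim flt] by simp
      then show ?case by (rule LIMSEQ_ignore_initial_segment)
    qed
  qed (use N in auto)
  then show "(\<lambda>n. \<integral>x. s (X n) x \<partial>M) \<longlonglongrightarrow> (\<integral>x. f x \<partial>M)"
    by (rule LIMSEQ_offset)
qed

section \<open>Elementary properties of Bergman spaces and kernel functionals\<close>

lemma norm_add_powr_le:
  fixes a b :: "'a::real_normed_vector"
  assumes "0 < p"
  shows "norm (a + b) powr p \<le> 2 powr p * (norm a powr p + norm b powr p)"
proof -
  have "norm (a + b) powr p \<le> (2 * max (norm a) (norm b)) powr p"
    using assms norm_triangle_ineq[of a b] by (intro powr_mono2) (auto simp: max_def)
  also have "\<dots> = 2 powr p * max (norm a) (norm b) powr p"
    by (simp add: powr_mult)
  also have "\<dots> \<le> 2 powr p * (norm a powr p + norm b powr p)"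
    by (intro mult_left_mono) (auto simp: max_def)
  finally show ?thesis .
qed

text \<open>Neither normalized nor raised to 1/p, hence easy to differentiate; on the unit sphere of
  the Bergman space its value is pi.\<close>

definition power_integral :: "real \<Rightarrow> (complex \<Rightarrow> complex) \<Rightarrow> real" where
  "power_integral p f = (\<integral>z. norm (f z) powr p \<partial>disc)"

lemma power_integral_nonneg: "0 \<le> power_integral p f"
  by (simp add: power_integral_def)

lemma in_bergman_iff:
  "in_bergman p f \<longleftrightarrow> f holomorphic_on ball 0 1 \<and> integrable disc (\<lambda>z. norm (f z) powr p)"
  by (simp add: in_bergman_def set_integrable_disc_iff)

lemma bergman_norm_eq: "bergman_norm p f = (power_integral p f / pi) powr (1 / p)"
  by (simp add: bergman_norm_def power_integral_def set_integral_disc_eq)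

lemma bergman_norm_eq_1_iff:
  assumes "0 < p"
  shows "bergman_norm p f = 1 \<longleftrightarrow> power_integral p f = pi"
proof -
  have "x powr (1 / p) = 1 \<longleftrightarrow> x = 1" if "0 \<le> x" for x :: real
  proof (cases "x = 0")
    case False
    then show ?thesis using that assms by (auto simp: powr_def)
  qed simp
  from this[of "power_integral p f / pi"] show ?thesis
    by (auto simp: bergman_norm_eq power_integral_nonneg)
qed

lemma measure_disc: "measure disc (space disc) = pi"
  by (simp add: disc_def measure_restrict_space space_restrict_space content_ball unit_ball_vol_2)

lemma in_bergman_measurable: "in_bergman p f \<Longrightarrow> f \<in> borel_measurable disc"
  by (simp add: in_bergman_iff holomorphic_measurable_disc)

lemma le_one_add_powr:
  fixes p x :: real
  assumes "1 \<le> p" "0 \<le> x"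
  shows "x \<le> 1 + x powr p"
proof (cases "x \<le> 1")
  case False
  then have "x powr 1 \<le> x powr p" using assms by (intro powr_mono) auto
  then show ?thesis using False by simp
qed (use powr_ge_zero[of x p] in linarith)

lemma in_bergman_integrable:
  assumes "1 \<le> p" "in_bergman p f"
  shows "integrable disc f"
proof (rule Bochner_Integration.integrable_bound)
  show "integrable disc (\<lambda>z. 1 + norm (f z) powr p)"
    using assms by (simp add: in_bergman_iff)
  show "f \<in> borel_measurable disc" using assms by (simp add: in_bergman_measurable)
  show "AE z in disc. norm (f z) \<le> norm (1 + norm (f z) powr p)"
    using le_one_add_powr[OF assms(1)] by (auto intro!: AE_I2 simp: abs_of_nonneg add_nonneg_nonneg)
qed

lemma in_bergman_add:
  assumes "1 < p" "in_bergman p f" "in_bergman p g"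
  shows "in_bergman p (\<lambda>z. f z + g z)"
  unfolding in_bergman_iff
proof
  note [measurable] = in_bergman_measurable[OF assms(2)] in_bergman_measurable[OF assms(3)]
  show "(\<lambda>z. f z + g z) holomorphic_on ball 0 1"
    using assms by (auto simp: in_bergman_iff intro: holomorphic_intros)
  show "integrable disc (\<lambda>z. norm (f z + g z) powr p)"
  proof (rule Bochner_Integration.integrable_bound)
    show "integrable disc (\<lambda>z. 2 powr p * (norm (f z) powr p + norm (g z) powr p))"
      using assms by (simp add: in_bergman_iff)
    show "AE z in disc. norm (norm (f z + g z) powr p) \<le> norm (2 powr p * (norm (f z) powr p + norm (g z) powr p))"
      using norm_add_powr_le[of p] assms by (auto intro!: AE_I2 simp: abs_of_nonneg)
  qed measurable
qed

lemma in_bergman_mult: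
  assumes f: "in_bergman p f" and p: "0 \<le> p" and h: "h holomorphic_on ball 0 1"
    and B: "\<And>z. z \<in> ball 0 1 \<Longrightarrow> norm (h z) \<le> B"
  shows "in_bergman p (\<lambda>z. h z * f z)"
  unfolding in_bergman_iff
proof
  note [measurable] = in_bergman_measurable[OF f] holomorphic_measurable_disc[OF h]
  show "(\<lambda>z. h z * f z) holomorphic_on ball 0 1"
    using assms by (auto simp: in_bergman_iff intro: holomorphic_intros)
  show "integrable disc (\<lambda>z. norm (h z * f z) powr p)"
  proof (rule Bochner_Integration.integrable_bound)
    show "integrable disc (\<lambda>z. B powr p * norm (f z) powr p)"
      using assms by (simp add: in_bergman_iff)
    show "AE z in disc. norm (norm (h z * f z) powr p) \<le> norm (B powr p * norm (f z) powr p)"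
    proof (rule AE_I2)
      fix z assume "z \<in> space disc"
      then have "norm (h z) \<le> B" by (intro B) auto
      then have "(norm (h z) * norm (f z)) powr p \<le> (B * norm (f z)) powr p"
        using p by (intro powr_mono2 mult_right_mono) auto
      moreover have "0 \<le> B" using \<open>norm (h z) \<le> B\<close> norm_ge_zero order_trans by blast
      ultimately show "norm (norm (h z * f z) powr p) \<le> norm (B powr p * norm (f z) powr p)"
        by (simp add: norm_mult powr_mult abs_mult)
    qed
  qed measurable
qed

lemma in_bergman_cmult: "in_bergman p f \<Longrightarrow> 0 \<le> p \<Longrightarrow> in_bergman p (\<lambda>z. c * f z)"
  by (rule in_bergman_mult[where B="norm c"]) auto

lemma in_bergman_power_mult: "in_bergman p f \<Longrightarrow> 0 \<le> p \<Longrightarrow> in_bergman p (\<lambda>z. z ^ m * f z)"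
  by (rule in_bergman_mult[where B=1]) (auto intro!: holomorphic_intros simp: norm_power power_le_one)

lemma in_bergman_rotate:
  assumes "in_bergman p f"
  shows "in_bergman p (\<lambda>z. f (cis t * z))"
  unfolding in_bergman_iff
proof
  have f: "f holomorphic_on ball 0 1" "integrable disc (\<lambda>z. norm (f z) powr p)"
    using assms by (auto simp: in_bergman_iff)
  have "(f \<circ> (\<lambda>z. cis t * z)) holomorphic_on ball 0 1"
    by (rule holomorphic_on_compose_gen[OF _ f(1)]) (auto intro!: holomorphic_intros simp: norm_mult)
  then show "(\<lambda>z. f (cis t * z)) holomorphic_on ball 0 1" by (simp add: o_def)
  note [measurable] = in_bergman_measurable[OF assms]
  show "integrable disc (\<lambda>z. norm (f (cis t * z)) powr p)"
    using f(2) integrable_disc_rotate[of "\<lambda>z. norm (f z) powr p" "cis t"] by simp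
qed

lemma in_bergman_1: "in_bergman p (\<lambda>z. 1)"
  by (simp add: in_bergman_iff)

lemma power_integral_cmult: "power_integral p (\<lambda>z. c * f z) = norm c powr p * power_integral p f"
  by (simp add: power_integral_def norm_mult powr_mult)

lemma moment_add:
  assumes "integrable disc f" "integrable disc g"
  shows "moment (\<lambda>z. f z + g z) m j = moment f m j + moment g m j"
  unfolding moment_def
  using Bochner_Integration.integral_add[OF integrable_moment[OF assms(1)] integrable_moment[OF assms(2)], of m j m j]
  by (simp add: algebra_simps)

lemma moment_cmult:
  "moment (\<lambda>z. c * f z) m j = c * moment f m j"
proof -
  have "z ^ m * (c * f z) * cnj z ^ j = c * (z ^ m * f z * cnj z ^ j)" for z by (simp add: mult_ac)
  then show ?thesis unfolding moment_def by (simp only:) (rule integral_mult_right_zero)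
qed

lemma kernel_functional_moment0:
  "integrable disc f \<Longrightarrow>
    kernel_functional k f = (\<Sum>j\<le>degree k. cnj (coeff k j) * moment f 0 j) / of_real pi"
  using kernel_functional_eq_moments[of f k 0] by simp

lemma kernel_functional_add:
  assumes "integrable disc f" "integrable disc g"
  shows "kernel_functional k (\<lambda>z. f z + g z) = kernel_functional k f + kernel_functional k g"
  using assms by (simp add: kernel_functional_moment0 moment_add sum.distrib distrib_left add_divide_distrib)

lemma kernel_functional_cmult:
  assumes "integrable disc f"
  shows "kernel_functional k (\<lambda>z. c * f z) = c * kernel_functional k f"
proof -
  have "integrable disc (\<lambda>z. c * f z)" using assms by simp
  then show ?thesis using assms
    by (simp add: kernel_functional_moment0 moment_cmult sum_distrib_left mult_ac)
qed

text \<open>A crude bound from x <= 1 + x^p in place of Hoelder's inequality. Its purpose is that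
  the suprema defining the norm and extremality are taken over bounded sets.\<close>

lemma norm_kernel_functional_le:
  assumes "1 \<le> p" "in_bergman p f"
  shows "norm (kernel_functional k f) \<le> (\<Sum>j\<le>degree k. norm (coeff k j)) * (1 + power_integral p f / pi)"
proof -
  have f: "integrable disc f" by (rule in_bergman_integrable[OF assms])
  have m: "norm (moment f 0 j) \<le> pi + power_integral p f" for j
  proof -
    have "norm (moment f 0 j) \<le> (\<integral>z. norm (z ^ 0 * f z * cnj z ^ j) \<partial>disc)"
      unfolding moment_def by (rule integral_norm_bound)
    also have "\<dots> \<le> (\<integral>z. 1 + norm (f z) powr p \<partial>disc)"
    proof (rule integral_mono)
      show "integrable disc (\<lambda>z. norm (z ^ 0 * f z * cnj z ^ j))"
        by (intro integrable_norm integrable_moment f)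
      show "integrable disc (\<lambda>z. 1 + norm (f z) powr p)"
        using assms by (simp add: in_bergman_iff)
      fix z assume "z \<in> space disc"
      then have "norm (z ^ 0 * f z * cnj z ^ j) \<le> norm (f z) * 1"
        by (simp only: norm_mult norm_power power_0 norm_one mult_1 complex_mod_cnj, intro mult_left_mono power_le_one) auto
      also have "\<dots> \<le> 1 + norm (f z) powr p" using le_one_add_powr[OF assms(1), of "norm (f z)"] by simp
      finally show "norm (z ^ 0 * f z * cnj z ^ j) \<le> 1 + norm (f z) powr p" .
    qed
    also have "\<dots> = pi + power_integral p f"
      using assms measure_disc by (simp add: in_bergman_iff power_integral_def)
    finally show ?thesis .
  qed
  have "norm (kernel_functional k f) \<le> (\<Sum>j\<le>degree k. norm (coeff k j) * (pi + power_integral p f)) / pi"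
    unfolding kernel_functional_moment0[OF f] norm_divide norm_of_real
    by (auto intro!: divide_right_mono sum_norm_le mult_left_mono m simp: norm_mult)
  also have "\<dots> = (\<Sum>j\<le>degree k. norm (coeff k j)) * (1 + power_integral p f / pi)"
    unfolding sum_distrib_right[symmetric] by (simp add: field_simps)
  finally show ?thesis .
qed

lemma taylor_coeff_1: "taylor_coeff (\<lambda>z. 1) l = (if l = 0 then 1 else 0)"
proof -
  have "(deriv ^^ n) (\<lambda>z. 1 :: complex) = (\<lambda>z. if n = 0 then 1 else 0)" for n
    by (induction n) auto
  then show ?thesis by (auto simp: taylor_coeff_def)
qed

section \<open>The extremal function and its variational equation\<close>

locale bergman_extremal =
  fixes p :: real and k :: "complex poly" and F :: "complex \<Rightarrow> complex"
  assumes p: "1 < p" and k: "k \<noteq> 0" and extremal: "is_extremal p k F"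
begin

abbreviation "M \<equiv> functional_norm p k"
abbreviation "\<phi> \<equiv> kernel_functional k"
abbreviation "J \<equiv> dual_power p"

lemma bergman_F: "in_bergman p F"
  using extremal by (simp add: is_extremal_def)

lemma holomorphic_F: "F holomorphic_on ball 0 1"
  using bergman_F by (simp add: in_bergman_iff)

lemma power_integral_F: "power_integral p F = pi"
  using extremal p bergman_norm_eq_1_iff[of p F] by (simp add: is_extremal_def)

lemma norm_functional_le:
  assumes "in_bergman p g" "bergman_norm p g = 1"
  shows "norm (\<phi> g) \<le> (\<Sum>j\<le>degree k. norm (coeff k j)) * 2"
  using norm_kernel_functional_le[of p g k] assms p bergman_norm_eq_1_iff[of p g] by simp

lemma norm_functional_le_functional_norm:
  assumes "in_bergman p g" "bergman_norm p g = 1"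
  shows "norm (\<phi> g) \<le> M"
  unfolding functional_norm_def
  by (rule cSup_upper) (use assms norm_functional_le in \<open>auto intro!: bdd_aboveI\<close>)

text \<open>Multiplying a competitor by a unimodular constant rotates its value under
  \<open>\<phi>\<close> onto the positive axis, so the supremum of real parts equals the supremum of
  moduli.\<close>

lemma Re_functional_F: "Re (\<phi> F) = M"
proof (rule antisym)
  have "Re (\<phi> F) \<le> norm (\<phi> F)" by (rule complex_Re_le_cmod)
  also have "\<dots> \<le> M"
    using extremal by (intro norm_functional_le_functional_norm) (auto simp: is_extremal_def)
  finally show "Re (\<phi> F) \<le> M" .
  have bdd: "bdd_above {Re (\<phi> g) |g. in_bergman p g \<and> bergman_norm p g = 1}"
    using norm_functional_le complex_Re_le_cmod order_trans by (fastforce intro!: bdd_aboveI)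
  have "Sup {norm (\<phi> g) |g. in_bergman p g \<and> bergman_norm p g = 1}
     \<le> Sup {Re (\<phi> g) |g. in_bergman p g \<and> bergman_norm p g = 1}"
  proof (rule cSup_subset_mono[OF _ bdd])
    show "{norm (\<phi> g) |g. in_bergman p g \<and> bergman_norm p g = 1} \<noteq> {}"
      using extremal by (auto simp: is_extremal_def)
    show "{norm (\<phi> g) |g. in_bergman p g \<and> bergman_norm p g = 1}
       \<subseteq> {Re (\<phi> g) |g. in_bergman p g \<and> bergman_norm p g = 1}"
    proof clarify
      fix g assume g: "in_bergman p g" "bergman_norm p g = 1"
      define c where "c = cis (- Arg (\<phi> g))"
      have "c * \<phi> g = of_real (norm (\<phi> g))"
      proof -
        have "\<phi> g = of_real (norm (\<phi> g)) * cis (Arg (\<phi> g))"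
          by (metis rcis_cmod_Arg rcis_def)
        then have "c * \<phi> g = of_real (norm (\<phi> g)) * (c * cis (Arg (\<phi> g)))"
          by (metis mult.left_commute)
        then show ?thesis by (simp add: c_def cis_mult)
      qed
      then have "norm (\<phi> g) = Re (\<phi> (\<lambda>z. c * g z))"
        using kernel_functional_cmult[OF in_bergman_integrable[of p g]] p g by simp
      moreover have "in_bergman p (\<lambda>z. c * g z)" using g p by (intro in_bergman_cmult) auto
      moreover have "bergman_norm p (\<lambda>z. c * g z) = 1"
        using g by (simp add: bergman_norm_eq power_integral_cmult c_def)
      ultimately show "\<exists>ga. norm (\<phi> g) = Re (\<phi> ga) \<and> in_bergman p ga \<and> bergman_norm p ga = 1"
        by blast
    qed
  qed
  then show "M \<le> Re (\<phi> F)"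
    using extremal by (simp add: is_extremal_def functional_norm_def)
qed

text \<open>By homogeneity this reduces to the unit sphere. A function of norm zero vanishes almost
  everywhere, so all its moments vanish too.\<close>

lemma norm_functional_le_bergman_norm:
  assumes g: "in_bergman p g"
  shows "norm (\<phi> g) \<le> M * bergman_norm p g"
proof (cases "power_integral p g = 0")
  case True
  have "AE z in disc. norm (g z) powr p = 0"
    using True g unfolding power_integral_def in_bergman_iff
    by (subst (asm) integral_nonneg_eq_0_iff_AE) auto
  then have "AE z in disc. g z = 0" by simp
  then have "moment g 0 j = 0" for j
    unfolding moment_def by (intro integral_eq_zero_AE) (auto elim!: eventually_mono)
  then have "\<phi> g = 0"
    using kernel_functional_moment0[OF in_bergman_integrable[of p g]] p g by simp
  then show ?thesis using True p by (simp add: bergman_norm_eq)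
next
  case False
  define N where "N = bergman_norm p g"
  have N: "N > 0" using False power_integral_nonneg[of p g] by (simp add: N_def bergman_norm_eq)
  have Np: "N powr p = power_integral p g / pi"
    using p power_integral_nonneg[of p g] by (simp add: N_def bergman_norm_eq powr_powr)
  define h where "h z = of_real (1 / N) * g z" for z
  have "in_bergman p h" unfolding h_def using g p by (intro in_bergman_cmult) auto
  moreover have "power_integral p h = pi"
  proof -
    have "norm (complex_of_real (1 / N)) powr p = 1 / N powr p"
      using N by (simp add: powr_divide norm_divide)
    then show ?thesis
      unfolding h_def power_integral_cmult using Np False by (simp add: field_simps)
  qed
  ultimately have "norm (\<phi> h) \<le> M"
    using p by (intro norm_functional_le_functional_norm) (auto simp: bergman_norm_eq_1_iff)
  moreover have "\<phi> h = of_real (1 / N) * \<phi> g"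
    unfolding h_def using p g by (intro kernel_functional_cmult in_bergman_integrable[of p]) auto
  ultimately have "1 / N * norm (\<phi> g) \<le> M" using N by (simp add: norm_mult norm_divide)
  then show ?thesis using N unfolding N_def[symmetric] by (simp add: field_simps)
qed

text \<open>The monomial of degree \<open>degree k\<close> is a test function: orthogonality of
  monomials leaves only the conjugate leading coefficient.\<close>

lemma M_pos: "0 < M"
proof -
  define n where "n = degree k"
  have "\<phi> (\<lambda>z. z ^ n * 1) = (\<Sum>j\<le>degree k. cnj (coeff k j) * (if j = n then of_real (pi / real (j + 1)) else 0)) / of_real pi"
    by (subst kernel_functional_eq_moments)
       (auto simp: moment_eq taylor_coeff_1 intro!: sum.cong)
  also have "\<dots> = cnj (coeff k n) * of_real (pi / real (n + 1)) / of_real pi"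
    by (simp add: n_def if_distrib[where f="\<lambda>x. _ * x"] cong: if_cong)
  finally have "\<phi> (\<lambda>z. z ^ n * 1) \<noteq> 0"
    using k by (simp add: n_def leading_coeff_0_iff del: of_nat_add of_nat_Suc)
  moreover have "norm (\<phi> (\<lambda>z. z ^ n * 1)) \<le> M * bergman_norm p (\<lambda>z. z ^ n * 1)"
    using p by (intro norm_functional_le_bergman_norm in_bergman_power_mult in_bergman_1) auto
  ultimately have "0 < M * bergman_norm p (\<lambda>z. z ^ n * 1)"
    by (meson less_le_trans zero_less_norm_iff)
  then show ?thesis
    by (simp add: zero_less_mult_iff bergman_norm_eq) 
qed

text \<open>Differentiation under the integral. For |t| at most 1 the mean value inequality bounds
  the difference quotients by p(|F| + |f|)^p, which is dominated by the integrable
  \<open>w\<close>.\<close>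

lemma power_integral_has_derivative:
  assumes f: "in_bergman p f"
  shows "((\<lambda>t. power_integral p (\<lambda>z. F z + of_real t * f z)) has_real_derivative
     p * (\<integral>z. Re (J (F z) * f z) \<partial>disc)) (at 0)"
proof -
  note [measurable] = in_bergman_measurable[OF f] in_bergman_measurable[OF bergman_F]
  define u where "u t z = norm (F z + of_real t * f z) powr p" for t z
  define w where "w z = p * (2 powr p * (norm (F z) powr p + norm (f z) powr p))" for z
  have w: "integrable disc w"
    unfolding w_def using f bergman_F by (simp add: in_bergman_iff)
  have um[measurable]: "u t \<in> borel_measurable disc" for t unfolding u_def by measurable
  have u_int: "integrable disc (u t)" for t
    using in_bergman_add[OF p bergman_F in_bergman_cmult[OF f, of "of_real t"]] p
    by (simp add: in_bergman_iff u_def[abs_def])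
  have der: "((\<lambda>t. u t z) has_real_derivative p * Re (J (F z + of_real t * f z) * f z)) (at t)" for t z
    unfolding u_def
    by (rule has_real_derivative_norm_powr[OF p])
       (auto intro!: derivative_eq_intros simp: has_vector_derivative_def scaleR_conv_of_real)
  have bound: "norm (u t z - u 0 z) \<le> w z * norm (t - 0)" if "\<bar>t\<bar> \<le> 1" for t z
  proof (rule field_differentiable_bound[where S="{-1..1::real}"])
    fix s :: real assume s: "s \<in> {-1..1}"
    show "((\<lambda>t. u t z) has_real_derivative p * Re (J (F z + of_real s * f z) * f z)) (at s within {-1..1})"
      by (rule has_field_derivative_at_within[OF der])
    define A where "A = norm (F z) + norm (f z)"
    have A: "norm (F z + of_real s * f z) \<le> A"
    proof -
      have "norm (F z + of_real s * f z) \<le> norm (F z) + \<bar>s\<bar> * norm (f z)"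
        by (rule order_trans[OF norm_triangle_ineq]) (simp add: norm_mult)
      also have "\<bar>s\<bar> * norm (f z) \<le> 1 * norm (f z)" using s by (intro mult_right_mono) auto
      finally show ?thesis by (simp add: A_def)
    qed
    have "norm (Re (J (F z + of_real s * f z) * f z)) \<le> norm (J (F z + of_real s * f z) * f z)"
      unfolding real_norm_def by (rule abs_Re_le_cmod)
    also have "\<dots> = norm (F z + of_real s * f z) powr (p - 1) * norm (f z)"
      by (simp add: norm_mult norm_dual_power)
    also have "\<dots> \<le> A powr (p - 1) * A"
      using p A by (intro mult_mono powr_mono2) (auto simp: A_def)
    also have "\<dots> = A powr p"
      by (cases "A = 0") (auto simp: powr_diff A_def)
    also have "\<dots> = norm (of_real (norm (F z)) + of_real (norm (f z)) :: complex) powr p"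
      by (simp add: A_def flip: of_real_add)
    also have "\<dots> \<le> 2 powr p * (norm (F z) powr p + norm (f z) powr p)"
      using norm_add_powr_le[of p "of_real (norm (F z)) :: complex" "of_real (norm (f z))"] p by simp
    finally show "norm (p * Re (J (F z + of_real s * f z) * f z)) \<le> w z"
      using p unfolding w_def by (simp add: abs_mult)
  qed (use that in auto)
  have "((\<lambda>t. \<integral>z. (u t z - u 0 z) / (t - 0) \<partial>disc) \<longlongrightarrow> (\<integral>z. p * Re (J (F z) * f z) \<partial>disc)) (at 0)"
  proof (rule dominated_convergence_at_within[OF _ w])
    show "AE z in disc. ((\<lambda>t. (u t z - u 0 z) / (t - 0)) \<longlongrightarrow> p * Re (J (F z) * f z)) (at 0)"
      using der[of _ 0] by (auto simp: has_field_derivative_iff)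
    have "\<forall>\<^sub>F t in at (0::real). \<bar>t\<bar> \<le> 1 \<and> t \<noteq> 0"
      by (auto simp: eventually_at intro!: exI[of _ 1])
    then show "\<forall>\<^sub>F t in at 0. (\<lambda>z. (u t z - u 0 z) / (t - 0)) \<in> borel_measurable disc \<and>
      (AE z in disc. norm ((u t z - u 0 z) / (t - 0)) \<le> w z)"
    proof eventually_elim
      case (elim t)
      have "norm ((u t z - u 0 z) / (t - 0)) \<le> w z" for z
        using bound[of t z] elim by (simp add: field_simps)
      then show ?case by (auto intro!: AE_I2)
    qed
  qed measurable
  moreover have "(\<integral>z. (u t z - u 0 z) / (t - 0) \<partial>disc) = (power_integral p (\<lambda>z. F z + of_real t * f z) - power_integral p (\<lambda>z. F z + of_real 0 * f z)) / (t - 0)" for t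
    using Bochner_Integration.integral_diff[OF u_int[of t] u_int[of 0]] by (simp add: power_integral_def u_def[abs_def])
  ultimately have "((\<lambda>t. (power_integral p (\<lambda>z. F z + of_real t * f z) - power_integral p (\<lambda>z. F z + of_real 0 * f z)) / (t - 0))
     \<longlongrightarrow> (\<integral>z. p * Re (J (F z) * f z) \<partial>disc)) (at 0)"
    by (simp only:)
  then show ?thesis
    unfolding has_field_derivative_iff by simp
qed

lemma integrable_dual_power:
  assumes f: "in_bergman p f"
  shows "integrable disc (\<lambda>z. J (F z) * f z)"
proof (rule Bochner_Integration.integrable_bound)
  note [measurable] = in_bergman_measurable[OF f] in_bergman_measurable[OF bergman_F]
  show "integrable disc (\<lambda>z. norm (F z) powr p + norm (f z) powr p)"
    using f bergman_F by (simp add: in_bergman_iff)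
  show "(\<lambda>z. J (F z) * f z) \<in> borel_measurable disc" by measurable
  show "AE z in disc. norm (J (F z) * f z) \<le> norm (norm (F z) powr p + norm (f z) powr p)"
  proof (rule AE_I2)
    fix z
    define A where "A = max (norm (F z)) (norm (f z))"
    have "norm (J (F z) * f z) = norm (F z) powr (p - 1) * norm (f z)"
      by (simp add: norm_mult norm_dual_power)
    also have "\<dots> \<le> A powr (p - 1) * A"
      using p by (intro mult_mono powr_mono2) (auto simp: A_def)
    also have "\<dots> = A powr p"
      by (cases "A = 0") (auto simp: powr_diff A_def max_def)
    also have "\<dots> \<le> norm (F z) powr p + norm (f z) powr p" by (auto simp: A_def max_def)
    finally show "norm (J (F z) * f z) \<le> norm (norm (F z) powr p + norm (f z) powr p)" by simp
  qed
qed

text \<open>The function \<open>\<psi>\<close> is the norm bound minus the real part of the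
  functional along the line F + t f. It is nonnegative and vanishes at t = 0 by extremality, so its
  derivative there is zero; this is the claimed identity.\<close>

lemma Re_functional_eq:
  assumes f: "in_bergman p f"
  shows "Re (\<phi> f) = M / pi * (\<integral>z. Re (J (F z) * f z) \<partial>disc)"
proof -
  define D where "D = (\<integral>z. Re (J (F z) * f z) \<partial>disc)"
  define I where "I t = power_integral p (\<lambda>z. F z + of_real t * f z)" for t
  define \<psi> where "\<psi> t = M * (I t / pi) powr (1 / p) - (M + t * Re (\<phi> f))" for t
  have I0: "I 0 = pi" by (simp add: I_def power_integral_F)
  have dI: "(I has_real_derivative p * D) (at 0)"
    unfolding I_def[abs_def] D_def by (rule power_integral_has_derivative[OF f])
  have *: "((\<lambda>t. (I t / pi) powr (1 / p)) has_real_derivative (1 / p) * (I 0 / pi) powr (1 / p - 1) * (p * D / pi)) (at 0)"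
    using DERIV_fun_powr[OF DERIV_cdivide[OF dI, of pi], of "1 / p"] I0 by simp
  have d: "(\<psi> has_real_derivative M * (D / pi) - Re (\<phi> f)) (at 0)"
  proof -
    have "((\<lambda>t. (I t / pi) powr (1 / p)) has_real_derivative D / pi) (at 0)"
      using * p I0 by simp
    then show ?thesis
      unfolding \<psi>_def[abs_def] by (intro DERIV_diff DERIV_cmult) (auto intro!: derivative_eq_intros)
  qed
  have "\<psi> 0 \<le> \<psi> t" for t
  proof -
    have b: "in_bergman p (\<lambda>z. F z + of_real t * f z)"
      using in_bergman_add[OF p bergman_F in_bergman_cmult[OF f, of "of_real t"]] p by simp
    have "\<phi> (\<lambda>z. F z + of_real t * f z) = \<phi> F + of_real t * \<phi> f"
      using p f bergman_F in_bergman_integrable[of p]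
      by (simp add: kernel_functional_add kernel_functional_cmult)
    then have "M + t * Re (\<phi> f) = Re (\<phi> (\<lambda>z. F z + of_real t * f z))"
      by (simp add: Re_functional_F)
    also have "\<dots> \<le> norm (\<phi> (\<lambda>z. F z + of_real t * f z))" by (rule complex_Re_le_cmod)
    also have "\<dots> \<le> M * (I t / pi) powr (1 / p)"
      using norm_functional_le_bergman_norm[OF b] by (simp add: bergman_norm_eq I_def)
    finally show ?thesis using I0 by (simp add: \<psi>_def)
  qed
  then have "M * (D / pi) - Re (\<phi> f) = 0"
    by (intro DERIV_local_min[OF d, of 1]) auto
  then show ?thesis by (simp add: D_def)
qed

text \<open>The real identity for \<open>f\<close> gives the real part; for -i f it gives the
  imaginary part.\<close>

lemma functional_eq:
  assumes f: "in_bergman p f"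
  shows "(\<integral>z. J (F z) * f z \<partial>disc) = of_real (pi / M) * \<phi> f"
proof -
  have f': "in_bergman p (\<lambda>z. - \<i> * f z)" using f p by (intro in_bergman_cmult) auto
  note i = integrable_dual_power[OF f] integrable_dual_power[OF f']
  have "(\<integral>z. J (F z) * (- \<i> * f z) \<partial>disc) = - \<i> * (\<integral>z. J (F z) * f z \<partial>disc)"
  proof -
    have "J (F z) * (- \<i> * f z) = - \<i> * (J (F z) * f z)" for z by simp
    then show ?thesis by (simp only:) (rule integral_mult_right_zero)
  qed
  moreover have "\<phi> (\<lambda>z. - \<i> * f z) = - \<i> * \<phi> f"
    using f p by (intro kernel_functional_cmult in_bergman_integrable) auto
  moreover have "Re (\<phi> f) = M / pi * Re (\<integral>z. J (F z) * f z \<partial>disc)"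
    using Re_functional_eq[OF f] integral_Re[OF i(1)] by simp
  moreover have "Re (\<phi> (\<lambda>z. - \<i> * f z)) = M / pi * Re (\<integral>z. J (F z) * (- \<i> * f z) \<partial>disc)"
    using Re_functional_eq[OF f'] integral_Re[OF i(2)] by simp
  ultimately show ?thesis
    using M_pos by (simp add: complex_eq_iff field_simps)
qed

end

section \<open>Rotations of the extremal function\<close>

lemma two_minus_two_cos_le: "2 - 2 * cos x \<le> (x::real)\<^sup>2"
proof -
  have "2 - 2 * cos x = (2 * sin (x / 2))\<^sup>2"
    using cos_double_sin[of "x / 2"] by (simp add: power2_eq_square)
  also have "\<dots> \<le> x\<^sup>2"
    using abs_sin_x_le_abs_x[of "x / 2"] unfolding abs_le_square_iff[symmetric] by (simp add: abs_mult)
  finally show ?thesis .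
qed

lemma norm_cis_minus_1_le: "norm (cis t - 1) \<le> \<bar>t\<bar>"
proof -
  have "norm (cis t - 1) = 2 * \<bar>sin (t / 2)\<bar>"
    using dist_exp_i_1[of t] by (simp add: cis_conv_exp)
  also have "\<dots> \<le> \<bar>t\<bar>" using abs_sin_x_le_abs_x[of "t / 2"] by simp
  finally show ?thesis .
qed

lemma has_vector_derivative_rotate:
  assumes f: "f holomorphic_on ball 0 1" and z: "norm z < 1"
  shows "((\<lambda>t. f (cis t * z)) has_vector_derivative \<i> * (cis t * z) * deriv f (cis t * z)) (at t)"
proof -
  have "((\<lambda>t. cis (1 * t) * z) has_vector_derivative (\<i> * of_real 1 * cis (1 * t) * z)) (at t)"
    by (intro has_vector_derivative_mult_left cis_has_vector_derivative)
  moreover have "(f has_field_derivative deriv f (cis t * z)) (at (cis t * z))"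
    by (rule holomorphic_derivI[OF f]) (use z in \<open>auto simp: norm_mult\<close>)
  ultimately show ?thesis
    using field_vector_diff_chain_at[of "\<lambda>t. cis t * z" "\<i> * cis t * z" t f "deriv f (cis t * z)"]
    by (simp add: o_def mult_ac)
qed

lemma has_vector_derivative_radial:
  assumes f: "f holomorphic_on ball 0 1" and r: "\<bar>r\<bar> < 1"
  shows "((\<lambda>r. f (polar r \<theta>)) has_vector_derivative cis \<theta> * deriv f (polar r \<theta>)) (at r)"
proof -
  have "((\<lambda>r. polar r \<theta>) has_vector_derivative (1 * cis \<theta>)) (at r)"
    by (intro has_vector_derivative_mult_left) (auto intro!: derivative_eq_intros)
  moreover have "(f has_field_derivative deriv f (polar r \<theta>)) (at (polar r \<theta>))"
    by (rule holomorphic_derivI[OF f]) (use r in \<open>auto simp: norm_mult\<close>)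
  ultimately show ?thesis
    using field_vector_diff_chain_at[of "\<lambda>r. polar r \<theta>" "cis \<theta>" r f "deriv f (polar r \<theta>)"]
    by (simp add: o_def)
qed

section \<open>The energy of a rotation and integrability of the derivative\<close>

context bergman_extremal
begin

abbreviation "F' \<equiv> deriv F"

definition energy :: "real \<Rightarrow> complex \<Rightarrow> real" where
  "energy t z = Re ((J (F z) - J (F (cis t * z))) * (F z - F (cis t * z)))"

definition strong_const :: real where
  "strong_const = min (1 / 2) (p - 1)"

lemma strong_const_pos: "0 < strong_const"
  using p by (simp add: strong_const_def)

lemma energy_nonneg: "0 \<le> energy t z"
  unfolding energy_def by (rule dual_power_monotone[OF p])

lemma F_measurable [measurable]: "F \<in> borel_measurable disc"
  by (rule in_bergman_measurable[OF bergman_F])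

lemma F_rotate_measurable [measurable]: "(\<lambda>z. F (cis t * z)) \<in> borel_measurable disc"
  by (rule in_bergman_measurable[OF in_bergman_rotate[OF bergman_F]])

lemma F'_measurable [measurable]: "F' \<in> borel_measurable disc"
  using holomorphic_F by (intro holomorphic_measurable_disc holomorphic_deriv) auto

lemma id_disc_measurable [measurable]: "(\<lambda>z. z) \<in> borel_measurable disc"
  by (intro borel_measurable_disc) auto

lemma energy_measurable [measurable]: "energy t \<in> borel_measurable disc"
  unfolding energy_def[abs_def] by measurable

lemma integrable_F_powr: "integrable disc (\<lambda>z. norm (F z) powr p)"
  using bergman_F by (simp add: in_bergman_iff)

lemma integrable_F: "integrable disc F"
  using bergman_F p by (intro in_bergman_integrable[of p]) auto

lemma functional_rotate:
  "\<phi> (\<lambda>z. z ^ m * F (cis t * z)) =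
    (\<Sum>j\<le>degree k. cnj (coeff k j) * (cis ((real j - real m) * t) * moment F m j)) / of_real pi"
  using kernel_functional_eq_moments[OF in_bergman_integrable[OF _ in_bergman_rotate[OF bergman_F]], of k m t] p
  by (simp add: moment_rotate)

text \<open>Of the four products in the expansion, those containing J(F) are \<open>h 0\<close> and
  \<open>h t\<close>. The two containing the rotated J are \<open>h (- t)\<close> and
  \<open>h 0\<close> evaluated at \<open>cis t * z\<close>, so invariance of area brings them back
  to J(F), where the orthogonality relation applies.\<close>

lemma
  shows integrable_energy: "integrable disc (energy t)"
    and integral_energy: "(\<integral>z. energy t z \<partial>disc) =
      pi / M * Re (2 * \<phi> F - \<phi> (\<lambda>z. F (cis t * z)) - \<phi> (\<lambda>z. F (cis (- t) * z)))"
proof -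
  have c: "cis t * cis (- t) = 1" by (simp add: cis_mult)
  define h where "h s z = J (F z) * F (cis s * z)" for s z
  have h: "integrable disc (h s)" for s
    unfolding h_def by (rule integrable_dual_power[OF in_bergman_rotate[OF bergman_F]])
  have h_int: "(\<integral>z. h s z \<partial>disc) = of_real (pi / M) * \<phi> (\<lambda>z. F (cis s * z))" for s
    unfolding h_def by (rule functional_eq[OF in_bergman_rotate[OF bergman_F]])
  have h_rot: "integrable disc (\<lambda>z. h s (cis t * z))"
     "(\<integral>z. h s (cis t * z) \<partial>disc) = (\<integral>z. h s z \<partial>disc)" for s
    using disc_rotate[of "h s" "cis t"] h[of s] by auto
  have e: "(J (F z) - J (F (cis t * z))) * (F z - F (cis t * z)) =
      h 0 z - h t z - h (- t) (cis t * z) + h 0 (cis t * z)" for z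
  proof -
    have "cis (- t) * (cis t * z) = z" using c by (metis mult.assoc mult.commute mult_1)
    then have "h (- t) (cis t * z) = J (F (cis t * z)) * F z" by (simp only: h_def)
    then show ?thesis by (simp only: h_def cis_zero mult_1) (simp only: algebra_simps)
  qed
  have int: "integrable disc (\<lambda>z. (J (F z) - J (F (cis t * z))) * (F z - F (cis t * z)))"
    unfolding e by (intro Bochner_Integration.integrable_add Bochner_Integration.integrable_diff h h_rot)
  then show "integrable disc (energy t)"
    unfolding energy_def[abs_def] by (rule integrable_Re)
  have "(\<integral>z. (J (F z) - J (F (cis t * z))) * (F z - F (cis t * z)) \<partial>disc)
     = (\<integral>z. h 0 z \<partial>disc) - (\<integral>z. h t z \<partial>disc) - (\<integral>z. h (- t) z \<partial>disc) + (\<integral>z. h 0 z \<partial>disc)"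
    unfolding e
    by (simp add: Bochner_Integration.integral_add Bochner_Integration.integral_diff h h_rot)
  also have "\<dots> = of_real (pi / M) * (2 * \<phi> F - \<phi> (\<lambda>z. F (cis t * z)) - \<phi> (\<lambda>z. F (cis (- t) * z)))"
    unfolding h_int by (simp add: algebra_simps)
  finally show "(\<integral>z. energy t z \<partial>disc) =
      pi / M * Re (2 * \<phi> F - \<phi> (\<lambda>z. F (cis t * z)) - \<phi> (\<lambda>z. F (cis (- t) * z)))"
    unfolding energy_def using integral_Re[OF int] by simp
qed

text \<open>The second difference of \<^term>\<open>\<lambda>t. \<phi> (\<lambda>z. F (cis t * z))\<close> is \<open>O(t\<^sup>2)\<close>
  because this function of \<open>t\<close> is a trigonometric polynomial.\<close>

lemma energy_bound:
  "\<exists>C>0. \<forall>t. (\<integral>z. energy t z \<partial>disc) \<le> C * t\<^sup>2"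
proof (intro exI conjI allI)
  define D where "D = (\<Sum>j\<le>degree k. norm (coeff k j) * norm (moment F 0 j) * (real j)\<^sup>2)"
  have D: "0 \<le> D" unfolding D_def by (intro sum_nonneg) auto
  \<comment> \<open>The added 1 keeps the constant positive even if \<open>D\<close> is 0; it later
    serves as a divisor.\<close>
  show "0 < D / M + 1" using D M_pos by (simp add: add_nonneg_pos)
  fix t :: real
  define c where "c j = cnj (coeff k j) * moment F 0 j" for j
  have "2 * \<phi> F - \<phi> (\<lambda>z. F (cis t * z)) - \<phi> (\<lambda>z. F (cis (- t) * z))
     = (\<Sum>j\<le>degree k. c j * of_real (2 - 2 * cos (real j * t))) / of_real pi"
  proof -
    have e: "cis (real j * t) + cis (- (real j * t)) = of_real (2 * cos (real j * t))" for j
      by (simp add: complex_eq_iff)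
    have "2 * \<phi> F - \<phi> (\<lambda>z. F (cis t * z)) - \<phi> (\<lambda>z. F (cis (- t) * z))
       = (\<Sum>j\<le>degree k. 2 * c j - c j * cis (real j * t) - c j * cis (- (real j * t))) / of_real pi"
      using functional_rotate[of 0 0] functional_rotate[of 0 t] functional_rotate[of 0 "-t"]
      by (simp add: c_def sum_subtractf sum_distrib_left diff_divide_distrib mult_ac)
    also have "(\<Sum>j\<le>degree k. 2 * c j - c j * cis (real j * t) - c j * cis (- (real j * t)))
       = (\<Sum>j\<le>degree k. c j * of_real (2 - 2 * cos (real j * t)))"
      unfolding of_real_diff e[symmetric] by (intro sum.cong refl) (simp add: algebra_simps)
    finally show ?thesis .
  qed
  then have "Re (2 * \<phi> F - \<phi> (\<lambda>z. F (cis t * z)) - \<phi> (\<lambda>z. F (cis (- t) * z)))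
     \<le> norm ((\<Sum>j\<le>degree k. c j * of_real (2 - 2 * cos (real j * t))) / of_real pi)"
    by (metis complex_Re_le_cmod)
  also have "\<dots> \<le> D * t\<^sup>2 / pi"
  proof -
    have "norm (c j * of_real (2 - 2 * cos (real j * t))) \<le> norm (coeff k j) * norm (moment F 0 j) * (real j)\<^sup>2 * t\<^sup>2" for j
    proof -
      have "\<bar>2 - 2 * cos (real j * t)\<bar> \<le> (real j)\<^sup>2 * t\<^sup>2"
        using two_minus_two_cos_le[of "real j * t"] cos_le_one[of "real j * t"] by (simp add: power_mult_distrib)
      then have "norm (c j) * \<bar>2 - 2 * cos (real j * t)\<bar> \<le> norm (c j) * ((real j)\<^sup>2 * t\<^sup>2)"
        by (intro mult_left_mono) auto
      then show ?thesis unfolding norm_mult norm_of_real by (simp add: c_def norm_mult mult.assoc)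
    qed
    then have "norm (\<Sum>j\<le>degree k. c j * of_real (2 - 2 * cos (real j * t))) \<le> D * t\<^sup>2"
      unfolding D_def sum_distrib_right by (intro sum_norm_le) 
    then show ?thesis by (simp add: norm_divide divide_right_mono)
  qed
  finally have "Re (2 * \<phi> F - \<phi> (\<lambda>z. F (cis t * z)) - \<phi> (\<lambda>z. F (cis (- t) * z))) \<le> D * t\<^sup>2 / pi" .
  from mult_left_mono[OF this, of "pi / M"] have "(\<integral>z. energy t z \<partial>disc) \<le> D / M * t\<^sup>2"
    unfolding integral_energy using M_pos by simp
  also have "\<dots> \<le> (D / M + 1) * t\<^sup>2" by (intro mult_right_mono) auto
  finally show "(\<integral>z. energy t z \<partial>disc) \<le> (D / M + 1) * t\<^sup>2" .
qed

lemma F_rotate_quotient_tendsto: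
  assumes "norm z < 1"
  shows "((\<lambda>t. (F (cis t * z) - F z) / of_real t) \<longlongrightarrow> \<i> * z * F' z) (at 0)"
  using has_vector_derivative_imp_quotient_tendsto[OF has_vector_derivative_rotate[OF holomorphic_F assms, of 0]]
  by (simp add: scaleR_conv_of_real field_simps)

text \<open>Fatou's lemma applied to the difference quotients in the strong monotonicity inequality.\<close>

lemma integrable_weighted_derivative:
  "integrable disc (\<lambda>z. norm (F z) powr (p - 2) * (norm (z * F' z))\<^sup>2)" (is "integrable _ ?g")
proof (rule integrableI_bounded)
  show "?g \<in> borel_measurable disc" by measurable
  obtain C where C: "0 < C" "\<And>t. (\<integral>z. energy t z \<partial>disc) \<le> C * t\<^sup>2" using energy_bound by blast
  define T where "T n = 1 / real (Suc n)" for n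
  have T0: "T n > 0" for n by (simp add: T_def)
  have T: "filterlim T (at 0) sequentially"
    using LIMSEQ_inverse_real_of_nat T0 less_imp_neq[OF T0] by (auto simp: filterlim_at T_def[abs_def] inverse_eq_divide)
  define q where "q n z = max (norm (F z)) (norm (F (cis (T n) * z))) powr (p - 2) * (norm ((F (cis (T n) * z) - F z) / of_real (T n)))\<^sup>2" for n z
  have [measurable]: "q n \<in> borel_measurable disc" for n
    unfolding q_def[abs_def] by measurable
  have q_le: "q n z \<le> energy (T n) z / (strong_const * (T n)\<^sup>2)" for n z
  proof -
    have "strong_const * max (norm (F z)) (norm (F (cis (T n) * z))) powr (p - 2) * (norm (F z - F (cis (T n) * z)))\<^sup>2
       \<le> energy (T n) z"
      unfolding energy_def strong_const_def by (rule dual_power_strongly_monotone[OF p])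
    then have "strong_const * (T n)\<^sup>2 * q n z \<le> energy (T n) z"
      using T0[of n] by (simp add: q_def norm_divide norm_minus_commute power_divide mult_ac)
    then show ?thesis using strong_const_pos T0[of n]
      by (simp add: pos_le_divide_eq mult.commute)
  qed
  have q_int: "(\<integral>\<^sup>+z. ennreal (q n z) \<partial>disc) \<le> ennreal (C / strong_const)" for n
  proof -
    have "(\<integral>\<^sup>+z. ennreal (q n z) \<partial>disc) \<le> (\<integral>\<^sup>+z. ennreal (energy (T n) z / (strong_const * (T n)\<^sup>2)) \<partial>disc)"
      by (intro nn_integral_mono ennreal_leI q_le)
    also have "\<dots> = ennreal (\<integral>z. energy (T n) z / (strong_const * (T n)\<^sup>2) \<partial>disc)"
      using strong_const_pos integrable_energy[of "T n"]
      by (intro nn_integral_eq_integral) (auto simp: energy_nonneg)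
    also have "\<dots> \<le> ennreal (C / strong_const)"
    proof (rule ennreal_leI)
      have "(\<integral>z. energy (T n) z / (strong_const * (T n)\<^sup>2) \<partial>disc) = (\<integral>z. energy (T n) z \<partial>disc) / (strong_const * (T n)\<^sup>2)"
        by simp
      also have "\<dots> \<le> C * (T n)\<^sup>2 / (strong_const * (T n)\<^sup>2)"
        using strong_const_pos T0[of n] C by (intro divide_right_mono) auto
      also have "\<dots> = C / strong_const" using T0[of n] by simp
      finally show "(\<integral>z. energy (T n) z / (strong_const * (T n)\<^sup>2) \<partial>disc) \<le> C / strong_const" .
    qed
    finally show ?thesis .
  qed
  have g_le: "ennreal (norm (?g z)) \<le> liminf (\<lambda>n. ennreal (q n z))" if "z \<in> space disc" for z
  \<comment> \<open>At a zero of \<open>F\<close> the weight is 0, as \<open>0 powr x\<close> is 0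
    for every x. Elsewhere the maximum stays away from 0 and the power is continuous, also for a
    negative exponent.\<close>
  proof (cases "F z = 0")
    case True
    then show ?thesis by simp
  next
    case False
    have z: "norm z < 1" using that by simp
    have lim: "(\<lambda>n. (F (cis (T n) * z) - F z) / of_real (T n)) \<longlonglongrightarrow> \<i> * z * F' z"
      by (rule filterlim_compose[OF F_rotate_quotient_tendsto[OF z] T])
    have "isCont (\<lambda>t. F (cis t * z)) 0"
      by (rule has_vector_derivative_continuous[OF has_vector_derivative_rotate[OF holomorphic_F z]])
    then have "((\<lambda>t. F (cis t * z)) \<longlongrightarrow> F z) (at 0)" by (simp add: isCont_def)
    then have "(\<lambda>n. F (cis (T n) * z)) \<longlonglongrightarrow> F z" by (rule filterlim_compose[OF _ T])
    then have m: "(\<lambda>n. max (norm (F z)) (norm (F (cis (T n) * z))) powr (p - 2)) \<longlonglongrightarrow> max (norm (F z)) (norm (F z)) powr (p - 2)"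
      using False by (intro tendsto_intros) auto
    have "(\<lambda>n. q n z) \<longlonglongrightarrow> max (norm (F z)) (norm (F z)) powr (p - 2) * (norm (\<i> * z * F' z))\<^sup>2"
      unfolding q_def by (intro tendsto_mult tendsto_power tendsto_norm lim m)
    then have "(\<lambda>n. q n z) \<longlonglongrightarrow> ?g z" by (simp add: norm_mult)
    then have "(\<lambda>n. ennreal (q n z)) \<longlonglongrightarrow> ennreal (?g z)" by (rule tendsto_ennrealI)
    then have "liminf (\<lambda>n. ennreal (q n z)) = ennreal (?g z)"
      by (rule lim_imp_Liminf[OF sequentially_bot])
    then show ?thesis by simp
  qed
  have "(\<integral>\<^sup>+z. ennreal (norm (?g z)) \<partial>disc) \<le> (\<integral>\<^sup>+z. liminf (\<lambda>n. ennreal (q n z)) \<partial>disc)"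
    by (rule nn_integral_mono) (rule g_le)
  also have "\<dots> \<le> liminf (\<lambda>n. \<integral>\<^sup>+z. ennreal (q n z) \<partial>disc)"
    by (rule nn_integral_liminf) measurable
  also have "\<dots> \<le> liminf (\<lambda>n::nat. ennreal (C / strong_const))"
    by (intro Liminf_mono always_eventually allI q_int)
  also have "\<dots> = ennreal (C / strong_const)" by (simp add: Liminf_const)
  also have "\<dots> < \<infinity>" by simp
  finally show "(\<integral>\<^sup>+z. ennreal (norm (?g z)) \<partial>disc) < \<infinity>" .
qed

text \<open>Young's inequality with parameter 1 interpolates between |F|^p and the square-integral
  bound just obtained.\<close>

lemma integrable_powr_derivative:
  "integrable disc (\<lambda>z. norm (F z) powr (p - 1) * norm (z * F' z))"
proof (rule Bochner_Integration.integrable_bound)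
  show "integrable disc (\<lambda>z. (norm (F z) powr p / 1 + 1 * (norm (F z) powr (p - 2) * (norm (z * F' z))\<^sup>2)) / 2)"
    using integrable_F_powr integrable_weighted_derivative by simp
  show "AE z in disc. norm (norm (F z) powr (p - 1) * norm (z * F' z)) \<le>
      norm ((norm (F z) powr p / 1 + 1 * (norm (F z) powr (p - 2) * (norm (z * F' z))\<^sup>2)) / 2)"
  proof (rule AE_I2)
    fix z
    have "norm (F z) powr (p - 1) * norm (z * F' z) \<le> (norm (F z) powr p / 1 + 1 * (norm (F z) powr (p - 2) * (norm (z * F' z))\<^sup>2)) / 2"
      by (rule norm_powr_mult_norm_le) simp
    then show "norm (norm (F z) powr (p - 1) * norm (z * F' z)) \<le>
      norm ((norm (F z) powr p / 1 + 1 * (norm (F z) powr (p - 2) * (norm (z * F' z))\<^sup>2)) / 2)"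
      by (simp add: abs_mult)
  qed
qed measurable

section \<open>Passing to the derivative in the rotation parameter under the integral\<close>

lemma annulus_integral_tendsto_0:
  fixes h :: "complex \<Rightarrow> real"
  assumes h: "integrable disc h"
  shows "((\<lambda>\<rho>. \<integral>z. indicator {z. \<rho> < norm z} z * h z \<partial>disc) \<longlongrightarrow> 0) (at_left 1)"
proof -
  have [measurable]: "h \<in> borel_measurable disc" using h by auto
  have "((\<lambda>\<rho>. \<integral>z. indicator {z. \<rho> < norm z} z * h z \<partial>disc) \<longlongrightarrow> (\<integral>z. 0 \<partial>disc)) (at_left 1)"
  proof (rule dominated_convergence_at_within)
    show "integrable disc (\<lambda>z. norm (h z))" using h by simp
    show "AE z in disc. ((\<lambda>\<rho>. indicator {z. \<rho> < norm z} z * h z) \<longlongrightarrow> 0) (at_left 1)"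
    proof (rule AE_I2)
      fix z assume "z \<in> space disc"
      then have "\<forall>\<^sub>F \<rho> in at_left 1. \<rho> \<in> {norm z<..<1}"
        by (intro eventually_at_left_real) simp
      then have "\<forall>\<^sub>F \<rho> in at_left 1. indicator {z. \<rho> < norm z} z * h z = 0"
        by eventually_elim simp
      then show "((\<lambda>\<rho>. indicator {z. \<rho> < norm z} z * h z) \<longlongrightarrow> 0) (at_left 1)"
        by (rule tendsto_eventually)
    qed
    have "(\<lambda>z. indicator {z. \<rho> < norm z} z * h z) \<in> borel_measurable disc" for \<rho>
    proof -
      have "indicator {z::complex. \<rho> < norm z} \<in> borel_measurable disc"
        by (intro borel_measurable_disc borel_measurable_indicator) measurable
      then show ?thesis by measurable
    qed
    then show "\<forall>\<^sub>F \<rho> in at_left 1. (\<lambda>z. indicator {z. \<rho> < norm z} z * h z) \<in> borel_measurable disc \<and>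
       (AE z in disc. norm (indicator {z. \<rho> < norm z} z * h z) \<le> norm (h z))"
      by (intro always_eventually allI conjI AE_I2) (auto simp: indicator_def)
  qed simp
  then show ?thesis by simp
qed

text \<open>The disc is split at a radius \<open>\<rho>\<close>. On the inner disc \<open>F'\<close>
  and J(F) are bounded, so dominated convergence applies with a constant majorant. On the outer
  annulus the limit is controlled by integrability of \<open>W\<close>, and the quotients by
  \<open>norm_powr_mult_diff_le\<close> together with the energy bound, uniformly in t.\<close>

lemma dual_power_quotient_tendsto:
  "((\<lambda>t. \<integral>z. J (F z) * (z ^ m * ((F (cis t * z) - F z) / of_real t)) \<partial>disc) \<longlongrightarrow>
    (\<integral>z. J (F z) * (z ^ m * (\<i> * z * F' z)) \<partial>disc)) (at 0)"
proof (rule tendstoI)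
  fix \<epsilon> :: real assume \<epsilon>: "0 < \<epsilon>"
  define X where "X t z = J (F z) * (z ^ m * ((F (cis t * z) - F z) / of_real t))" for t z
  define X0 where "X0 z = J (F z) * (z ^ m * (\<i> * z * F' z))" for z
  define W where "W z = norm (F z) powr (p - 1) * norm (z * F' z)" for z
  define P where "P z = norm (F z) powr p" for z
  have W: "integrable disc W" unfolding W_def by (rule integrable_powr_derivative)
  have P: "integrable disc P" unfolding P_def by (rule integrable_F_powr)
  have [measurable]: "X t \<in> borel_measurable disc" "X0 \<in> borel_measurable disc"
    "W \<in> borel_measurable disc" "P \<in> borel_measurable disc" for t
    unfolding X_def[abs_def] X0_def[abs_def] W_def[abs_def] P_def[abs_def] by measurable
  have zm: "norm (z ^ m) \<le> 1" if "z \<in> space disc" for z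
    using that by (simp add: norm_power power_le_one)
  have X0_le: "norm (X0 z) \<le> W z" if "z \<in> space disc" for z
  proof -
    have "norm (X0 z) = norm (z ^ m) * W z"
      by (simp add: X0_def W_def norm_mult norm_dual_power)
    also have "\<dots> \<le> 1 * W z" using zm[OF that] by (intro mult_right_mono) (auto simp: W_def)
    finally show ?thesis by simp
  qed
  have X0_int: "integrable disc X0"
  proof (rule Bochner_Integration.integrable_bound[OF W])
    show "AE z in disc. norm (X0 z) \<le> norm (W z)"
      by (rule AE_I2) (use X0_le abs_ge_self order_trans in \<open>fastforce\<close>)
  qed measurable
  have X_int: "integrable disc (X t)" for t
  proof -
    have "integrable disc (\<lambda>z. J (F z) * (z ^ m * F (cis t * z)))" "integrable disc (\<lambda>z. J (F z) * (z ^ m * F z))"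
      using p by (auto intro!: integrable_dual_power in_bergman_power_mult in_bergman_rotate bergman_F)
    then have "integrable disc (\<lambda>z. (J (F z) * (z ^ m * F (cis t * z)) - J (F z) * (z ^ m * F z)) / of_real t)"
      by auto
    then show ?thesis by (simp add: X_def[abs_def] algebra_simps diff_divide_distrib)
  qed
  obtain C where C: "0 < C" "\<And>t. (\<integral>z. energy t z \<partial>disc) \<le> C * t\<^sup>2" using energy_bound by blast
  note c = strong_const_pos
  \<comment> \<open>Chosen so that the energy contributes \<open>l / strong_const * C\<close>, which
    is \<open>\<epsilon> / 8\<close>, for every t. The radius \<open>\<rho>\<close> must be chosen
    after \<open>l\<close>, because the annulus term carries the factor
    \<open>2 / l\<close>.\<close>
  define l where "l = \<epsilon> * strong_const / (8 * C)"
  have l: "0 < l" using \<epsilon> c C by (simp add: l_def)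
  define out where "out \<rho> z = (indicator {z. \<rho> < norm z} z :: real)" for \<rho> and z :: complex
  have out_meas[measurable]: "out \<rho> \<in> borel_measurable disc" for \<rho>
    unfolding out_def[abs_def] by (intro borel_measurable_disc borel_measurable_indicator) measurable
  have "((\<lambda>\<rho>. \<integral>z. out \<rho> z * (2 / l * P z + W z) \<partial>disc) \<longlongrightarrow> 0) (at_left 1)"
    unfolding out_def using P W by (intro annulus_integral_tendsto_0) auto
  then have "\<forall>\<^sub>F \<rho> in at_left 1. dist (\<integral>z. out \<rho> z * (2 / l * P z + W z) \<partial>disc) 0 < \<epsilon> / 4"
    using \<epsilon> by (intro tendstoD) auto
  moreover have "\<forall>\<^sub>F \<rho> in at_left 1. \<rho> \<in> {0<..<1::real}" by (rule eventually_at_left_real) simp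
  ultimately have "\<exists>\<rho>. dist (\<integral>z. out \<rho> z * (2 / l * P z + W z) \<partial>disc) 0 < \<epsilon> / 4 \<and> \<rho> \<in> {0<..<1::real}"
    by (intro eventually_happens'[OF trivial_limit_at_left_real] eventually_conj)
  then obtain \<rho> where \<rho>: "0 < \<rho>" "\<rho> < 1" "(\<integral>z. out \<rho> z * (2 / l * P z + W z) \<partial>disc) < \<epsilon> / 4"
    by auto
  have int_out: "integrable disc (\<lambda>z. out \<rho> z * h z)" if "integrable disc h" for h :: "complex \<Rightarrow> real"
    by (rule Bochner_Integration.integrable_bound[OF that])
       (use that in \<open>auto intro!: AE_I2 simp: out_def indicator_def\<close>)
  have int_outc: "integrable disc (\<lambda>z. of_real (out \<rho> z) * h z)" if "integrable disc h" for h :: "complex \<Rightarrow> complex"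
    by (rule Bochner_Integration.integrable_bound[OF that])
       (use that in \<open>auto intro!: AE_I2 simp: out_def indicator_def\<close>)
  have int_inc: "integrable disc (\<lambda>z. of_real (1 - out \<rho> z) * h z)" if "integrable disc h" for h :: "complex \<Rightarrow> complex"
    by (rule Bochner_Integration.integrable_bound[OF that])
       (use that in \<open>auto intro!: AE_I2 simp: out_def indicator_def\<close>)
  have sub: "cball 0 \<rho> \<subseteq> ball (0::complex) 1" using \<rho> by auto
  have "continuous_on (cball 0 \<rho>) F'"
    using holomorphic_F sub by (meson continuous_on_subset holomorphic_deriv holomorphic_on_imp_continuous_on open_ball)
  then have "bounded (F' ` cball 0 \<rho>)" by (intro compact_imp_bounded compact_continuous_image) auto
  then obtain B where "\<forall>z\<in>cball 0 \<rho>. norm (F' z) \<le> B" by (auto simp: bounded_iff)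
  then have B: "norm (F' z) \<le> B" if "norm z \<le> \<rho>" for z using that by simp
  have "continuous_on (cball 0 \<rho>) (\<lambda>z. J (F z))"
  proof (rule continuous_on_compose2[OF continuous_on_dual_power[OF p]])
    show "continuous_on (cball 0 \<rho>) F"
      using holomorphic_F sub by (meson continuous_on_subset holomorphic_on_imp_continuous_on)
  qed auto
  then have "bounded ((\<lambda>z. J (F z)) ` cball 0 \<rho>)" by (intro compact_imp_bounded compact_continuous_image) auto
  then obtain B' where "\<forall>z\<in>cball 0 \<rho>. norm (J (F z)) \<le> B'" by (auto simp: bounded_iff)
  then have B': "norm (J (F z)) \<le> B'" if "norm z \<le> \<rho>" for z using that by simp
  have B0: "0 \<le> B" "0 \<le> B'" using B[of 0] B'[of 0] \<rho> by (auto intro: order_trans[OF norm_ge_zero])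
  have quot: "norm ((F (cis t * z) - F z) / of_real t) \<le> B" if z: "norm z \<le> \<rho>" and t: "t \<noteq> 0" for t z
  proof -
    have "norm (F (cis t * z) - F z) \<le> B * norm (cis t * z - z)"
    proof (rule field_differentiable_bound[where S="cball 0 \<rho>"])
      fix w :: complex assume w: "w \<in> cball 0 \<rho>"
      show "(F has_field_derivative F' w) (at w within cball 0 \<rho>)"
        by (rule has_field_derivative_at_within, rule holomorphic_derivI[OF holomorphic_F]) (use w \<rho> in auto)
      show "norm (F' w) \<le> B" using B w by simp
    qed (use z in \<open>auto simp: norm_mult\<close>)
    also have "norm (cis t * z - z) = norm (cis t - 1) * norm z"
      by (simp add: norm_mult[symmetric] left_diff_distrib)
    also have "\<dots> \<le> \<bar>t\<bar> * 1"
      using z \<rho> norm_cis_minus_1_le[of t] by (intro mult_mono) auto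
    finally show ?thesis using t B0 by (simp add: norm_divide pos_divide_le_eq mult_left_mono)
  qed
  have "((\<lambda>t. \<integral>z. of_real (1 - out \<rho> z) * X t z \<partial>disc) \<longlongrightarrow> (\<integral>z. of_real (1 - out \<rho> z) * X0 z \<partial>disc)) (at 0)"
  proof (rule dominated_convergence_at_within)
    show "integrable disc (\<lambda>z. B' * (1 * B))" by simp
    show "AE z in disc. ((\<lambda>t. of_real (1 - out \<rho> z) * X t z) \<longlongrightarrow> of_real (1 - out \<rho> z) * X0 z) (at 0)"
      unfolding X_def X0_def by (intro AE_I2 tendsto_mult tendsto_const F_rotate_quotient_tendsto) simp
    have "\<forall>\<^sub>F t in at (0::real). t \<noteq> 0" by (simp add: eventually_at_filter)
    then show "\<forall>\<^sub>F t in at 0. (\<lambda>z. of_real (1 - out \<rho> z) * X t z) \<in> borel_measurable disc \<and>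
        (AE z in disc. norm (of_real (1 - out \<rho> z) * X t z) \<le> B' * (1 * B))"
    proof eventually_elim
      case (elim t)
      have "norm (of_real (1 - out \<rho> z) * X t z) \<le> B' * (1 * B)" if "z \<in> space disc" for z
      proof (cases "norm z \<le> \<rho>")
        case True
        have "norm (X t z) \<le> B' * (1 * B)"
          unfolding X_def norm_mult using True elim zm[OF that] B0
          by (intro mult_mono B' quot) (auto simp: norm_mult[symmetric] norm_power)
        then show ?thesis using True by (simp add: out_def)
      next
        case False
        then show ?thesis using B0 by (simp add: out_def)
      qed
      then show ?case by (auto intro!: AE_I2)
    qed
  qed measurable
  then have "\<forall>\<^sub>F t in at 0. dist (\<integral>z. of_real (1 - out \<rho> z) * X t z \<partial>disc) (\<integral>z. of_real (1 - out \<rho> z) * X0 z \<partial>disc) < \<epsilon> / 4"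
    using \<epsilon> by (intro tendstoD) auto
  moreover have "\<forall>\<^sub>F t in at (0::real). t \<noteq> 0" by (simp add: eventually_at_filter)
  ultimately have "\<forall>\<^sub>F t in at 0. dist (\<integral>z. X t z \<partial>disc) (\<integral>z. X0 z \<partial>disc) < \<epsilon>"
  proof eventually_elim
    case (elim t)
    have split: "(\<integral>z. h z \<partial>disc) = (\<integral>z. of_real (1 - out \<rho> z) * h z \<partial>disc) + (\<integral>z. of_real (out \<rho> z) * h z \<partial>disc)"
      if "integrable disc h" for h :: "complex \<Rightarrow> complex"
      by (subst Bochner_Integration.integral_add[symmetric, OF int_inc[OF that] int_outc[OF that]]) (simp add: algebra_simps)
    have X_le: "norm (X t z) \<le> (P z + P (cis t * z)) / l + l / (strong_const * t\<^sup>2) * energy t z" if "z \<in> space disc" for z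
    proof -
      have "norm (X t z) = norm (z ^ m) * (norm (F z) powr (p - 1) * norm (F z - F (cis t * z)) / \<bar>t\<bar>)"
        by (simp add: X_def norm_mult norm_divide norm_dual_power norm_minus_commute mult_ac)
      also have "\<dots> \<le> 1 * (norm (F z) powr (p - 1) * norm (F z - F (cis t * z)) / \<bar>t\<bar>)"
        using zm[OF that] by (intro mult_right_mono) auto
      \<comment> \<open>The parameter is \<open>l / \<bar>t\<bar>\<close>: after division by |t| the
        first term becomes independent of t, and the energy term acquires 1/t^2, matching the
        quadratic energy bound.\<close>
      also have "norm (F z) powr (p - 1) * norm (F z - F (cis t * z)) \<le>
         (norm (F z) powr p + norm (F (cis t * z)) powr p) / (l / \<bar>t\<bar>) + (l / \<bar>t\<bar>) / strong_const * energy t z"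
        unfolding energy_def strong_const_def using l elim by (intro norm_powr_mult_diff_le p) auto
      finally have "norm (X t z) \<le> ((P z + P (cis t * z)) / (l / \<bar>t\<bar>) + (l / \<bar>t\<bar>) / strong_const * energy t z) / \<bar>t\<bar>"
        by (simp add: P_def divide_right_mono)
      also have "\<dots> = (P z + P (cis t * z)) / l + l / (strong_const * t\<^sup>2) * energy t z"
        using elim l c by (simp add: field_simps power2_eq_square)
      finally show ?thesis .
    qed
    have P_rot: "integrable disc (\<lambda>z. P (cis t * z))"
      using integrable_disc_rotate[of P "cis t"] P by simp
    have "norm (\<integral>z. of_real (out \<rho> z) * X t z \<partial>disc) \<le> (\<integral>z. norm (of_real (out \<rho> z) * X t z) \<partial>disc)"
      by (rule integral_norm_bound)
    also have "\<dots> \<le> (\<integral>z. (out \<rho> z * P z + out \<rho> z * P (cis t * z)) / l + l / (strong_const * t\<^sup>2) * energy t z \<partial>disc)"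
    proof (rule integral_mono)
      show "integrable disc (\<lambda>z. norm (of_real (out \<rho> z) * X t z))"
        by (intro integrable_norm int_outc X_int)
      show "integrable disc (\<lambda>z. (out \<rho> z * P z + out \<rho> z * P (cis t * z)) / l + l / (strong_const * t\<^sup>2) * energy t z)"
        using int_out[OF P] int_out[OF P_rot] integrable_energy[of t] by auto
      fix z assume z: "z \<in> space disc"
      have o: "out \<rho> z = 0 \<or> out \<rho> z = 1" by (auto simp: out_def indicator_def)
      have "0 \<le> l / (strong_const * t\<^sup>2) * energy t z" using l c energy_nonneg[of t z] by simp
      with X_le[OF z] o show "norm (of_real (out \<rho> z) * X t z) \<le> (out \<rho> z * P z + out \<rho> z * P (cis t * z)) / l + l / (strong_const * t\<^sup>2) * energy t z"
        by (auto simp: norm_mult)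
    qed
    also have "\<dots> = ((\<integral>z. out \<rho> z * P z \<partial>disc) + (\<integral>z. out \<rho> z * P (cis t * z) \<partial>disc)) / l
        + l / (strong_const * t\<^sup>2) * (\<integral>z. energy t z \<partial>disc)"
      using int_out[OF P] int_out[OF P_rot] integrable_energy[of t] by simp
    \<comment> \<open>The annulus is invariant under rotations, so the rotated function has the same
      mass on it.\<close>
    also have "(\<integral>z. out \<rho> z * P (cis t * z) \<partial>disc) = (\<integral>z. out \<rho> z * P z \<partial>disc)"
      using integral_disc_rotate[of "\<lambda>z. out \<rho> z * P z" "cis t"] by (simp add: out_def indicator_def norm_mult)
    also have "l / (strong_const * t\<^sup>2) * (\<integral>z. energy t z \<partial>disc) \<le> l / (strong_const * t\<^sup>2) * (C * t\<^sup>2)"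
      using C(2)[of t] l c by (intro mult_left_mono) auto
    also have "\<dots> = \<epsilon> / 8" using elim c C by (simp add: l_def field_simps)
    finally have out_X: "norm (\<integral>z. of_real (out \<rho> z) * X t z \<partial>disc) \<le> 2 / l * (\<integral>z. out \<rho> z * P z \<partial>disc) + \<epsilon> / 8"
      using l by (simp add: field_simps)
    have "norm (\<integral>z. of_real (out \<rho> z) * X0 z \<partial>disc) \<le> (\<integral>z. norm (of_real (out \<rho> z) * X0 z) \<partial>disc)"
      by (rule integral_norm_bound)
    also have "\<dots> \<le> (\<integral>z. out \<rho> z * W z \<partial>disc)"
    proof (rule integral_mono)
      show "integrable disc (\<lambda>z. norm (of_real (out \<rho> z) * X0 z))"
        by (intro integrable_norm int_outc X0_int)
      fix z assume "z \<in> space disc"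
      then show "norm (of_real (out \<rho> z) * X0 z) \<le> out \<rho> z * W z"
        using X0_le by (auto simp: norm_mult out_def indicator_def)
    qed (rule int_out[OF W])
    finally have out_X0: "norm (\<integral>z. of_real (out \<rho> z) * X0 z \<partial>disc) \<le> (\<integral>z. out \<rho> z * W z \<partial>disc)" .
    have "(\<integral>z. out \<rho> z * (2 / l * P z + W z) \<partial>disc) = (\<integral>z. 2 / l * (out \<rho> z * P z) + out \<rho> z * W z \<partial>disc)"
      by (intro Bochner_Integration.integral_cong refl) (simp add: algebra_simps)
    also have "\<dots> = 2 / l * (\<integral>z. out \<rho> z * P z \<partial>disc) + (\<integral>z. out \<rho> z * W z \<partial>disc)"
      using int_out[OF P] int_out[OF W] by simp
    finally have small: "2 / l * (\<integral>z. out \<rho> z * P z \<partial>disc) + (\<integral>z. out \<rho> z * W z \<partial>disc) < \<epsilon> / 4"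
      using \<rho>(3) by simp
    have tri: "norm ((a1 + b1) - (a2 + b2)) \<le> norm (a1 - a2) + norm b1 + norm b2" for a1 a2 b1 b2 :: complex
      using norm_triangle_ineq[of "a1 - a2" "b1 - b2"] norm_triangle_ineq4[of b1 b2] by (simp add: algebra_simps)
    have "dist (\<integral>z. X t z \<partial>disc) (\<integral>z. X0 z \<partial>disc) \<le>
        dist (\<integral>z. of_real (1 - out \<rho> z) * X t z \<partial>disc) (\<integral>z. of_real (1 - out \<rho> z) * X0 z \<partial>disc)
        + norm (\<integral>z. of_real (out \<rho> z) * X t z \<partial>disc) + norm (\<integral>z. of_real (out \<rho> z) * X0 z \<partial>disc)"
      unfolding dist_norm split[OF X_int] split[OF X0_int] by (rule tri)
    also have "\<dots> < \<epsilon>"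
      using elim(1) out_X out_X0 small \<epsilon> by linarith
    finally show ?case .
  qed
  then show "\<forall>\<^sub>F t in at 0. dist (\<integral>z. J (F z) * (z ^ m * ((F (cis t * z) - F z) / of_real t)) \<partial>disc)
      (\<integral>z. J (F z) * (z ^ m * (\<i> * z * F' z)) \<partial>disc) < \<epsilon>"
    by (simp add: X_def X0_def)
qed

lemma integral_dual_power_moment:
  "(\<integral>z. J (F z) * (z ^ m * F (cis t * z)) \<partial>disc) =
    (\<Sum>j\<le>degree k. cnj (coeff k j) * (cis ((real j - real m) * t) * moment F m j)) / of_real M"
proof -
  have "in_bergman p (\<lambda>z. z ^ m * F (cis t * z))"
    using p by (intro in_bergman_power_mult in_bergman_rotate bergman_F) auto
  then show ?thesis by (simp add: functional_eq functional_rotate)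
qed

text \<open>Both sides of \<open>integral_dual_power_moment\<close> are differentiated at t = 0. The
  trigonometric polynomial brings down i(j - m), the difference quotients on the left converge to
  the integral with i z F', and the common factor i cancels.\<close>

lemma integral_dual_power_derivative_moment:
  "(\<integral>z. J (F z) * (z ^ m * (z * F' z)) \<partial>disc) =
    (\<Sum>j\<le>degree k. cnj (coeff k j) * (of_real (real j - real m) * moment F m j)) / of_real M"
proof -
  define \<Psi> where "\<Psi> t = (\<Sum>j\<le>degree k. cnj (coeff k j) * (cis ((real j - real m) * t) * moment F m j)) / of_real M" for t
  define D where "D = (\<Sum>j\<le>degree k. cnj (coeff k j) * ((\<i> * of_real (real j - real m) * cis ((real j - real m) * 0)) * moment F m j)) / of_real M"
  have "(\<Psi> has_vector_derivative D) (at 0)"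
    unfolding \<Psi>_def[abs_def] D_def
    by (intro has_vector_derivative_divide has_vector_derivative_sum has_vector_derivative_mult_right
        has_vector_derivative_mult_left cis_has_vector_derivative)
  then have "((\<lambda>t. (\<Psi> t - \<Psi> 0) /\<^sub>R (t - 0)) \<longlongrightarrow> D) (at 0)"
    by (rule has_vector_derivative_imp_quotient_tendsto)
  moreover have "(\<Psi> t - \<Psi> 0) /\<^sub>R (t - 0) = (\<integral>z. J (F z) * (z ^ m * ((F (cis t * z) - F z) / of_real t)) \<partial>disc)" for t
  proof -
    have i: "integrable disc (\<lambda>z. J (F z) * (z ^ m * F (cis t * z)))" for t
      using p by (auto intro!: integrable_dual_power in_bergman_power_mult in_bergman_rotate bergman_F)
    have "\<Psi> t - \<Psi> 0 = (\<integral>z. J (F z) * (z ^ m * F (cis t * z)) \<partial>disc) - (\<integral>z. J (F z) * (z ^ m * F (cis 0 * z)) \<partial>disc)"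
      unfolding \<Psi>_def integral_dual_power_moment ..
    also have "\<dots> = (\<integral>z. J (F z) * (z ^ m * F (cis t * z)) - J (F z) * (z ^ m * F (cis 0 * z)) \<partial>disc)"
      by (rule Bochner_Integration.integral_diff[symmetric]) (rule i)+
    finally have "(\<Psi> t - \<Psi> 0) / of_real t = (\<integral>z. (J (F z) * (z ^ m * F (cis t * z)) - J (F z) * (z ^ m * F (cis 0 * z))) / of_real t \<partial>disc)"
      by simp
    also have "\<dots> = (\<integral>z. J (F z) * (z ^ m * ((F (cis t * z) - F z) / of_real t)) \<partial>disc)"
      by (intro Bochner_Integration.integral_cong refl) (simp add: algebra_simps diff_divide_distrib)
    finally show ?thesis by (simp add: scaleR_conv_of_real divide_inverse mult.commute)
  qed
  ultimately have "((\<lambda>t. \<integral>z. J (F z) * (z ^ m * ((F (cis t * z) - F z) / of_real t)) \<partial>disc) \<longlongrightarrow> D) (at 0)"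
    by simp
  from tendsto_unique[OF _ dual_power_quotient_tendsto this]
  have "(\<integral>z. J (F z) * (z ^ m * (\<i> * z * F' z)) \<partial>disc) = D" by simp
  moreover have "(\<integral>z. J (F z) * (z ^ m * (\<i> * z * F' z)) \<partial>disc) = \<i> * (\<integral>z. J (F z) * (z ^ m * (z * F' z)) \<partial>disc)"
  proof -
    have "J (F z) * (z ^ m * (\<i> * z * F' z)) = \<i> * (J (F z) * (z ^ m * (z * F' z)))" for z by (simp add: mult_ac)
    then show ?thesis by (simp only:) (rule integral_mult_right_zero)
  qed
  moreover have "D = \<i> * ((\<Sum>j\<le>degree k. cnj (coeff k j) * (of_real (real j - real m) * moment F m j)) / of_real M)"
    unfolding D_def by (simp add: sum_distrib_left mult_ac)
  ultimately have "\<i> * (\<integral>z. J (F z) * (z ^ m * (z * F' z)) \<partial>disc)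
     = \<i> * ((\<Sum>j\<le>degree k. cnj (coeff k j) * (of_real (real j - real m) * moment F m j)) / of_real M)"
    by (simp only:)
  then show ?thesis by (simp only: mult_left_cancel[OF complex_i_not_zero])
qed

end

section \<open>Radial limits and Green's formula\<close>

text \<open>The fundamental theorem holds on \<open>{a..r}\<close> for r < 1, and integrability of
  \<open>g\<close> carries it to the endpoint by dominated convergence. The bound is uniform in r,
  which later makes it a majorant in the angle.\<close>

lemma
  fixes G g :: "real \<Rightarrow> complex"
  assumes a: "0 \<le> a" "a < 1"
    and der: "\<And>r. a \<le> r \<Longrightarrow> r < 1 \<Longrightarrow> (G has_vector_derivative g r) (at r)"
    and cont: "continuous_on {a..<1} g"
    and int: "integrable radius (\<lambda>r. indicator {a..} r *\<^sub>R g r)"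
  shows radial_FTC_tendsto: "(G \<longlongrightarrow> G a + (\<integral>r. indicator {a..} r *\<^sub>R g r \<partial>radius)) (at_left 1)"
    and radial_FTC_bound: "\<And>r. a \<le> r \<Longrightarrow> r < 1 \<Longrightarrow>
      norm (G r - G a) \<le> (\<integral>r. norm (indicator {a..} r *\<^sub>R g r) \<partial>radius)"
proof -
  define u where "u r = (indicator {a..} r *\<^sub>R g r)" for r
  have u: "integrable radius u" using int by (simp add: u_def[abs_def])
  then have [measurable]: "u \<in> borel_measurable radius" by auto
  have ind[measurable]: "(\<lambda>x. indicator {..r} x *\<^sub>R u x) \<in> borel_measurable radius" for r :: real
  proof -
    have "indicator {..r} \<in> borel_measurable radius"
      by (intro borel_measurable_radius borel_measurable_indicator) auto
    then show ?thesis by measurable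
  qed
  have eq: "(\<integral>x. indicator {..r} x *\<^sub>R u x \<partial>radius) = G r - G a" if r: "a \<le> r" "r < 1" for r
  proof -
    have m: "(\<lambda>x. indicator {0<..<1} x *\<^sub>R (indicator {..r} x *\<^sub>R u x)) \<in> borel_measurable lborel"
      using ind[of r] unfolding radius_def by (subst (asm) borel_measurable_restrict_space_iff) auto
    have "continuous_on {a..r} g" using cont r by (auto intro: continuous_on_subset)
    then have m': "(\<lambda>x. indicator {a..r} x *\<^sub>R g x) \<in> borel_measurable lborel"
      using borel_measurable_continuous_on_indicator[of "{a..r}" g] by simp
    have "(\<integral>x. indicator {..r} x *\<^sub>R u x \<partial>radius) = (\<integral>x. indicator {0<..<1} x *\<^sub>R (indicator {..r} x *\<^sub>R u x) \<partial>lborel)"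
      by (simp add: radius_def integral_restrict_space)
    also have "\<dots> = (\<integral>x. indicator {a..r} x *\<^sub>R g x \<partial>lborel)"
    proof (rule integral_cong_AE[OF m m'])
      show "AE x in lborel. indicator {0<..<1} x *\<^sub>R (indicator {..r} x *\<^sub>R u x) = indicator {a..r} x *\<^sub>R g x"
        using AE_lborel_singleton[of "0::real"]
      proof eventually_elim
        case (elim x)
        show ?case
          using elim a r by (cases "a \<le> x"; cases "x \<le> r") (simp_all add: u_def indicator_def)
      qed
    qed
    also have "\<dots> = G r - G a"
    proof (rule integral_FTC_atLeastAtMost[OF r(1) _ \<open>continuous_on {a..r} g\<close>])
      fix x assume "a \<le> x" "x \<le> r"
      then show "(G has_vector_derivative g x) (at x within {a..r})"
        using r by (intro has_vector_derivative_at_within[OF der]) auto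
    qed
    finally show ?thesis .
  qed
  have "((\<lambda>r. \<integral>x. indicator {..r} x *\<^sub>R u x \<partial>radius) \<longlongrightarrow> (\<integral>x. u x \<partial>radius)) (at_left 1)"
  proof (rule dominated_convergence_at_within)
    show "integrable radius (\<lambda>x. norm (u x))" using u by simp
    show "AE x in radius. ((\<lambda>r. indicator {..r} x *\<^sub>R u x) \<longlongrightarrow> u x) (at_left 1)"
    proof (rule AE_I2)
      fix x assume "x \<in> space radius"
      then have "\<forall>\<^sub>F r in at_left 1. r \<in> {x<..<1}" by (intro eventually_at_left_real) simp
      then have "\<forall>\<^sub>F r in at_left 1. indicator {..r} x *\<^sub>R u x = u x"
        by eventually_elim simp
      then show "((\<lambda>r. indicator {..r} x *\<^sub>R u x) \<longlongrightarrow> u x) (at_left 1)"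
        by (rule tendsto_eventually)
    qed
    show "\<forall>\<^sub>F r in at_left 1. (\<lambda>x. indicator {..r} x *\<^sub>R u x) \<in> borel_measurable radius \<and>
       (AE x in radius. norm (indicator {..r} x *\<^sub>R u x) \<le> norm (u x))"
      by (intro always_eventually allI conjI AE_I2 ind) (auto simp: indicator_def)
  qed measurable
  moreover have "\<forall>\<^sub>F r in at_left 1. r \<in> {a<..<1}" using a by (intro eventually_at_left_real) simp
  then have "\<forall>\<^sub>F r in at_left 1. (\<integral>x. indicator {..r} x *\<^sub>R u x \<partial>radius) = G r - G a"
    by eventually_elim (rule eq, auto)
  ultimately have "((\<lambda>r. G r - G a) \<longlongrightarrow> (\<integral>x. u x \<partial>radius)) (at_left 1)"
    by (rule Lim_transform_eventually)
  from tendsto_add[OF this tendsto_const[of "G a"]]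
  show "(G \<longlongrightarrow> G a + (\<integral>r. indicator {a..} r *\<^sub>R g r \<partial>radius)) (at_left 1)"
    by (simp add: u_def add.commute)
  fix r assume r: "a \<le> r" "r < 1"
  have "norm (G r - G a) \<le> (\<integral>x. norm (indicator {..r} x *\<^sub>R u x) \<partial>radius)"
    unfolding eq[OF r, symmetric] by (rule integral_norm_bound)
  also have "\<dots> \<le> (\<integral>x. norm (u x) \<partial>radius)"
    using u by (intro integral_mono integrable_norm Bochner_Integration.integrable_bound[OF u ind])
      (auto simp: indicator_def intro!: AE_I2)
  finally show "norm (G r - G a) \<le> (\<integral>r. norm (indicator {a..} r *\<^sub>R g r) \<partial>radius)"
    by (simp add: u_def)
qed

text \<open>By continuity in the radius, existence of the radial limit can be tested on rational radii;
  where it fails to exist, \<^const>\<open>boundary_val\<close> takes one fixed value.\<close>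

lemma boundary_val_measurable:
  assumes F: "F holomorphic_on ball 0 1"
  shows "boundary_val F \<in> borel_measurable borel"
proof -
  define f where "f r \<theta> = F (polar r \<theta>)" for r \<theta>
  have contF: "continuous_on (ball 0 1) F" using F by (rule holomorphic_on_imp_continuous_on)
  have f_meas: "f r \<in> borel_measurable borel" if "0 \<le> r" "r < 1" for r
    unfolding f_def[abs_def]
    by (intro borel_measurable_continuous_onI continuous_on_compose2[OF contF] continuous_intros)
       (use that in \<open>auto simp: norm_mult\<close>)
  have f_cont: "isCont (\<lambda>r. f r \<theta>) r" if "0 \<le> r" "r < 1" for r \<theta>
    unfolding f_def using has_vector_derivative_radial[OF F, of r \<theta>] that
    by (intro has_vector_derivative_continuous) auto
  define R where "R n = 1 - 1 / real (n + 2)" for n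
  have R: "0 \<le> R n" "R n < 1" for n by (auto simp: R_def field_simps)
  have R_lim: "filterlim R (at_left 1) sequentially"
  proof -
    have "R \<longlonglongrightarrow> 1 - 0"
      unfolding R_def[abs_def] by (intro tendsto_diff tendsto_const LIMSEQ_ignore_initial_segment[OF lim_1_over_n])
    then show ?thesis using R by (auto simp: filterlim_at less_imp_neq)
  qed
  \<comment> \<open>A measurable candidate for the radial limit, taken along one fixed sequence of
    radii. It is arbitrary where that sequence diverges, but there \<open>E\<close> fails.\<close>
  define L where "L \<theta> = lim (\<lambda>n. f (R n) \<theta>)" for \<theta>
  have [measurable]: "f (R n) \<in> borel_measurable borel" for n using R by (rule f_meas)
  have L[measurable]: "L \<in> borel_measurable borel" unfolding L_def[abs_def] by measurable
  define Q where "Q N = {q \<in> \<rat>. 1 - 1 / real (Suc N) < q \<and> q < (1::real)}" for N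
  have Q: "0 \<le> q" "q < 1" if "q \<in> Q N" for q N
  proof -
    have "1 / real (Suc N) \<le> 1" by simp
    moreover have "1 - 1 / real (Suc N) < q" "q < 1" using that by (auto simp: Q_def)
    ultimately show "0 \<le> q" "q < 1" by linarith+
  qed
  have Q_count: "countable (Q N)" for N
    using countable_rat by (rule countable_subset[rotated]) (auto simp: Q_def)
  define E where "E \<theta> \<longleftrightarrow> (\<forall>n. \<exists>N. \<forall>q\<in>Q N. norm (f q \<theta> - L \<theta>) \<le> 1 / real (Suc n))" for \<theta>
  have E_meas[measurable]: "Measurable.pred borel E"
    unfolding E_def[abs_def]
  proof (intro pred_intros_countable)
    fix n N :: nat
    have "Measurable.pred borel (\<lambda>\<theta>. norm (f q \<theta> - L \<theta>) \<le> 1 / real (Suc n))" if "q \<in> Q N" for q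
    proof -
      have [measurable]: "f q \<in> borel_measurable borel" using Q[OF that] by (intro f_meas)
      show ?thesis by measurable
    qed
    then have "{\<theta> \<in> space borel. norm (f q \<theta> - L \<theta>) \<le> 1 / real (Suc n)} \<in> sets borel" if "q \<in> Q N" for q
      using that by (auto simp: pred_def)
    then show "Measurable.pred borel (\<lambda>\<theta>. \<forall>q\<in>Q N. norm (f q \<theta> - L \<theta>) \<le> 1 / real (Suc n))"
      unfolding pred_def by (intro sets.sets_Collect_countable_All' Q_count)
  qed
  have E_lim: "((\<lambda>r. f r \<theta>) \<longlongrightarrow> L \<theta>) (at_left 1)" if "E \<theta>" for \<theta>
  proof (rule tendstoI)
    fix e :: real assume "0 < e"
    then obtain n where n: "1 / real (Suc n) < e" using nat_approx_posE by blast
    obtain N where N: "\<And>q. q \<in> Q N \<Longrightarrow> norm (f q \<theta> - L \<theta>) \<le> 1 / real (Suc n)"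
      using \<open>E \<theta>\<close> unfolding E_def by blast
    \<comment> \<open>A violation at some radius would persist nearby by continuity, hence also at a
      rational radius slightly to the right, contradicting the bound on \<open>Q N\<close>.\<close>
    have le: "norm (f r \<theta> - L \<theta>) \<le> 1 / real (Suc n)" if r: "1 - 1 / real (Suc N) < r" "r < 1" for r
    proof (rule ccontr)
      assume neg: "\<not> norm (f r \<theta> - L \<theta>) \<le> 1 / real (Suc n)"
      have "1 / real (Suc N) \<le> 1" by simp
      then have r0: "0 \<le> r" using r by linarith
      have "isCont (\<lambda>r. norm (f r \<theta> - L \<theta>)) r"
        by (intro continuous_intros f_cont r0 r)
      then have "\<forall>\<^sub>F s in at r. 1 / real (Suc n) < norm (f s \<theta> - L \<theta>)"
        using neg unfolding isCont_def by (intro order_tendstoD) auto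
      then obtain d where d: "0 < d" "\<And>s. s \<noteq> r \<Longrightarrow> dist s r < d \<Longrightarrow> 1 / real (Suc n) < norm (f s \<theta> - L \<theta>)"
        unfolding eventually_at by blast
      have "r < min 1 (r + d)" using r d by simp
      then obtain q where q: "q \<in> \<rat>" "r < q" "q < min 1 (r + d)" using Rats_dense_in_real by blast
      then have "q \<in> Q N" using r by (auto simp: Q_def)
      from N[OF this] d(2)[of q] q show False by (auto simp: dist_real_def)
    qed
    have "\<forall>\<^sub>F r in at_left 1. r \<in> {1 - 1 / real (Suc N)<..<1}"
      by (rule eventually_at_left_real) simp
    then show "\<forall>\<^sub>F r in at_left 1. dist (f r \<theta>) (L \<theta>) < e"
    proof eventually_elim
      case (elim r)
      then show ?case using le[of r] n by (auto simp: dist_norm)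
    qed
  qed
  have lim_E: "E \<theta>" if l: "((\<lambda>r. f r \<theta>) \<longlongrightarrow> l) (at_left 1)" for \<theta> l
  proof -
    have "(\<lambda>n. f (R n) \<theta>) \<longlonglongrightarrow> l" by (rule filterlim_compose[OF l R_lim])
    then have "L \<theta> = l" unfolding L_def by (rule limI)
    show ?thesis
      unfolding E_def
    proof
      fix n
      have "\<forall>\<^sub>F r in at_left 1. dist (f r \<theta>) l < 1 / real (Suc n)"
        by (rule tendstoD[OF l]) simp
      from iffD1[OF eventually_at_left[OF zero_less_one] this]
      obtain b where b: "b < 1" "\<And>r. b < r \<Longrightarrow> r < 1 \<Longrightarrow> dist (f r \<theta>) l < 1 / real (Suc n)"
        by blast
      obtain N where "1 / real (Suc N) < 1 - b" using nat_approx_posE[of "1 - b"] b by auto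
      then have "\<forall>q\<in>Q N. norm (f q \<theta> - L \<theta>) \<le> 1 / real (Suc n)"
        using b(2) by (auto simp: Q_def dist_norm \<open>L \<theta> = l\<close> intro!: less_imp_le simp del: of_nat_Suc)
      then show "\<exists>N. \<forall>q\<in>Q N. norm (f q \<theta> - L \<theta>) \<le> 1 / real (Suc n)" ..
    qed
  qed
  have "boundary_val F = (\<lambda>\<theta>. if E \<theta> then L \<theta> else (THE l. False))"
  proof
    fix \<theta>
    show "boundary_val F \<theta> = (if E \<theta> then L \<theta> else (THE l. False))"
    proof (cases "E \<theta>")
      case True
      from tendsto_Lim[OF trivial_limit_at_left_real E_lim[OF this]] True
      show ?thesis by (simp add: boundary_val_def f_def)
    next
      case False
      then have "(\<lambda>l. ((\<lambda>r. f r \<theta>) \<longlongrightarrow> l) (at_left 1)) = (\<lambda>l. False)" using lim_E by blast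
      then show ?thesis using False by (simp add: boundary_val_def t2_space_class.Lim_def f_def)
    qed
  qed
  also have "\<dots> \<in> borel_measurable borel" by measurable
  finally show ?thesis .
qed

lemma boundary_val_eqI:
  "((\<lambda>r. F (polar r \<theta>)) \<longlongrightarrow> l) (at_left 1) \<Longrightarrow> boundary_val F \<theta> = l"
  unfolding boundary_val_def by (rule tendsto_Lim[OF trivial_limit_at_left_real])

section \<open>Green's formula in polar coordinates\<close>

context bergman_extremal
begin

definition weighted_deriv :: "complex \<Rightarrow> real" where
  "weighted_deriv z = norm (F z) powr (p - 1) * norm (z * F' z)"

definition F_powr :: "complex \<Rightarrow> real" where
  "F_powr z = norm (F z) powr p"

lemma weighted_deriv_measurable [measurable]: "weighted_deriv \<in> borel_measurable disc"
  unfolding weighted_deriv_def[abs_def] by measurable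

lemma F_powr_measurable [measurable]: "F_powr \<in> borel_measurable disc"
  unfolding F_powr_def[abs_def] by measurable

lemma F_powr_nonneg: "0 \<le> F_powr z" by (simp add: F_powr_def)

text \<open>\<open>\<partial>\<^sub>r\<close> of \<open>r\<^sup>m\<^sup>+\<^sup>2 e\<^sup>i\<^sup>m\<^sup>\<theta> |F|\<^sup>p\<close> and \<open>\<partial>\<^sub>\<theta>\<close> of
  \<open>r\<^sup>m\<^sup>+\<^sup>1 e\<^sup>i\<^sup>m\<^sup>\<theta> |F|\<^sup>p\<close>\<close>

definition radial_deriv :: "nat \<Rightarrow> real \<Rightarrow> real \<Rightarrow> complex" where
  "radial_deriv m r \<theta> = cis (real m * \<theta>) * of_real
     (real (m + 2) * r ^ (m + 1) * F_powr (polar r \<theta>) +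
      r ^ (m + 2) * (p * Re (J (F (polar r \<theta>)) * (cis \<theta> * F' (polar r \<theta>)))))"

definition angular_deriv :: "nat \<Rightarrow> real \<Rightarrow> real \<Rightarrow> complex" where
  "angular_deriv m r \<theta> = of_real (r ^ (m + 1)) *
     (\<i> * of_real (real m) * cis (real m * \<theta>) * of_real (F_powr (polar r \<theta>)) +
      cis (real m * \<theta>) * of_real (p * Re (J (F (polar r \<theta>)) * (\<i> * (polar r \<theta>) * F' (polar r \<theta>)))))"

lemma has_real_derivative_power_mult:
  assumes "(g has_real_derivative D) (at r)"
  shows "((\<lambda>r. r ^ (m + 2) * g r) has_real_derivative real (m + 2) * r ^ (m + 1) * g r + r ^ (m + 2) * D) (at r)"
  using DERIV_mult[OF DERIV_pow[of "m + 2" r] assms] by (rule DERIV_cong) simp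

lemma has_radial_deriv:
  assumes r: "0 \<le> r" "r < 1"
  shows "((\<lambda>r. cis (real m * \<theta>) * of_real (r ^ (m + 2) * F_powr (polar r \<theta>)))
    has_vector_derivative radial_deriv m r \<theta>) (at r)"
proof -
  have "((\<lambda>r. F_powr (polar r \<theta>)) has_real_derivative
     p * Re (J (F (polar r \<theta>)) * (cis \<theta> * F' (polar r \<theta>)))) (at r)"
    unfolding F_powr_def using r
    by (intro has_real_derivative_norm_powr[OF p] has_vector_derivative_radial holomorphic_F) auto
  then have "((\<lambda>r. r ^ (m + 2) * F_powr (polar r \<theta>)) has_real_derivative
     real (m + 2) * r ^ (m + 1) * F_powr (polar r \<theta>) +
      r ^ (m + 2) * (p * Re (J (F (polar r \<theta>)) * (cis \<theta> * F' (polar r \<theta>))))) (at r)"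
    by (rule has_real_derivative_power_mult)
  then show ?thesis
    unfolding radial_deriv_def
    by (intro has_vector_derivative_mult_right has_vector_derivative_of_real)
qed

lemma has_angular_deriv:
  assumes r: "0 \<le> r" "r < 1"
  shows "((\<lambda>\<theta>. of_real (r ^ (m + 1)) * (cis (real m * \<theta>) * of_real (F_powr (polar r \<theta>))))
    has_vector_derivative angular_deriv m r \<theta>) (at \<theta>)"
proof -
  have "((\<lambda>\<theta>. F (polar r \<theta>)) has_vector_derivative \<i> * (polar r \<theta>) * F' (polar r \<theta>)) (at \<theta>)"
    using has_vector_derivative_rotate[OF holomorphic_F, of "of_real r" \<theta>] r by (simp add: mult.commute)
  then have "((\<lambda>\<theta>. F_powr (polar r \<theta>)) has_real_derivative
     p * Re (J (F (polar r \<theta>)) * (\<i> * (polar r \<theta>) * F' (polar r \<theta>)))) (at \<theta>)"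
    unfolding F_powr_def by (rule has_real_derivative_norm_powr[OF p])
  then have "((\<lambda>\<theta>. complex_of_real (F_powr (polar r \<theta>))) has_vector_derivative
     of_real (p * Re (J (F (polar r \<theta>)) * (\<i> * (polar r \<theta>) * F' (polar r \<theta>))))) (at \<theta>)"
    by (rule has_vector_derivative_of_real)
  from has_vector_derivative_mult[OF cis_has_vector_derivative[of "real m" \<theta> UNIV] this]
  show ?thesis
    unfolding angular_deriv_def
    by (intro has_vector_derivative_mult_right) (simp add: add.commute)
qed

lemma continuous_on_F: "continuous_on (ball 0 1) F"
  using holomorphic_F by (rule holomorphic_on_imp_continuous_on)

lemma continuous_on_F': "continuous_on (ball 0 1) F'"
  using holomorphic_F by (intro holomorphic_on_imp_continuous_on holomorphic_deriv) auto

lemma continuous_on_J_F: "continuous_on (ball 0 1) (\<lambda>z. J (F z))"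
  by (rule continuous_on_compose2[OF continuous_on_dual_power[OF p] continuous_on_F]) auto

lemma continuous_on_F_powr: "continuous_on (ball 0 1) F_powr"
  unfolding F_powr_def[abs_def] using p
  by (intro continuous_on_powr' continuous_intros continuous_on_F) auto

lemma continuous_on_radial_deriv: "continuous_on {0..<1} (\<lambda>r. radial_deriv m r \<theta>)"
  unfolding radial_deriv_def
  by (intro continuous_intros continuous_on_compose2[OF continuous_on_F'] continuous_on_compose2[OF continuous_on_J_F]
      continuous_on_compose2[OF continuous_on_F_powr]) (auto simp: norm_mult)

lemma continuous_on_angular_deriv:
  assumes "0 \<le> r" "r < 1"
  shows "continuous_on UNIV (\<lambda>\<theta>. angular_deriv m r \<theta>)"
  unfolding angular_deriv_def
  by (intro continuous_intros continuous_on_compose2[OF continuous_on_F'] continuous_on_compose2[OF continuous_on_J_F]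
      continuous_on_compose2[OF continuous_on_F_powr]) (use assms in \<open>auto simp: norm_mult\<close>)

text \<open>One factor r is kept as the area weight, and in the derivative term a second one turns
  |F'| into |z F'|; the remaining r^m is at most 1. What is left is integrable over the polar
  rectangle. The angular bound has the same shape.\<close>

lemma norm_radial_deriv_le:
  assumes r: "0 \<le> r" "r < 1"
  shows "norm (radial_deriv m r \<theta>) \<le>
    real (m + 2) * (r * F_powr (polar r \<theta>)) + p * (r * weighted_deriv (polar r \<theta>))"
proof -
  define \<zeta> where "\<zeta> = polar r \<theta>"
  have \<zeta>: "norm \<zeta> = r" using r by (simp add: \<zeta>_def norm_mult)
  have rm: "r ^ m \<le> 1" using r by (simp add: power_le_one)
  have "norm (radial_deriv m r \<theta>) \<le> real (m + 2) * r ^ (m + 1) * F_powr \<zeta> + \<bar>r ^ (m + 2) * (p * Re (J (F \<zeta>) * (cis \<theta> * F' \<zeta>)))\<bar>"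
    unfolding radial_deriv_def \<zeta>_def[symmetric] norm_mult norm_of_real norm_cis mult_1
    by (rule order_trans[OF abs_triangle_ineq]) (use r F_powr_nonneg[of \<zeta>] in \<open>simp add: abs_mult\<close>)
  also have "real (m + 2) * r ^ (m + 1) * F_powr \<zeta> = r ^ m * (real (m + 2) * (r * F_powr \<zeta>))"
    by simp
  also have "\<dots> \<le> 1 * (real (m + 2) * (r * F_powr \<zeta>))"
    using rm r F_powr_nonneg[of \<zeta>] by (intro mult_right_mono mult_nonneg_nonneg) auto
  also have "\<bar>r ^ (m + 2) * (p * Re (J (F \<zeta>) * (cis \<theta> * F' \<zeta>)))\<bar> = r ^ m * (p * r * (r * \<bar>Re (J (F \<zeta>) * (cis \<theta> * F' \<zeta>))\<bar>))"
    using r p by (simp add: abs_mult)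
  also have "\<dots> \<le> 1 * (p * r * (r * \<bar>Re (J (F \<zeta>) * (cis \<theta> * F' \<zeta>))\<bar>))"
    using rm r p by (intro mult_right_mono mult_nonneg_nonneg) auto
  also have "\<bar>Re (J (F \<zeta>) * (cis \<theta> * F' \<zeta>))\<bar> \<le> norm (J (F \<zeta>) * (cis \<theta> * F' \<zeta>))" by (rule abs_Re_le_cmod)
  also have "1 * (p * r * (r * norm (J (F \<zeta>) * (cis \<theta> * F' \<zeta>)))) = p * (r * weighted_deriv \<zeta>)"
    using \<zeta> by (simp add: weighted_deriv_def norm_mult norm_dual_power mult_ac)
  finally show ?thesis using r p by (simp add: \<zeta>_def mult_left_mono mult_right_mono)
qed

lemma norm_angular_deriv_le:
  assumes r: "0 \<le> r" "r < 1"
  shows "norm (angular_deriv m r \<theta>) \<le>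
    real m * (r * F_powr (polar r \<theta>)) + p * (r * weighted_deriv (polar r \<theta>))"
proof -
  define \<zeta> where "\<zeta> = polar r \<theta>"
  have rm: "r ^ (m + 1) \<le> r" using r by (simp add: power_le_one mult_left_le)
  have "norm (\<i> * of_real (real m) * cis (real m * \<theta>) * of_real (F_powr \<zeta>) +
      cis (real m * \<theta>) * of_real (p * Re (J (F \<zeta>) * (\<i> * \<zeta> * F' \<zeta>)))) \<le> real m * F_powr \<zeta> + \<bar>p * Re (J (F \<zeta>) * (\<i> * \<zeta> * F' \<zeta>))\<bar>"
    by (rule order_trans[OF norm_triangle_ineq]) (simp add: norm_mult F_powr_nonneg del: of_real_mult)
  also have "\<bar>p * Re (J (F \<zeta>) * (\<i> * \<zeta> * F' \<zeta>))\<bar> \<le> p * norm (J (F \<zeta>) * (\<i> * \<zeta> * F' \<zeta>))"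
    unfolding abs_mult using p by (intro mult_mono abs_Re_le_cmod) auto
  also have "norm (J (F \<zeta>) * (\<i> * \<zeta> * F' \<zeta>)) = weighted_deriv \<zeta>"
    by (simp add: weighted_deriv_def norm_mult norm_dual_power)
  finally have *: "norm (\<i> * of_real (real m) * cis (real m * \<theta>) * of_real (F_powr \<zeta>) +
      cis (real m * \<theta>) * of_real (p * Re (J (F \<zeta>) * (\<i> * \<zeta> * F' \<zeta>)))) \<le> real m * F_powr \<zeta> + p * weighted_deriv \<zeta>"
    by simp
  have "norm (angular_deriv m r \<theta>) \<le> r * (real m * F_powr \<zeta> + p * weighted_deriv \<zeta>)"
    unfolding angular_deriv_def \<zeta>_def[symmetric] norm_mult[of "of_real (r ^ (m + 1))"]
    using rm r by (intro mult_mono *) (auto simp: norm_power norm_mult)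
  then show ?thesis by (simp add: \<zeta>_def algebra_simps)
qed

definition disc_density :: "nat \<Rightarrow> complex \<Rightarrow> complex" where
  "disc_density m z = of_nat (2 * (m + 1)) * (J (F z) * (z ^ m * F z)) + of_real p * (J (F z) * (z ^ m * (z * F' z)))"

text \<open>The Cauchy--Riemann operator \<open>2\<partial>\<^sub>z = e\<^sup>-\<^sup>i\<^sup>\<theta>(\<partial>\<^sub>r - (i/r)\<partial>\<^sub>\<theta>)\<close> applied
  to \<open>z\<^sup>m\<^sup>+\<^sup>1 |F|\<^sup>p\<close>.\<close>

lemma radial_angular_deriv:
  "radial_deriv m r \<theta> - \<i> * angular_deriv m r \<theta> = r *\<^sub>R disc_density m (polar r \<theta>)"
proof -
  define \<zeta> w c where "\<zeta> = polar r \<theta>" and "w = J (F \<zeta>) * (\<zeta> * F' \<zeta>)" and "c = cis (real m * \<theta>)"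
  have \<zeta>m: "\<zeta> ^ m = of_real (r ^ m) * c"
    by (simp add: \<zeta>_def c_def power_mult_distrib Complex.DeMoivre)
  have r1: "of_real r * (J (F \<zeta>) * (cis \<theta> * F' \<zeta>)) = w" by (simp add: w_def \<zeta>_def mult_ac)
  have "Re (of_real r * (J (F \<zeta>) * (cis \<theta> * F' \<zeta>))) = r * Re (J (F \<zeta>) * (cis \<theta> * F' \<zeta>))"
    by (simp only: Re_complex_of_real Im_complex_of_real times_complex.sel)
  then have r2: "r * Re (J (F \<zeta>) * (cis \<theta> * F' \<zeta>)) = Re w" using r1 by simp
  have i1: "Re (J (F \<zeta>) * (\<i> * \<zeta> * F' \<zeta>)) = - Im w"
  proof -
    have "J (F \<zeta>) * (\<i> * \<zeta> * F' \<zeta>) = \<i> * w" by (simp add: w_def mult_ac)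
    then show ?thesis by (simp only:) simp
  qed
  have "r ^ (m + 2) * (p * Re (J (F \<zeta>) * (cis \<theta> * F' \<zeta>))) = r ^ (m + 1) * (p * Re w)"
    unfolding r2[symmetric] by simp
  then have rad: "radial_deriv m r \<theta> = c * of_real (real (m + 2) * r ^ (m + 1) * F_powr \<zeta> + r ^ (m + 1) * (p * Re w))"
    unfolding radial_deriv_def \<zeta>_def[symmetric] c_def[symmetric] by (simp only:)
  have ang: "angular_deriv m r \<theta> = of_real (r ^ (m + 1)) * (\<i> * of_real (real m) * c * of_real (F_powr \<zeta>) + c * of_real (p * (- Im w)))"
    unfolding angular_deriv_def \<zeta>_def[symmetric] c_def[symmetric] i1 by simp
  have w: "w = of_real (Re w) + \<i> * of_real (Im w)" by (rule complex_eq)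
  \<comment> \<open>The powers add up to (m + 2) + m = 2(m + 1), and the real part of
    \<open>w\<close> from the radius recombines with its imaginary part from the angle.\<close>
  have "radial_deriv m r \<theta> - \<i> * angular_deriv m r \<theta> = of_real (r ^ (m + 1)) * c * (of_real (2 * real m + 2) * of_real (F_powr \<zeta>) + of_real p * (of_real (Re w) + \<i> * of_real (Im w)))"
    unfolding rad ang by (simp add: algebra_simps)
  also have "\<dots> = of_real r * (of_nat (2 * (m + 1)) * (\<zeta> ^ m * of_real (F_powr \<zeta>)) + of_real p * (\<zeta> ^ m * w))"
    unfolding w[symmetric] \<zeta>m by (simp add: algebra_simps)
  also have "of_real (F_powr \<zeta>) = J (F \<zeta>) * F \<zeta>" by (simp add: F_powr_def dual_power_mult_self)
  finally show ?thesis
    unfolding disc_density_def \<zeta>_def[symmetric] w_def by (simp add: scaleR_conv_of_real mult_ac)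
qed

lemma integrable_polar_F_powr:
  "integrable polar_rect (\<lambda>(r, \<theta>). r * F_powr (polar r \<theta>))"
  using integrable_F_powr integrable_disc_polar[OF F_powr_measurable]
  by (simp add: F_powr_def[abs_def] case_prod_unfold polar_point_def)

lemma integrable_polar_weighted_deriv:
  "integrable polar_rect (\<lambda>(r, \<theta>). r * weighted_deriv (polar r \<theta>))"
  using integrable_powr_derivative integrable_disc_polar[OF weighted_deriv_measurable]
  by (simp add: weighted_deriv_def[abs_def] case_prod_unfold polar_point_def)

lemma polar_compose_measurable:
  "g \<in> borel_measurable disc \<Longrightarrow>
    (\<lambda>x. g (of_real (fst x) * cis (snd x))) \<in> borel_measurable polar_rect"
  using measurable_compose[OF polar_point_measurable, of g] by (simp add: polar_point_def)

lemma integrable_polar_dominated: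
  fixes g :: "real \<Rightarrow> real \<Rightarrow> complex"
  assumes "(\<lambda>x. g (fst x) (snd x)) \<in> borel_measurable polar_rect"
    and "\<And>r \<theta>. 0 \<le> r \<Longrightarrow> r < 1 \<Longrightarrow>
      norm (g r \<theta>) \<le> a * (r * F_powr (polar r \<theta>)) + p * (r * weighted_deriv (polar r \<theta>))"
  shows "integrable polar_rect (\<lambda>(r, \<theta>). g r \<theta>)"
proof (rule Bochner_Integration.integrable_bound)
  show "integrable polar_rect
     (\<lambda>(r, \<theta>). a * (r * F_powr (polar r \<theta>)) + p * (r * weighted_deriv (polar r \<theta>)))"
    using integrable_polar_F_powr integrable_polar_weighted_deriv unfolding case_prod_unfold
    by (intro Bochner_Integration.integrable_add integrable_mult_right)
qed (use assms in \<open>auto intro!: AE_I2 order_trans[OF _ abs_ge_self] simp: space_pair_measure case_prod_unfold\<close>)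

lemma integrable_radial_deriv:
  "integrable polar_rect (\<lambda>(r, \<theta>). radial_deriv m r \<theta>)"
  and integrable_angular_deriv:
  "integrable polar_rect (\<lambda>(r, \<theta>). angular_deriv m r \<theta>)"
proof -
  note [measurable] = polar_compose_measurable[OF F_powr_measurable] polar_compose_measurable[OF F_measurable]
    polar_compose_measurable[OF F'_measurable]
  have "(\<lambda>x. radial_deriv m (fst x) (snd x)) \<in> borel_measurable polar_rect"
    unfolding radial_deriv_def by measurable
  then show "integrable polar_rect (\<lambda>(r, \<theta>). radial_deriv m r \<theta>)"
    using norm_radial_deriv_le by (rule integrable_polar_dominated)
  have "(\<lambda>x. angular_deriv m (fst x) (snd x)) \<in> borel_measurable polar_rect"
    unfolding angular_deriv_def by measurable
  then show "integrable polar_rect (\<lambda>(r, \<theta>). angular_deriv m r \<theta>)"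
    using norm_angular_deriv_le by (rule integrable_polar_dominated)
qed

lemma integrable_disc_density_parts:
  "integrable disc (\<lambda>z. J (F z) * (z ^ m * F z))"
  "integrable disc (\<lambda>z. J (F z) * (z ^ m * (z * F' z)))"
proof -
  show "integrable disc (\<lambda>z. J (F z) * (z ^ m * F z))"
    using p by (intro integrable_dual_power in_bergman_power_mult bergman_F) auto
  show "integrable disc (\<lambda>z. J (F z) * (z ^ m * (z * F' z)))"
  proof (rule Bochner_Integration.integrable_bound[OF integrable_powr_derivative])
    show "AE z in disc. norm (J (F z) * (z ^ m * (z * F' z))) \<le> norm (norm (F z) powr (p - 1) * norm (z * F' z))"
    proof (rule AE_I2)
      fix z assume "z \<in> space disc"
      then have "norm (z ^ m) \<le> 1" by (simp add: norm_power power_le_one)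
      then have "norm (z ^ m) * (norm (F z) powr (p - 1) * norm (z * F' z)) \<le> 1 * (norm (F z) powr (p - 1) * norm (z * F' z))"
        by (intro mult_right_mono) auto
      then show "norm (J (F z) * (z ^ m * (z * F' z))) \<le> norm (norm (F z) powr (p - 1) * norm (z * F' z))"
        by (simp add: norm_mult norm_dual_power mult_ac)
    qed
  qed measurable
qed

text \<open>\<open>radial_angular_deriv\<close> is integrated over the polar rectangle. The angular
  derivative integrates to 0 on every circle by periodicity; the radial one is integrated along rays
  first, where it will produce the boundary term.\<close>

lemma integral_radial_deriv:
  "(\<integral>\<theta>. (\<integral>r. radial_deriv m r \<theta> \<partial>radius) \<partial>angle) = (\<integral>z. disc_density m z \<partial>disc)"
proof -
  have [measurable]: "disc_density m \<in> borel_measurable disc"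
    unfolding disc_density_def[abs_def] by measurable
  have "(\<integral>z. disc_density m z \<partial>disc) =
     (\<integral>x. fst x *\<^sub>R disc_density m (of_real (fst x) * cis (snd x)) \<partial>polar_rect)"
    by (subst integral_disc_polar) (auto simp: polar_point_def)
  also have "\<dots> = (\<integral>x. (case x of (r, \<theta>) \<Rightarrow> radial_deriv m r \<theta>) - \<i> * (case x of (r, \<theta>) \<Rightarrow> angular_deriv m r \<theta>) \<partial>polar_rect)"
    by (simp add: case_prod_unfold radial_angular_deriv)
  also have "\<dots> = (\<integral>x. (case x of (r, \<theta>) \<Rightarrow> radial_deriv m r \<theta>) \<partial>polar_rect)
     - (\<integral>x. \<i> * (case x of (r, \<theta>) \<Rightarrow> angular_deriv m r \<theta>) \<partial>polar_rect)"
    by (intro Bochner_Integration.integral_diff integrable_radial_deriv integrable_mult_right integrable_angular_deriv)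
  also have "(\<integral>x. \<i> * (case x of (r, \<theta>) \<Rightarrow> angular_deriv m r \<theta>) \<partial>polar_rect) = 0"
  proof -
    have "(\<integral>\<theta>. angular_deriv m r \<theta> \<partial>angle) = 0" if "r \<in> space radius" for r
    proof (rule integral_angle_FTC)
      show "((\<lambda>\<theta>. of_real (r ^ (m + 1)) * (cis (real m * \<theta>) * of_real (F_powr (polar r \<theta>))))
          has_vector_derivative angular_deriv m r \<theta>) (at \<theta>)" for \<theta>
        using that by (intro has_angular_deriv) auto
      show "continuous_on UNIV (angular_deriv m r)"
        using that continuous_on_angular_deriv[of r m] by auto
      show "of_real (r ^ (m + 1)) * (cis (real m * (2 * pi)) * of_real (F_powr (of_real r * cis (2 * pi)))) =
          of_real (r ^ (m + 1)) * (cis (real m * 0) * of_real (F_powr (of_real r * cis 0)))"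
        using cis_int_2pi[of "int m"] by simp
    qed
    then have "(\<integral>r. (\<integral>\<theta>. angular_deriv m r \<theta> \<partial>angle) \<partial>radius) = (\<integral>r. 0 \<partial>radius)"
      by (intro Bochner_Integration.integral_cong) auto
    then have "(\<integral>x. (case x of (r, \<theta>) \<Rightarrow> angular_deriv m r \<theta>) \<partial>polar_rect) = 0"
      by (subst polar.integral_fst[OF integrable_angular_deriv, symmetric]) simp
    then show ?thesis by (subst integral_mult_right_zero) simp
  qed
  finally show ?thesis
    by (subst polar.integral_snd[OF integrable_radial_deriv]) simp
qed

section \<open>Boundary behaviour along almost every ray\<close>

definition regular_ray :: "real \<Rightarrow> bool" where
  "regular_ray \<theta> \<longleftrightarrow> integrable radius (\<lambda>r. r * F_powr (polar r \<theta>)) \<and>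
     integrable radius (\<lambda>r. r * weighted_deriv (polar r \<theta>))"

text \<open>Fubini applied to the two functions that are integrable over the disc; every pointwise
  statement about boundary values is made on these rays.\<close>

lemma AE_regular_ray: "AE \<theta> in angle. regular_ray \<theta>"
  using polar.AE_integrable_snd[OF integrable_polar_F_powr] polar.AE_integrable_snd[OF integrable_polar_weighted_deriv]
  by eventually_elim (simp add: regular_ray_def)

lemma radius_measurable:
  fixes g :: "real \<Rightarrow> 'a::real_normed_vector"
  assumes "continuous_on {0..<1} g"
  shows "g \<in> borel_measurable radius"
proof -
  have "continuous_on {0<..<1} g" using assms by (rule continuous_on_subset) auto
  then have "g \<in> borel_measurable (restrict_space borel {0<..<1})"
    by (rule borel_measurable_continuous_on_restrict)
  then show ?thesis
    unfolding radius_def by (simp cong: measurable_cong_sets add: sets_restrict_space)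
qed

text \<open>The integral along the ray of the bound for \<open>radial_deriv 0\<close>, whence the
  coefficient 2. It is an integrable function of the angle and plays the part of a radial maximal
  function.\<close>

definition ray_bound :: "real \<Rightarrow> real" where
  "ray_bound \<theta> = (\<integral>r. 2 * (r * F_powr (polar r \<theta>)) + p * (r * weighted_deriv (polar r \<theta>)) \<partial>radius)"

lemma integrable_ray_bound: "integrable angle ray_bound"
proof -
  have "integrable polar_rect
     (\<lambda>(r, \<theta>). 2 * (r * F_powr (polar r \<theta>)) + p * (r * weighted_deriv (polar r \<theta>)))"
    using integrable_polar_F_powr integrable_polar_weighted_deriv unfolding case_prod_unfold
    by (intro Bochner_Integration.integrable_add integrable_mult_right)
  from polar.integrable_snd[OF this] show ?thesis by (simp add: ray_bound_def[abs_def])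
qed

context
  fixes \<theta> :: real
  assumes regular: "regular_ray \<theta>"
begin

lemma ray_integrable_bound:
  "integrable radius (\<lambda>r. a * (r * F_powr (polar r \<theta>)) + p * (r * weighted_deriv (polar r \<theta>)))"
  using regular unfolding regular_ray_def
  by (intro Bochner_Integration.integrable_add integrable_mult_right) auto

lemma ray_integrable_radial_deriv: "integrable radius (\<lambda>r. radial_deriv m r \<theta>)"
proof (rule Bochner_Integration.integrable_bound[OF ray_integrable_bound[of "real (m + 2)"]])
  show "(\<lambda>r. radial_deriv m r \<theta>) \<in> borel_measurable radius"
    by (rule radius_measurable[OF continuous_on_radial_deriv])
  show "AE r in radius. norm (radial_deriv m r \<theta>) \<le>
     norm (real (m + 2) * (r * F_powr (polar r \<theta>)) + p * (r * weighted_deriv (polar r \<theta>)))"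
    using norm_radial_deriv_le[of _ m \<theta>]
    by (auto intro!: AE_I2 order_trans[OF _ abs_ge_self])
qed

lemma ray_integrable_radial_deriv':
  "integrable radius (\<lambda>r. indicator {0..} r *\<^sub>R radial_deriv m r \<theta>)"
proof -
  have "integrable radius (\<lambda>r. indicator {0..} r *\<^sub>R radial_deriv m r \<theta>) \<longleftrightarrow>
      integrable radius (\<lambda>r. radial_deriv m r \<theta>)"
    by (intro Bochner_Integration.integrable_cong) (auto simp: indicator_def)
  then show ?thesis using ray_integrable_radial_deriv by simp
qed

text \<open>The antiderivative vanishes at r = 0 owing to the factor r^(m+2), so the limit at the
  circle is the whole integral with no inner boundary term.\<close>

lemma ray_tendsto:
  "((\<lambda>r. cis (real m * \<theta>) * of_real (r ^ (m + 2) * F_powr (polar r \<theta>))) \<longlongrightarrow>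
    (\<integral>r. radial_deriv m r \<theta> \<partial>radius)) (at_left 1)"
proof -
  have "(\<integral>r. indicator {0..} r *\<^sub>R radial_deriv m r \<theta> \<partial>radius) = (\<integral>r. radial_deriv m r \<theta> \<partial>radius)"
    by (intro Bochner_Integration.integral_cong) (auto simp: indicator_def)
  moreover have "((\<lambda>r. cis (real m * \<theta>) * of_real (r ^ (m + 2) * F_powr (polar r \<theta>))) \<longlongrightarrow>
      cis (real m * \<theta>) * of_real (0 ^ (m + 2) * F_powr (of_real 0 * cis \<theta>)) +
      (\<integral>r. indicator {0..} r *\<^sub>R radial_deriv m r \<theta> \<partial>radius)) (at_left 1)"
    by (rule radial_FTC_tendsto[OF _ _ has_radial_deriv continuous_on_radial_deriv ray_integrable_radial_deriv']) auto
  ultimately show ?thesis by simp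
qed

text \<open>The case m = 0: r^2 |F|^p starts at 0 and its total variation along the ray is at most
  \<open>ray_bound\<close>. The 4 is the inverse square of the smallest radius 1/2.\<close>

lemma F_powr_le_ray_bound:
  assumes r: "1 / 2 \<le> r" "r < 1"
  shows "F_powr (polar r \<theta>) \<le> 4 * ray_bound \<theta>"
proof -
  define G where "G r = cis (real 0 * \<theta>) * of_real (r ^ (0 + 2) * F_powr (polar r \<theta>))" for r
  have "norm (G r - G 0) \<le> (\<integral>r. norm (indicator {0..} r *\<^sub>R radial_deriv 0 r \<theta>) \<partial>radius)"
    unfolding G_def
    by (rule radial_FTC_bound[OF _ _ has_radial_deriv continuous_on_radial_deriv ray_integrable_radial_deriv'])
       (use r in auto)
  also have "\<dots> \<le> ray_bound \<theta>"
    unfolding ray_bound_def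
  proof (rule integral_mono)
    show "integrable radius (\<lambda>r. norm (indicator {0..} r *\<^sub>R radial_deriv 0 r \<theta>))"
      by (intro integrable_norm ray_integrable_radial_deriv')
    show "integrable radius (\<lambda>r. 2 * (r * F_powr (polar r \<theta>)) + p * (r * weighted_deriv (polar r \<theta>)))"
      by (rule ray_integrable_bound)
    fix r assume "r \<in> space radius"
    then show "norm (indicator {0..} r *\<^sub>R radial_deriv 0 r \<theta>) \<le> 2 * (r * F_powr (polar r \<theta>)) + p * (r * weighted_deriv (polar r \<theta>))"
      using norm_radial_deriv_le[of r 0 \<theta>] by (auto simp: indicator_def)
  qed
  finally have "r\<^sup>2 * F_powr (polar r \<theta>) \<le> ray_bound \<theta>"
    using F_powr_nonneg[of "polar r \<theta>"] by (simp add: G_def norm_mult abs_mult norm_power power2_eq_square)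
  moreover have "(1 / 2)\<^sup>2 * F_powr (polar r \<theta>) \<le> r\<^sup>2 * F_powr (polar r \<theta>)"
    using r by (intro mult_right_mono power_mono F_powr_nonneg) auto
  ultimately show ?thesis by (simp add: power2_eq_square)
qed

text \<open>If the limit of \<open>|F|\<^sup>p\<close> along the ray is positive, then \<open>|F|\<close> is bounded below near the boundary,
  so that integrability of \<open>|F|\<^sup>p\<^sup>-\<^sup>1 |F'|\<close> implies that of \<open>|F'|\<close>.\<close>

lemma ray_limit_exists: "\<exists>l. ((\<lambda>r. F (polar r \<theta>)) \<longlongrightarrow> l) (at_left 1)"
proof -
  define f where "f r = F (polar r \<theta>)" for r
  define h where "h r = F_powr (polar r \<theta>)" for r
  have one: "((\<lambda>r::real. r) \<longlongrightarrow> 1) (at_left 1)" by (rule tendsto_ident_at)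
  have gt: "\<forall>\<^sub>F r in at_left 1. r \<in> {0<..<1::real}" by (rule eventually_at_left_real) simp
  define L where "L = (\<integral>r. radial_deriv 0 r \<theta> \<partial>radius)"
  have L: "((\<lambda>r. of_real (r ^ 2 * h r)) \<longlongrightarrow> L) (at_left 1)"
    using ray_tendsto[of 0] by (simp add: h_def L_def power2_eq_square)
  from tendsto_Re[OF L] have "((\<lambda>r. r ^ 2 * h r) \<longlongrightarrow> Re L) (at_left 1)" by simp
  then have "((\<lambda>r. r ^ 2 * h r / r ^ 2) \<longlongrightarrow> Re L / 1 ^ 2) (at_left 1)"
    by (intro tendsto_divide tendsto_power one) auto
  moreover have "\<forall>\<^sub>F r in at_left 1. r ^ 2 * h r / r ^ 2 = h r"
    using gt by eventually_elim simp
  ultimately have "(h \<longlongrightarrow> Re L / 1 ^ 2) (at_left 1)" by (rule Lim_transform_eventually)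
  then have hL: "(h \<longlongrightarrow> Re L) (at_left 1)" by simp
  have "0 \<le> Re L"
    by (rule tendsto_lowerbound[OF hL]) (auto simp: h_def F_powr_nonneg)
  then consider "Re L = 0" | "0 < Re L" by linarith
  then show ?thesis
  proof cases
    \<comment> \<open>If |F|^p tends to 0, then so does \<open>F\<close>, whatever its argument
      does; no information on the derivative enters.\<close>
    case 1
    have "((\<lambda>r. h r powr (1 / p)) \<longlongrightarrow> 0 powr (1 / p)) (at_left 1)"
    proof -
      have "\<forall>\<^sub>F r in at_left 1. 0 \<le> h r" by (simp add: h_def F_powr_nonneg)
      then have "((\<lambda>r. h r powr (1 / p)) \<longlongrightarrow> Re L powr (1 / p)) (at_left 1)"
        using p by (intro tendsto_powr'[OF hL tendsto_const]) auto
      then show ?thesis by (simp only: 1)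
    qed
    moreover have "h r powr (1 / p) = norm (f r)" for r
      using p by (simp add: h_def F_powr_def f_def powr_powr)
    ultimately have "((\<lambda>r. norm (f r)) \<longlongrightarrow> 0) (at_left 1)" by simp
    then show ?thesis unfolding f_def by (auto simp: tendsto_norm_zero_iff)
  next
    case 2
    then have "\<forall>\<^sub>F r in at_left 1. Re L / 2 < h r" by (intro order_tendstoD(1)[OF hL]) simp
    from iffD1[OF eventually_at_left[OF zero_less_one] this]
    obtain b where b: "b < 1" "\<And>r. b < r \<Longrightarrow> r < 1 \<Longrightarrow> Re L / 2 < h r"
      by blast
    \<comment> \<open>Beyond \<open>b\<close> the lower bound on |F|^p holds; the value 1/2 keeps r
      away from 0, so that powers of r can be divided out.\<close>
    define a where "a = max (1 / 2) ((b + 1) / 2)"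
    have "b < (b + 1) / 2" "(b + 1) / 2 < 1" using b(1) by simp_all
    then have a: "1 / 2 \<le> a" "a < 1" "b < a" unfolding a_def by linarith+
    \<comment> \<open>The lower bound Re L / 2 for |F|^p, converted into one for |F|^(p-1).\<close>
    define \<delta> where "\<delta> = (Re L / 2) powr ((p - 1) / p)"
    have \<delta>: "0 < \<delta>" using 2 by (simp add: \<delta>_def)
    have low: "\<delta> \<le> norm (f r) powr (p - 1)" if "a \<le> r" "r < 1" for r
    proof -
      have "\<delta> \<le> h r powr ((p - 1) / p)"
        unfolding \<delta>_def using b(2)[of r] that a p 2 by (intro powr_mono2) auto
      also have "\<dots> = norm (f r) powr (p - 1)"
        using p by (simp add: h_def F_powr_def f_def powr_powr)
      finally show ?thesis .
    qed
    have cont: "continuous_on {0..<1} (\<lambda>r. cis \<theta> * F' (polar r \<theta>))"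
      by (intro continuous_intros continuous_on_compose2[OF continuous_on_F']) (auto simp: norm_mult)
    have [measurable]: "(\<lambda>r. cis \<theta> * F' (polar r \<theta>)) \<in> borel_measurable radius"
      by (rule radius_measurable[OF cont])
    have "indicator {a..} \<in> borel_measurable radius"
      by (intro borel_measurable_radius borel_measurable_indicator) auto
    then have meas: "(\<lambda>r. indicator {a..} r *\<^sub>R (cis \<theta> * F' (polar r \<theta>))) \<in> borel_measurable radius"
      by measurable
    have int: "integrable radius (\<lambda>r. indicator {a..} r *\<^sub>R (cis \<theta> * F' (polar r \<theta>)))"
    proof (rule Bochner_Integration.integrable_bound[OF _ meas])
      show "integrable radius (\<lambda>r. 4 / \<delta> * (r * weighted_deriv (polar r \<theta>)))"
        using regular by (intro integrable_mult_right) (simp add: regular_ray_def)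
      show "AE r in radius. norm (indicator {a..} r *\<^sub>R (cis \<theta> * F' (polar r \<theta>)))
         \<le> norm (4 / \<delta> * (r * weighted_deriv (polar r \<theta>)))"
      proof (rule AE_I2)
        fix r assume "r \<in> space radius"
        then have r: "0 < r" "r < 1" by auto
        show "norm (indicator {a..} r *\<^sub>R (cis \<theta> * F' (polar r \<theta>)))
         \<le> norm (4 / \<delta> * (r * weighted_deriv (polar r \<theta>)))"
        proof (cases "a \<le> r")
          case True
          define n where "n = norm (F' (polar r \<theta>))"
          \<comment> \<open>One factor r is the area weight and the other is |z| inside
            \<open>weighted_deriv\<close>; both are at least 1/2, which yields the 4.\<close>
          have "(1 / 2) * (1 / 2) * \<delta> * n \<le> r * r * norm (f r) powr (p - 1) * n"
            using True a r \<delta> low[OF True r(2)] by (intro mult_mono) (auto simp: n_def)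
          also have "\<dots> = r * weighted_deriv (polar r \<theta>)"
            using r by (simp add: weighted_deriv_def f_def n_def norm_mult)
          finally have "n \<le> 4 / \<delta> * (r * weighted_deriv (polar r \<theta>))"
            using \<delta> by (simp add: field_simps)
          also have "\<dots> \<le> norm (4 / \<delta> * (r * weighted_deriv (polar r \<theta>)))"
            by (simp only: real_norm_def abs_ge_self)
          finally show ?thesis using True by (simp add: n_def norm_mult)
        next
          case False
          then show ?thesis by simp
        qed
      qed
    qed
    have "(f \<longlongrightarrow> f a + (\<integral>r. indicator {a..} r *\<^sub>R (cis \<theta> * F' (polar r \<theta>)) \<partial>radius)) (at_left 1)"
    proof (rule radial_FTC_tendsto[OF _ _ _ _ int])
      show "(f has_vector_derivative cis \<theta> * F' (polar r \<theta>)) (at r)" if "a \<le> r" "r < 1" for r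
        unfolding f_def using that a by (intro has_vector_derivative_radial holomorphic_F) auto
      show "continuous_on {a..<1} (\<lambda>r. cis \<theta> * F' (polar r \<theta>))"
        using a by (intro continuous_on_subset[OF cont]) auto
    qed (use a in auto)
    then show ?thesis unfolding f_def by blast
  qed
qed

lemma ray_boundary_tendsto: "((\<lambda>r. F (polar r \<theta>)) \<longlongrightarrow> boundary_val F \<theta>) (at_left 1)"
  using ray_limit_exists boundary_val_eqI by metis

text \<open>The same expression has two limits along the ray: the integral, by
  \<open>ray_tendsto\<close>, and its value at the circle, since \<open>F\<close> tends to
  \<open>boundary_val F \<theta>\<close>.\<close>

lemma ray_integral_radial_deriv:
  "(\<integral>r. radial_deriv m r \<theta> \<partial>radius) = of_real (norm (boundary_val F \<theta>) powr p) * cis (real m * \<theta>)"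
proof -
  have "((\<lambda>r. cis (real m * \<theta>) * of_real (r ^ (m + 2) * F_powr (polar r \<theta>))) \<longlongrightarrow>
     cis (real m * \<theta>) * of_real (1 ^ (m + 2) * norm (boundary_val F \<theta>) powr p)) (at_left 1)"
    unfolding F_powr_def using p
    by (intro tendsto_intros tendsto_powr' ray_boundary_tendsto) auto
  from tendsto_unique[OF trivial_limit_at_left_real ray_tendsto this]
  show ?thesis by (simp add: mult.commute)
qed

end

section \<open>Boundary integrals and Fourier coefficients on the circle\<close>

lemma integral_boundary_powr:
  "(\<integral>\<theta>. of_real (norm (boundary_val F \<theta>) powr p) * cis (real m * \<theta>) \<partial>angle) =
    (\<integral>z. disc_density m z \<partial>disc)"
proof -
  have [measurable]: "boundary_val F \<in> borel_measurable angle"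
    by (intro borel_measurable_angle boundary_val_measurable holomorphic_F)
  have "(\<integral>\<theta>. of_real (norm (boundary_val F \<theta>) powr p) * cis (real m * \<theta>) \<partial>angle) =
     (\<integral>\<theta>. (\<integral>r. radial_deriv m r \<theta> \<partial>radius) \<partial>angle)"
  proof (rule integral_cong_AE)
    show "(\<lambda>\<theta>. \<integral>r. radial_deriv m r \<theta> \<partial>radius) \<in> borel_measurable angle"
      using polar.integrable_snd[OF integrable_radial_deriv[of m]] by auto
    show "AE \<theta> in angle. of_real (norm (boundary_val F \<theta>) powr p) * cis (real m * \<theta>) = (\<integral>r. radial_deriv m r \<theta> \<partial>radius)"
      using AE_regular_ray by eventually_elim (simp add: ray_integral_radial_deriv)
  qed measurable
  then show ?thesis by (simp add: integral_radial_deriv)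
qed

lemma norm_F_le_ray_bound:
  assumes "regular_ray \<theta>" "1 / 2 \<le> r" "r < 1"
  shows "norm (F (polar r \<theta>)) \<le> 1 + 4 * ray_bound \<theta>"
  using le_one_add_powr[of p "norm (F (polar r \<theta>))"] F_powr_le_ray_bound[OF assms] p
  by (simp add: F_powr_def)

lemma integrable_boundary: "integrable angle (\<lambda>\<theta>. boundary_val F \<theta> * cis (of_int l * \<theta>))"
proof (rule Bochner_Integration.integrable_bound)
  show "integrable angle (\<lambda>\<theta>. 1 + 4 * ray_bound \<theta>)"
    using integrable_ray_bound by auto
  have [measurable]: "boundary_val F \<in> borel_measurable angle"
    by (intro borel_measurable_angle boundary_val_measurable holomorphic_F)
  show "(\<lambda>\<theta>. boundary_val F \<theta> * cis (of_int l * \<theta>)) \<in> borel_measurable angle" by measurable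
  show "AE \<theta> in angle. norm (boundary_val F \<theta> * cis (of_int l * \<theta>)) \<le> norm (1 + 4 * ray_bound \<theta>)"
    using AE_regular_ray
  proof eventually_elim
    case (elim \<theta>)
    have "\<forall>\<^sub>F r in at_left 1. r \<in> {1 / 2<..<1::real}" by (rule eventually_at_left_real) simp
    then have "\<forall>\<^sub>F r in at_left 1. norm (F (polar r \<theta>)) \<le> 1 + 4 * ray_bound \<theta>"
      by eventually_elim (rule norm_F_le_ray_bound[OF elim], auto)
    then have "norm (boundary_val F \<theta>) \<le> 1 + 4 * ray_bound \<theta>"
      by (rule tendsto_upperbound[OF tendsto_norm[OF ray_boundary_tendsto[OF elim]]]) simp
    then show ?case by (simp add: norm_mult)
  qed
qed

text \<open>The coefficient formula on circles of radius r passes to r = 1 by dominated convergence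
  with majorant \<open>1 + 4 * ray_bound \<theta>\<close>; this takes the place of mean convergence
  in Hardy space.\<close>

lemma boundary_coefficient:
  "(\<integral>\<theta>. boundary_val F \<theta> * cis (of_int l * \<theta>) \<partial>angle) = of_real (2 * pi) * taylor_coeff F (- l)"
proof -
  have [measurable]: "boundary_val F \<in> borel_measurable angle"
    by (intro borel_measurable_angle boundary_val_measurable holomorphic_F)
  have "((\<lambda>r. \<integral>\<theta>. F (polar r \<theta>) * cis (of_int l * \<theta>) \<partial>angle) \<longlongrightarrow>
     (\<integral>\<theta>. boundary_val F \<theta> * cis (of_int l * \<theta>) \<partial>angle)) (at_left 1)"
  proof (rule dominated_convergence_at_within)
    show "integrable angle (\<lambda>\<theta>. 1 + 4 * ray_bound \<theta>)"
      using integrable_ray_bound by auto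
    show "(\<lambda>\<theta>. boundary_val F \<theta> * cis (of_int l * \<theta>)) \<in> borel_measurable angle" by measurable
    show "AE \<theta> in angle. ((\<lambda>r. F (polar r \<theta>) * cis (of_int l * \<theta>)) \<longlongrightarrow> boundary_val F \<theta> * cis (of_int l * \<theta>)) (at_left 1)"
      using AE_regular_ray by eventually_elim (intro tendsto_mult tendsto_const ray_boundary_tendsto)
    have "\<forall>\<^sub>F r in at_left 1. r \<in> {1 / 2<..<1::real}" by (rule eventually_at_left_real) simp
    then show "\<forall>\<^sub>F r in at_left 1. (\<lambda>\<theta>. F (polar r \<theta>) * cis (of_int l * \<theta>)) \<in> borel_measurable angle \<and>
        (AE \<theta> in angle. norm (F (polar r \<theta>) * cis (of_int l * \<theta>)) \<le> 1 + 4 * ray_bound \<theta>)"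
    proof eventually_elim
      case (elim r)
      have "continuous_on UNIV (\<lambda>\<theta>. F (polar r \<theta>) * cis (of_int l * \<theta>))"
        by (intro continuous_intros continuous_on_compose2[OF continuous_on_F]) (use elim in \<open>auto simp: norm_mult\<close>)
      then have "(\<lambda>\<theta>. F (polar r \<theta>) * cis (of_int l * \<theta>)) \<in> borel_measurable angle"
        by (intro borel_measurable_angle borel_measurable_continuous_onI)
      moreover have "AE \<theta> in angle. norm (F (polar r \<theta>) * cis (of_int l * \<theta>)) \<le> 1 + 4 * ray_bound \<theta>"
        using AE_regular_ray
        by eventually_elim (use elim norm_F_le_ray_bound[of _ r] in \<open>auto simp: norm_mult\<close>)
      ultimately show ?case ..
    qed
  qed
  moreover have "((\<lambda>r. \<integral>\<theta>. F (polar r \<theta>) * cis (of_int l * \<theta>) \<partial>angle) \<longlongrightarrow>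
     of_real (2 * pi * 1 ^ nat (- l)) * taylor_coeff F (- l)) (at_left 1)"
  proof (rule Lim_transform_eventually)
    show "((\<lambda>r. of_real (2 * pi * r ^ nat (- l)) * taylor_coeff F (- l)) \<longlongrightarrow> of_real (2 * pi * 1 ^ nat (- l)) * taylor_coeff F (- l)) (at_left (1::real))"
      by (intro tendsto_intros)
    have "\<forall>\<^sub>F r in at_left 1. r \<in> {0<..<1::real}" by (rule eventually_at_left_real) simp
    then show "\<forall>\<^sub>F r in at_left 1. of_real (2 * pi * r ^ nat (- l)) * taylor_coeff F (- l) = (\<integral>\<theta>. F (polar r \<theta>) * cis (of_int l * \<theta>) \<partial>angle)"
      by eventually_elim (use circle_coefficient[OF holomorphic_F] in auto)
  qed
  ultimately show ?thesis
    using tendsto_unique[OF trivial_limit_at_left_real] by fastforce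
qed

end

text \<open>Termwise antiderivative in the segment parameter t. At z = 0 the defining quotient is 0
  by convention instead of the constant coefficient, hence the restriction; the formula is used on
  the unit circle.\<close>

lemma primitive_avg_eq:
  assumes "z \<noteq> 0"
  shows "primitive_avg k z = (\<Sum>j\<le>degree k. coeff k j * z ^ j / of_nat (j + 1))"
proof -
  define G where "G t = (\<Sum>j\<le>degree k. coeff k j * z ^ (j + 1) / of_nat (j + 1) * of_real t ^ (j + 1))" for t :: real
  have der: "(G has_vector_derivative poly k (of_real t * z) * z) (at t within {0..1})" for t
  proof -
    have "((\<lambda>w. \<Sum>j\<le>degree k. coeff k j * z ^ (j + 1) / of_nat (j + 1) * w ^ (j + 1)) has_field_derivative
       (\<Sum>j\<le>degree k. coeff k j * z ^ (j + 1) / of_nat (j + 1) * (of_nat (j + 1) * of_real t ^ j))) (at (of_real t))"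
      by (intro DERIV_sum DERIV_cmult DERIV_cong[OF DERIV_power[OF DERIV_ident]]) simp
    moreover have "(\<Sum>j\<le>degree k. coeff k j * z ^ (j + 1) / of_nat (j + 1) * (of_nat (j + 1) * of_real t ^ j)) = poly k (of_real t * z) * z"
      unfolding poly_altdef sum_distrib_right
      by (intro sum.cong refl) (simp add: power_mult_distrib del: of_nat_Suc of_nat_add)
    ultimately show ?thesis
      unfolding G_def[abs_def] by (intro has_vector_derivative_real_field) simp
  qed
  have "(LINT t:{0..1}|lborel. poly k (of_real t * z) * z) = G 1 - G 0"
    unfolding set_lebesgue_integral_def
    by (intro integral_FTC_atLeastAtMost der) (auto intro!: continuous_intros)
  then have "primitive_avg k z = (1 / z) * (\<Sum>j\<le>degree k. coeff k j * z ^ (j + 1) / of_nat (j + 1))"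
    by (simp add: primitive_avg_def G_def)
  also have "\<dots> = (\<Sum>j\<le>degree k. coeff k j * z ^ j / of_nat (j + 1))"
    unfolding sum_distrib_left using assms by (intro sum.cong refl) (simp add: field_simps del: of_nat_Suc of_nat_add)
  finally show ?thesis .
qed

theorem theorem3p1:
  fixes p :: real and k :: "complex poly" and F :: "complex \<Rightarrow> complex" and m :: nat
  assumes "1 < p" and "k \<noteq> 0" and "is_extremal p k F"
  shows "(LINT \<theta>:{0..2*pi}|lborel.
            complex_of_real (norm (boundary_val F \<theta>) powr p) * cis (real m * \<theta>))
           / complex_of_real (2 * pi)
       = (LINT \<theta>:{0..2*pi}|lborel.
            boundary_val F \<theta> * cis (real m * \<theta>) *
              (complex_of_real (p / 2) * cnj (poly k (cis \<theta>))
               + complex_of_real (1 - p / 2) * of_nat (m + 1) * cnj (primitive_avg k (cis \<theta>))))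
           / complex_of_real (2 * pi * functional_norm p k)"
proof -
  interpret bergman_extremal p k F using assms by unfold_locales
  \<comment> \<open>The factor that the bracket on the right-hand side attaches to the conjugate
    j-th coefficient of \<open>k\<close>: the first summand comes from \<open>k\<close>, the second,
    with denominator j + 1, from its averaged primitive.\<close>
  define c where "c j = p / 2 + (1 - p / 2) * real (m + 1) / real (j + 1)" for j
  define A where "A j = cnj (coeff k j) * (of_real (2 * pi) * taylor_coeff F (int j - int m))" for j
  \<comment> \<open>Over the common denominator the numerator is the combination produced by the two
    area integrals: 2(m + 1) from the undifferentiated term and p(j - m) from the differentiated
    one.\<close>
  have c: "c j = (2 * real (m + 1) + p * (real j - real m)) / (2 * real (j + 1))" for j
    by (simp add: c_def field_simps)
  have "(LINT \<theta>:{0..2*pi}|lborel. complex_of_real (norm (boundary_val F \<theta>) powr p) * cis (real m * \<theta>))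
     = (\<integral>z. disc_density m z \<partial>disc)"
    by (simp only: set_integral_angle_eq integral_boundary_powr)
  also have "\<dots> = of_nat (2 * (m + 1)) * (\<integral>z. J (F z) * (z ^ m * F z) \<partial>disc) + of_real p * (\<integral>z. J (F z) * (z ^ m * (z * F' z)) \<partial>disc)"
    unfolding disc_density_def
    by (simp add: integrable_disc_density_parts integrable_mult_right)
  also have "\<dots> = (\<Sum>j\<le>degree k. cnj (coeff k j) * (of_real (2 * real (m + 1) + p * (real j - real m)) * moment F m j)) / of_real M"
  proof -
    have "(\<integral>z. J (F z) * (z ^ m * F z) \<partial>disc) = (\<Sum>j\<le>degree k. cnj (coeff k j) * moment F m j) / of_real M"
      using integral_dual_power_moment[of m 0] by simp
    then show ?thesis
      unfolding integral_dual_power_derivative_moment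
      by (simp only: times_divide_eq_right add_divide_distrib[symmetric] sum_distrib_left sum.distrib[symmetric])
         (intro arg_cong2[where f="(/)"] sum.cong refl, simp add: algebra_simps)
  qed
  also have "(\<Sum>j\<le>degree k. cnj (coeff k j) * (of_real (2 * real (m + 1) + p * (real j - real m)) * moment F m j))
     = (\<Sum>j\<le>degree k. of_real (c j) * A j)"
  proof (intro sum.cong refl)
    fix j
    have "(2 * real (m + 1) + p * (real j - real m)) * (pi / real (j + 1)) = c j * (2 * pi)"
      unfolding c by (simp add: field_simps)
    then have "of_real (2 * real (m + 1) + p * (real j - real m)) * (of_real (pi / real (j + 1)) :: complex) = of_real (c j) * of_real (2 * pi)"
      by (simp only: of_real_mult[symmetric])
    then have "of_real (2 * real (m + 1) + p * (real j - real m)) * moment F m j = of_real (c j) * of_real (2 * pi) * taylor_coeff F (int j - int m)"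
      unfolding moment_eq[OF holomorphic_F integrable_F] by (simp only: mult.assoc[symmetric])
    then show "cnj (coeff k j) * (of_real (2 * real (m + 1) + p * (real j - real m)) * moment F m j) = of_real (c j) * A j"
      by (simp only: A_def mult_ac)
  qed
  finally have lhs: "(LINT \<theta>:{0..2*pi}|lborel. complex_of_real (norm (boundary_val F \<theta>) powr p) * cis (real m * \<theta>))
     = (\<Sum>j\<le>degree k. of_real (c j) * A j) / of_real M" .
  have "boundary_val F \<theta> * cis (real m * \<theta>) *
          (complex_of_real (p / 2) * cnj (poly k (cis \<theta>))
           + complex_of_real (1 - p / 2) * of_nat (m + 1) * cnj (primitive_avg k (cis \<theta>)))
     = (\<Sum>j\<le>degree k. of_real (c j) * cnj (coeff k j) * (boundary_val F \<theta> * cis (of_int (int m - int j) * \<theta>)))" for \<theta>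
  proof -
    have "complex_of_real (p / 2) * cnj (poly k (cis \<theta>)) + complex_of_real (1 - p / 2) * of_nat (m + 1) * cnj (primitive_avg k (cis \<theta>))
       = (\<Sum>j\<le>degree k. of_real (c j) * cnj (coeff k j) * cnj (cis \<theta>) ^ j)"
    proof -
      have "complex_of_real (p / 2) * (cnj (coeff k j) * cnj (cis \<theta>) ^ j) +
          complex_of_real (1 - p / 2) * of_nat (m + 1) * (cnj (coeff k j) * cnj (cis \<theta>) ^ j / of_nat (j + 1))
          = of_real (c j) * cnj (coeff k j) * cnj (cis \<theta>) ^ j" for j
      proof -
        have "complex_of_real (c j) = complex_of_real (p / 2) + complex_of_real (1 - p / 2) * of_nat (m + 1) / of_nat (j + 1)"
          unfolding c_def by (simp del: of_nat_add of_nat_Suc)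
        then show ?thesis by (simp only:) (simp add: algebra_simps del: of_nat_add of_nat_Suc)
      qed
      then show ?thesis
        by (simp add: primitive_avg_eq poly_altdef sum_distrib_left sum.distrib[symmetric] del: of_nat_add of_nat_Suc)
    qed
    \<comment> \<open>The frequency m - j makes \<open>boundary_coefficient\<close> return the
      Taylor coefficient of index j - m, the same one as in \<open>moment_eq\<close>.\<close>
    moreover have "cis (of_int (int m - int j) * \<theta>) = cis (real m * \<theta>) * cnj (cis \<theta>) ^ j" for j
      using cis_power_mult_cnj[of \<theta> m j] by (simp add: Complex.DeMoivre)
    ultimately show ?thesis by (simp add: sum_distrib_left mult_ac)
  qed
  then have "(LINT \<theta>:{0..2*pi}|lborel. boundary_val F \<theta> * cis (real m * \<theta>) *
          (complex_of_real (p / 2) * cnj (poly k (cis \<theta>))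
           + complex_of_real (1 - p / 2) * of_nat (m + 1) * cnj (primitive_avg k (cis \<theta>))))
     = (\<integral>\<theta>. (\<Sum>j\<le>degree k. of_real (c j) * cnj (coeff k j) * (boundary_val F \<theta> * cis (of_int (int m - int j) * \<theta>))) \<partial>angle)"
    by (simp only: set_integral_angle_eq)
  also have "\<dots> = (\<Sum>j\<le>degree k. of_real (c j) * cnj (coeff k j) * (\<integral>\<theta>. boundary_val F \<theta> * cis (of_int (int m - int j) * \<theta>) \<partial>angle))"
    by (subst Bochner_Integration.integral_sum)
       (intro integrable_mult_right integrable_boundary, simp only: integral_mult_right_zero)
  also have "\<dots> = (\<Sum>j\<le>degree k. of_real (c j) * A j)"
    unfolding boundary_coefficient by (simp add: A_def mult_ac)
  finally show ?thesis
    unfolding lhs by (simp add: mult.commute)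
qed

end
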